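(* Let $\pi:(M,\varphi,\xi,\eta,g)\to(N,J,g')$ be a contact-complex Riemannian submersion whose total space $M$ satisfies $K_{1\varphi}$. Then: (i) if the O'Neill tensor $T$ is $\varphi$-bilinear, then the fibres (with the induced almost contact metric structure) satisfy $K_{1\varphi}$; (ii) if the O'Neill tensor $A$ vanishes, then the base space $N$ satisfies $K_1$.
   Context: All manifolds and maps are $C^\infty$. An almost contact metric manifold $(M,\varphi,\xi,\eta,g)$ has a $(1,1)$-tensor field $\varphi$, a vector field $\xi$, a 1-form $\eta$ and a Riemannian metric $g$ with $\varphi^2=-I+\eta\otimes\xi$, $\eta(\xi)=1$, $g(\varphi X,\varphi Y)=g(X,Y)-\eta(X)\eta(Y)$. A contact-complex Riemannian submersion is a (surjective) Riemannian submersion $\pi:M\to N$ from an almost contact metric manifold onto an almost Hermitian manifold $(N,J,g')$ such that $J\circ d\pi=d\pi\circ\varphi$. The vertical distribution is $\mathcal V=\ker d\pi$, the horizontal distribution $\mathcal H$ is its orthogonal complement, with orthogonal projections $v,h$. It is known that $\xi$ is vertical and $\mathcal V,\mathcal H$ are $\varphi$-invariant, so the fibres inherit almost contact metric structures. With $\nabla$ the Levi-Civita connection of $g$, the O'Neill tensors are $T_{\tilde X}\tilde Y=h\nabla_{v\tilde X}v\tilde Y+v\nabla_{v\tilde X}h\tilde Y$ and $A_{\tilde X}\tilde Y=v\nabla_{h\tilde X}h\tilde Y+h\nabla_{h\tilde X}v\tilde Y$. $T$ is $\varphi$-bilinear if $T_{\varphi U}W=T_U\varphi W=\varphi T_UW$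 for all vertical $U,W$. With $R$ the $(0,4)$ Riemann curvature tensor of the Levi-Civita connection of the manifold in question: an almost contact metric manifold satisfies $K_{1\varphi}$ if $R(X,Y,Z,W)=R(X,Y,\varphi Z,\varphi W)$ for all vector fields $X,Y,Z,W$; an almost Hermitian manifold satisfies $K_1$ if $R(X,Y,Z,W)=R(X,Y,JZ,JW)$ for all vector fields $X,Y,Z,W$. *)

theory Defs
  imports "HOL-Analysis.Analysis" "HOL-Library.Function_Algebras"
begin

section \<open>Smooth functions\<close>

text \<open>\<open>k\<close> times continuously differentiable on the open set \<open>U\<close>: all iterated directional
  derivatives up to order \<open>k\<close> exist as Frechet derivatives and are continuous.\<close>

primrec Ck_on :: "nat \<Rightarrow> 'a::real_normed_vector set \<Rightarrow> ('a \<Rightarrow> 'b::real_normed_vector) \<Rightarrow> bool" where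
  "Ck_on 0 U f \<longleftrightarrow> continuous_on U f"
| "Ck_on (Suc k) U f \<longleftrightarrow> (\<forall>x\<in>U. f differentiable (at x)) \<and>
     (\<forall>v. Ck_on k U (\<lambda>x. frechet_derivative f (at x) v))"

text \<open>Smoothness on an arbitrary subset: locally the restriction of a smooth function on an open
  set of the ambient space. It is used for relatively open subsets of linear subspaces.\<close>

definition smooth_on :: "'a::real_normed_vector set \<Rightarrow> ('a \<Rightarrow> 'b::real_normed_vector) \<Rightarrow> bool" where
  "smooth_on S f \<longleftrightarrow> (\<forall>x\<in>S. \<exists>U h. open U \<and> x \<in> U \<and> (\<forall>k. Ck_on k U h) \<and> (\<forall>y\<in>U \<inter> S. h y = f y))"


section \<open>Smooth manifolds\<close>

text \<open>A smooth structure on a subspace \<open>points\<close> of a topological space is recorded by its ring of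
  smooth real functions (equivalently, by the maximal atlas). Functions are total, their values
  outside \<open>points\<close> are irrelevant: membership in \<open>smooth_funs\<close> never depends on them.\<close>

record 'm smooth_space =
  points :: "'m set"
  smooth_funs :: "('m \<Rightarrow> real) set"

text \<open>The model space is an arbitrary linear subspace \<open>E\<close> of a Euclidean space, so that every
  dimension, including 0, is covered.\<close>

definition smooth_atlas ::
  "'a::euclidean_space set \<Rightarrow> 'm::topological_space set \<Rightarrow> ('m set \<times> ('m \<Rightarrow> 'a)) set \<Rightarrow> bool" where
  "smooth_atlas E S A \<longleftrightarrow>
     (\<Union>(U, \<psi>)\<in>A. U) = S \<and>
     (\<forall>(U, \<psi>)\<in>A. openin (top_of_set S) U \<and> openin (top_of_set E) (\<psi> ` U) \<and>
        homeomorphism U (\<psi> ` U) \<psi> (inv_into U \<psi>)) \<and>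
     (\<forall>(U, \<psi>)\<in>A. \<forall>(V, \<theta>)\<in>A. smooth_on (\<psi> ` (U \<inter> V)) (\<theta> \<circ> inv_into U \<psi>))"

definition atlas_smooth_funs ::
  "('m set \<times> ('m \<Rightarrow> 'a::euclidean_space)) set \<Rightarrow> ('m \<Rightarrow> real) set" where
  "atlas_smooth_funs A = {f. \<forall>(U, \<psi>)\<in>A. smooth_on (\<psi> ` U) (f \<circ> inv_into U \<psi>)}"

definition smooth_manifold ::
  "'a::euclidean_space set \<Rightarrow>
   ('m::{t2_space, second_countable_topology}, 'z) smooth_space_scheme \<Rightarrow> bool" where
  "smooth_manifold E M \<longleftrightarrow> subspace E \<and>
     (\<exists>A. smooth_atlas E (points M) A \<and> smooth_funs M = atlas_smooth_funs A)"

definition smooth_map ::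
  "('m::topological_space, 'y) smooth_space_scheme \<Rightarrow> ('n::topological_space, 'z) smooth_space_scheme
   \<Rightarrow> ('m \<Rightarrow> 'n) \<Rightarrow> bool" where
  "smooth_map M N \<pi> \<longleftrightarrow> \<pi> ` points M \<subseteq> points N \<and> continuous_on (points M) \<pi> \<and>
     (\<forall>f\<in>smooth_funs N. f \<circ> \<pi> \<in> smooth_funs M)"


section \<open>Tangent vectors and vector fields\<close>

text \<open>Tangent vectors at \<open>p\<close> are the derivations of the ring of smooth functions at \<open>p\<close>, set to 0 on
  non-smooth arguments so that equality is equality of functions. Vector fields are set to 0
  outside the manifold for the same reason. Sums of tangent vectors and of vector fields are the
  pointwise ones of the theory Function_Algebras.\<close>

type_synonym 'm tvec = "('m \<Rightarrow> real) \<Rightarrow> real"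
type_synonym 'm vfield = "'m \<Rightarrow> 'm tvec"

definition tscale :: "real \<Rightarrow> 'm tvec \<Rightarrow> 'm tvec" where
  "tscale c u = (\<lambda>f. c * u f)"

definition tangent :: "('m, 'z) smooth_space_scheme \<Rightarrow> 'm \<Rightarrow> 'm tvec set" where
  "tangent M p = {u.
     (\<forall>f. f \<notin> smooth_funs M \<longrightarrow> u f = 0) \<and>
     (\<forall>f\<in>smooth_funs M. \<forall>h\<in>smooth_funs M. u (\<lambda>x. f x + h x) = u f + u h) \<and>
     (\<forall>f\<in>smooth_funs M. \<forall>c. u (\<lambda>x. c * f x) = c * u f) \<and>
     (\<forall>f\<in>smooth_funs M. \<forall>h\<in>smooth_funs M. u (\<lambda>x. f x * h x) = f p * u h + h p * u f)}"

definition dmap :: "('n, 'z) smooth_space_scheme \<Rightarrow> ('m \<Rightarrow> 'n) \<Rightarrow> 'm tvec \<Rightarrow> 'n tvec" where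
  "dmap N \<pi> u = (\<lambda>f. if f \<in> smooth_funs N then u (f \<circ> \<pi>) else 0)"

definition vfields :: "('m, 'z) smooth_space_scheme \<Rightarrow> 'm vfield set" where
  "vfields M = {X. (\<forall>p\<in>points M. X p \<in> tangent M p) \<and> (\<forall>p. p \<notin> points M \<longrightarrow> X p = 0) \<and>
     (\<forall>f\<in>smooth_funs M. (\<lambda>p. X p f) \<in> smooth_funs M)}"

definition fscale :: "('m \<Rightarrow> real) \<Rightarrow> 'm vfield \<Rightarrow> 'm vfield" where
  "fscale a X = (\<lambda>p. tscale (a p) (X p))"

definition bracket :: "('m, 'z) smooth_space_scheme \<Rightarrow> 'm vfield \<Rightarrow> 'm vfield \<Rightarrow> 'm vfield" where
  "bracket M X Y = (\<lambda>p f. if f \<in> smooth_funs M then X p (\<lambda>q. Y q f) - Y p (\<lambda>q. X q f) else 0)"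

text \<open>Application of a field of endomorphisms of the tangent spaces to a vector field.\<close>

definition app :: "('m, 'z) smooth_space_scheme \<Rightarrow> ('m \<Rightarrow> 'm tvec \<Rightarrow> 'm tvec) \<Rightarrow> 'm vfield \<Rightarrow> 'm vfield"
  where "app M t X = (\<lambda>p. if p \<in> points M then t p (X p) else 0)"

definition smooth_endomorphism_field ::
  "('m, 'z) smooth_space_scheme \<Rightarrow> ('m \<Rightarrow> 'm tvec \<Rightarrow> 'm tvec) \<Rightarrow> bool" where
  "smooth_endomorphism_field M t \<longleftrightarrow>
     (\<forall>p\<in>points M. \<forall>u\<in>tangent M p. t p u \<in> tangent M p \<and>
        (\<forall>w\<in>tangent M p. t p (u + w) = t p u + t p w) \<and>
        (\<forall>c. t p (tscale c u) = tscale c (t p u))) \<and>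
     (\<forall>X\<in>vfields M. app M t X \<in> vfields M)"

definition smooth_one_form ::
  "('m, 'z) smooth_space_scheme \<Rightarrow> ('m \<Rightarrow> 'm tvec \<Rightarrow> real) \<Rightarrow> bool" where
  "smooth_one_form M a \<longleftrightarrow>
     (\<forall>p\<in>points M. \<forall>u\<in>tangent M p.
        (\<forall>w\<in>tangent M p. a p (u + w) = a p u + a p w) \<and>
        (\<forall>c. a p (tscale c u) = c * a p u)) \<and>
     (\<forall>X\<in>vfields M. (\<lambda>p. a p (X p)) \<in> smooth_funs M)"


section \<open>Riemannian manifolds, Levi-Civita connection, curvature\<close>

record 'm riem_space = "'m smooth_space" +
  metric_tensor :: "'m \<Rightarrow> 'm tvec \<Rightarrow> 'm tvec \<Rightarrow> real"

definition riemannian_manifold ::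
  "'a::euclidean_space set \<Rightarrow>
   ('m::{t2_space, second_countable_topology}, 'z) riem_space_scheme \<Rightarrow> bool" where
  "riemannian_manifold E M \<longleftrightarrow> smooth_manifold E M \<and>
     (\<forall>p\<in>points M. \<forall>u\<in>tangent M p.
        (u \<noteq> 0 \<longrightarrow> metric_tensor M p u u > 0) \<and>
        (\<forall>w\<in>tangent M p. metric_tensor M p u w = metric_tensor M p w u \<and>
           (\<forall>c. metric_tensor M p (tscale c u) w = c * metric_tensor M p u w) \<and>
           (\<forall>z\<in>tangent M p. metric_tensor M p (u + w) z = metric_tensor M p u z + metric_tensor M p w z))) \<and>
     (\<forall>X\<in>vfields M. \<forall>Y\<in>vfields M. (\<lambda>p. metric_tensor M p (X p) (Y p)) \<in> smooth_funs M)"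

definition affine_connection ::
  "('m, 'z) smooth_space_scheme \<Rightarrow> ('m vfield \<Rightarrow> 'm vfield \<Rightarrow> 'm vfield) \<Rightarrow> bool" where
  "affine_connection M D \<longleftrightarrow>
     (\<forall>X\<in>vfields M. \<forall>Y\<in>vfields M. D X Y \<in> vfields M \<and>
        (\<forall>Z\<in>vfields M. D (X + Y) Z = D X Z + D Y Z \<and> D X (Y + Z) = D X Y + D X Z) \<and>
        (\<forall>a\<in>smooth_funs M. D (fscale a X) Y = fscale a (D X Y) \<and>
           D X (fscale a Y) = fscale (\<lambda>p. X p a) Y + fscale a (D X Y)))"

definition is_levi_civita ::
  "('m, 'z) riem_space_scheme \<Rightarrow> ('m vfield \<Rightarrow> 'm vfield \<Rightarrow> 'm vfield) \<Rightarrow> bool" where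
  "is_levi_civita M D \<longleftrightarrow> affine_connection M D \<and>
     (\<forall>X\<in>vfields M. \<forall>Y\<in>vfields M. D X Y - D Y X = bracket M X Y) \<and>
     (\<forall>X\<in>vfields M. \<forall>Y\<in>vfields M. \<forall>Z\<in>vfields M. \<forall>p\<in>points M.
        X p (\<lambda>q. metric_tensor M q (Y q) (Z q)) =
        metric_tensor M p (D X Y p) (Z p) + metric_tensor M p (Y p) (D X Z p))"

text \<open>On vector fields the Levi-Civita connection of a Riemannian manifold is unique; the choice
  only concerns its irrelevant values on arguments that are not vector fields.\<close>

definition levi_civita :: "('m, 'z) riem_space_scheme \<Rightarrow> 'm vfield \<Rightarrow> 'm vfield \<Rightarrow> 'm vfield" where
  "levi_civita M = (SOME D. is_levi_civita M D)"

definition curvature_op ::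
  "('m, 'z) riem_space_scheme \<Rightarrow> 'm vfield \<Rightarrow> 'm vfield \<Rightarrow> 'm vfield \<Rightarrow> 'm vfield" where
  "curvature_op M X Y Z =
     (let D = levi_civita M in D X (D Y Z) - D Y (D X Z) - D (bracket M X Y) Z)"

definition riemann ::
  "('m, 'z) riem_space_scheme \<Rightarrow> 'm vfield \<Rightarrow> 'm vfield \<Rightarrow> 'm vfield \<Rightarrow> 'm vfield \<Rightarrow> 'm \<Rightarrow> real" where
  "riemann M X Y Z W p = metric_tensor M p (curvature_op M X Y Z p) (W p)"


section \<open>Almost contact metric and almost Hermitian manifolds\<close>

record 'm contact_space = "'m riem_space" +
  phi_tensor :: "'m \<Rightarrow> 'm tvec \<Rightarrow> 'm tvec"
  xi_field :: "'m vfield"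
  eta_form :: "'m \<Rightarrow> 'm tvec \<Rightarrow> real"

record 'm hermitian_space = "'m riem_space" +
  J_tensor :: "'m \<Rightarrow> 'm tvec \<Rightarrow> 'm tvec"

definition almost_contact_metric_manifold ::
  "'a::euclidean_space set \<Rightarrow>
   ('m::{t2_space, second_countable_topology}, 'z) contact_space_scheme \<Rightarrow> bool" where
  "almost_contact_metric_manifold E M \<longleftrightarrow> riemannian_manifold E M \<and>
     smooth_endomorphism_field M (phi_tensor M) \<and> xi_field M \<in> vfields M \<and>
     smooth_one_form M (eta_form M) \<and>
     (\<forall>p\<in>points M. eta_form M p (xi_field M p) = 1 \<and>
        (\<forall>u\<in>tangent M p.
           phi_tensor M p (phi_tensor M p u) = - u + tscale (eta_form M p u) (xi_field M p) \<and>
           (\<forall>w\<in>tangent M p. metric_tensor M p (phi_tensor M p u) (phi_tensor M p w) =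
              metric_tensor M p u w - eta_form M p u * eta_form M p w)))"

definition almost_hermitian_manifold ::
  "'a::euclidean_space set \<Rightarrow>
   ('m::{t2_space, second_countable_topology}, 'z) hermitian_space_scheme \<Rightarrow> bool" where
  "almost_hermitian_manifold E N \<longleftrightarrow> riemannian_manifold E N \<and>
     smooth_endomorphism_field N (J_tensor N) \<and>
     (\<forall>p\<in>points N. \<forall>u\<in>tangent N p.
        J_tensor N p (J_tensor N p u) = - u \<and>
        (\<forall>w\<in>tangent N p. metric_tensor N p (J_tensor N p u) (J_tensor N p w) = metric_tensor N p u w))"

definition K1_phi :: "('m, 'z) contact_space_scheme \<Rightarrow> bool" where
  "K1_phi M \<longleftrightarrow> (\<forall>X\<in>vfields M. \<forall>Y\<in>vfields M. \<forall>Z\<in>vfields M. \<forall>W\<in>vfields M. \<forall>p\<in>points M.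
     riemann M X Y Z W p =
     riemann M X Y (app M (phi_tensor M) Z) (app M (phi_tensor M) W) p)"

definition K1 :: "('n, 'z) hermitian_space_scheme \<Rightarrow> bool" where
  "K1 N \<longleftrightarrow> (\<forall>X\<in>vfields N. \<forall>Y\<in>vfields N. \<forall>Z\<in>vfields N. \<forall>W\<in>vfields N. \<forall>p\<in>points N.
     riemann N X Y Z W p =
     riemann N X Y (app N (J_tensor N) Z) (app N (J_tensor N) W) p)"


section \<open>Riemannian submersions and O'Neill tensors\<close>

definition vertical_space ::
  "('m, 'y) riem_space_scheme \<Rightarrow> ('n, 'z) riem_space_scheme \<Rightarrow> ('m \<Rightarrow> 'n) \<Rightarrow> 'm \<Rightarrow> 'm tvec set" where
  "vertical_space M N \<pi> p = {u \<in> tangent M p. dmap N \<pi> u = 0}"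

definition horizontal_space ::
  "('m, 'y) riem_space_scheme \<Rightarrow> ('n, 'z) riem_space_scheme \<Rightarrow> ('m \<Rightarrow> 'n) \<Rightarrow> 'm \<Rightarrow> 'm tvec set" where
  "horizontal_space M N \<pi> p =
     {u \<in> tangent M p. \<forall>w\<in>vertical_space M N \<pi> p. metric_tensor M p u w = 0}"

definition riemannian_submersion ::
  "'a::euclidean_space set \<Rightarrow> 'b::euclidean_space set \<Rightarrow>
   ('m::{t2_space, second_countable_topology}, 'y) riem_space_scheme \<Rightarrow>
   ('n::{t2_space, second_countable_topology}, 'z) riem_space_scheme \<Rightarrow> ('m \<Rightarrow> 'n) \<Rightarrow> bool" where
  "riemannian_submersion E E' M N \<pi> \<longleftrightarrow>
     riemannian_manifold E M \<and> riemannian_manifold E' N \<and> smooth_map M N \<pi> \<and>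
     \<pi> ` points M = points N \<and>
     (\<forall>p\<in>points M. dmap N \<pi> ` tangent M p = tangent N (\<pi> p) \<and>
        (\<forall>u\<in>horizontal_space M N \<pi> p. \<forall>w\<in>horizontal_space M N \<pi> p.
           metric_tensor N (\<pi> p) (dmap N \<pi> u) (dmap N \<pi> w) = metric_tensor M p u w))"

definition contact_complex_submersion ::
  "'a::euclidean_space set \<Rightarrow> 'b::euclidean_space set \<Rightarrow>
   ('m::{t2_space, second_countable_topology}, 'y) contact_space_scheme \<Rightarrow>
   ('n::{t2_space, second_countable_topology}, 'z) hermitian_space_scheme \<Rightarrow> ('m \<Rightarrow> 'n) \<Rightarrow> bool" where
  "contact_complex_submersion E E' M N \<pi> \<longleftrightarrow>
     almost_contact_metric_manifold E M \<and> almost_hermitian_manifold E' N \<and>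
     riemannian_submersion E E' M N \<pi> \<and>
     (\<forall>p\<in>points M. \<forall>u\<in>tangent M p.
        J_tensor N (\<pi> p) (dmap N \<pi> u) = dmap N \<pi> (phi_tensor M p u))"

text \<open>The projections \<open>v\<close> and \<open>h\<close>.\<close>

definition vproj ::
  "('m, 'y) riem_space_scheme \<Rightarrow> ('n, 'z) riem_space_scheme \<Rightarrow> ('m \<Rightarrow> 'n) \<Rightarrow> 'm \<Rightarrow> 'm tvec \<Rightarrow> 'm tvec"
  where
  "vproj M N \<pi> p u =
     (THE w. w \<in> vertical_space M N \<pi> p \<and> u - w \<in> horizontal_space M N \<pi> p)"

definition hproj ::
  "('m, 'y) riem_space_scheme \<Rightarrow> ('n, 'z) riem_space_scheme \<Rightarrow> ('m \<Rightarrow> 'n) \<Rightarrow> 'm \<Rightarrow> 'm tvec \<Rightarrow> 'm tvec"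
  where "hproj M N \<pi> p u = u - vproj M N \<pi> p u"

definition oneill_T ::
  "('m, 'y) riem_space_scheme \<Rightarrow> ('n, 'z) riem_space_scheme \<Rightarrow> ('m \<Rightarrow> 'n) \<Rightarrow>
   'm vfield \<Rightarrow> 'm vfield \<Rightarrow> 'm vfield" where
  "oneill_T M N \<pi> X Y =
     (let v = app M (vproj M N \<pi>); h = app M (hproj M N \<pi>); D = levi_civita M
      in h (D (v X) (v Y)) + v (D (v X) (h Y)))"

definition oneill_A ::
  "('m, 'y) riem_space_scheme \<Rightarrow> ('n, 'z) riem_space_scheme \<Rightarrow> ('m \<Rightarrow> 'n) \<Rightarrow>
   'm vfield \<Rightarrow> 'm vfield \<Rightarrow> 'm vfield" where
  "oneill_A M N \<pi> X Y =
     (let v = app M (vproj M N \<pi>); h = app M (hproj M N \<pi>); D = levi_civita M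
      in v (D (h X) (h Y)) + h (D (h X) (v Y)))"

definition vertical_fields ::
  "('m, 'y) riem_space_scheme \<Rightarrow> ('n, 'z) riem_space_scheme \<Rightarrow> ('m \<Rightarrow> 'n) \<Rightarrow> 'm vfield set" where
  "vertical_fields M N \<pi> = {U \<in> vfields M. \<forall>p\<in>points M. U p \<in> vertical_space M N \<pi> p}"

definition T_phi_bilinear ::
  "('m, 'y) contact_space_scheme \<Rightarrow> ('n, 'z) riem_space_scheme \<Rightarrow> ('m \<Rightarrow> 'n) \<Rightarrow> bool" where
  "T_phi_bilinear M N \<pi> \<longleftrightarrow>
     (\<forall>U\<in>vertical_fields M N \<pi>. \<forall>W\<in>vertical_fields M N \<pi>.
        oneill_T M N \<pi> (app M (phi_tensor M) U) W = oneill_T M N \<pi> U (app M (phi_tensor M) W) \<and>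
        oneill_T M N \<pi> U (app M (phi_tensor M) W) = app M (phi_tensor M) (oneill_T M N \<pi> U W))"

definition oneill_A_vanishes ::
  "('m, 'y) riem_space_scheme \<Rightarrow> ('n, 'z) riem_space_scheme \<Rightarrow> ('m \<Rightarrow> 'n) \<Rightarrow> bool" where
  "oneill_A_vanishes M N \<pi> \<longleftrightarrow> (\<forall>X\<in>vfields M. \<forall>Y\<in>vfields M. oneill_A M N \<pi> X Y = 0)"


section \<open>The fibres with their induced structure\<close>

text \<open>The induced smooth structure of an embedded submanifold \<open>S\<close>: the functions which locally
  extend to smooth functions on \<open>M\<close>.\<close>

definition sub_space :: "('m::topological_space, 'z) smooth_space_scheme \<Rightarrow> 'm set \<Rightarrow> 'm smooth_space"
  where
  "sub_space M S = \<lparr>points = S,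
     smooth_funs = {f. \<forall>p\<in>S. \<exists>U h. open U \<and> p \<in> U \<and> h \<in> smooth_funs M \<and> (\<forall>x\<in>U \<inter> S. f x = h x)}\<rparr>"

text \<open>The differential \<open>i\<close> of the inclusion is \<open>dmap M id\<close>. The induced tensors are characterised by
  \<open>g\<^sub>S(u, w) = g(i u, i w)\<close>, \<open>i (\<phi>\<^sub>S u) = \<phi> (i u)\<close>, \<open>i \<xi>\<^sub>S = \<xi>\<close>, \<open>\<eta>\<^sub>S(u) = \<eta>(i u)\<close>.\<close>

definition induced_contact ::
  "('m::topological_space, 'z) contact_space_scheme \<Rightarrow> 'm set \<Rightarrow> 'm contact_space" where
  "induced_contact M S =
     (let i = dmap M id; TS = tangent (sub_space M S) in
      \<lparr>points = S, smooth_funs = smooth_funs (sub_space M S),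
       metric_tensor = (\<lambda>p u w. metric_tensor M p (i u) (i w)),
       phi_tensor = (\<lambda>p u. THE w. w \<in> TS p \<and> i w = phi_tensor M p (i u)),
       xi_field = (\<lambda>p. if p \<in> S then THE w. w \<in> TS p \<and> i w = xi_field M p else 0),
       eta_form = (\<lambda>p u. eta_form M p (i u))\<rparr>)"

definition fibre ::
  "('m::topological_space, 'z) contact_space_scheme \<Rightarrow> ('m \<Rightarrow> 'n) \<Rightarrow> 'n \<Rightarrow> 'm contact_space" where
  "fibre M \<pi> q = induced_contact M {p \<in> points M. \<pi> p = q}"

end

theory Submission
  imports Defs
begin

text \<open>For vertical fields the Levi-Civita connection of a fibre is the vertical part of that of \<open>M\<close>, and
  the Gauss equation expresses the difference of the two curvature tensors through the products
  \<open>g(T\<^sub>Y Z, T\<^sub>X W)\<close> and \<open>g(T\<^sub>X Z, T\<^sub>Y W)\<close>. If \<open>T\<close> is \<open>\<phi>\<close>-bilinear, replacing \<open>Z, W\<close> by \<open>\<phi>Z, \<phi>W\<close> applies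
  \<open>\<phi>\<close> to both factors; these are horizontal, where \<open>\<phi>\<close> is an isometry because \<open>\<xi>\<close> is vertical, so the
  correction does not change. If \<open>A = 0\<close>, the Levi-Civita connection and hence the curvature of \<open>N\<close> lift to
  horizontal fields, and \<open>\<phi>\<close> of a horizontal lift is the lift of \<open>J\<close>.

  Manifolds, base and fibres are treated alike through their rings of smooth functions. Existence of the
  Levi-Civita connection (Koszul) only needs a local dual basis of the vector fields and the Riesz property
  of the metric; for a fibre both are inherited from \<open>M\<close> by orthogonal projection, without an atlas.\<close>

section \<open>Calculus of smooth functions on open sets\<close>

text \<open>Tangent vectors are abstract derivations, so two analytic facts carry the weight. On a
  manifold, Hadamard's lemma identifies derivations with directional derivatives in charts; this
  yields the local dual basis. On a fibre, the smooth functions are those that locally extend to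
  \<open>M\<close>, so a vertical vector acts on them only if it kills every smooth function
  vanishing on the fibre near the point. That is where the inverse function theorem enters
  (\<open>vertical_vanish\<close>); afterwards the fibres are handled by algebra with local
  extensions.

  The Levi-Civita connection is given by a choice operator. It is accessible because it is
  characterised by the Koszul expression, built only from functions, brackets and the metric. These
  ingredients descend along \<pi> for horizontal lifts and restrict to the fibre for vertical
  extensions, and the connections follow.

  Fields such as lifts, projections and Riesz representatives are defined pointwise by a definite
  description; their smoothness comes from an explicit local formula that agrees with them.
  Gram-Schmidt takes the place of matrix inversion.\<close>

definition Cinf :: "'a::real_normed_vector set \<Rightarrow> ('a \<Rightarrow> 'b::real_normed_vector) \<Rightarrow> bool" where
  "Cinf U f \<longleftrightarrow> (\<forall>k. Ck_on k U f)"

lemma has_derivative_cong_open: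
  assumes "open U" "x \<in> U" "\<And>y. y \<in> U \<Longrightarrow> f y = g y"
  shows "(f has_derivative D) (at x) \<longleftrightarrow> (g has_derivative D) (at x)"
  using assms has_derivative_transform_within_open[of _ _ x UNIV U] by (metis)

lemma frechet_derivative_cong_open:
  assumes "open U" "x \<in> U" "\<And>y. y \<in> U \<Longrightarrow> f y = g y"
  shows "frechet_derivative f (at x) = frechet_derivative g (at x)"
  unfolding frechet_derivative_def using has_derivative_cong_open[OF assms] by simp

lemma Ck_on_cong:
  assumes "open U" "\<And>x. x \<in> U \<Longrightarrow> f x = g x"
  shows "Ck_on k U f \<longleftrightarrow> Ck_on k U g"
  using assms(2)
proof (induction k arbitrary: f g)
  case 0
  then show ?case by (auto cong: continuous_on_cong)
next
  case (Suc k)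
  have d: "f differentiable at x \<longleftrightarrow> g differentiable at x" if "x \<in> U" for x
    unfolding differentiable_def using has_derivative_cong_open[OF assms(1) that Suc.prems] by auto
  have "Ck_on k U (\<lambda>x. frechet_derivative f (at x) v) \<longleftrightarrow>
      Ck_on k U (\<lambda>x. frechet_derivative g (at x) v)" for v
    by (rule Suc.IH) (simp add: frechet_derivative_cong_open[OF assms(1) _ Suc.prems])
  with d show ?case by simp
qed

text \<open>Uniqueness of the derivative lets any formula \<open>f'\<close> replace
  \<open>frechet_derivative\<close>, so each rule below only has to exhibit the derivative that
  calculus provides.\<close>

lemma Ck_on_SucI:
  assumes "open U" "\<And>x. x \<in> U \<Longrightarrow> (f has_derivative f' x) (at x)"
    "\<And>v. Ck_on k U (\<lambda>x. f' x v)"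
  shows "Ck_on (Suc k) U f"
proof -
  have "frechet_derivative f (at x) v = f' x v" if "x \<in> U" for x v
    using frechet_derivative_at[OF assms(2)[OF that]] by simp
  then have "Ck_on k U (\<lambda>x. frechet_derivative f (at x) v)" for v
    using Ck_on_cong[OF assms(1), of "\<lambda>x. frechet_derivative f (at x) v" "\<lambda>x. f' x v" k] assms(3) by simp
  then show ?thesis using assms(2) by (auto simp: differentiable_def)
qed

lemma Ck_on_Suc_has_derivative:
  assumes "Ck_on (Suc k) U f" "x \<in> U"
  shows "(f has_derivative frechet_derivative f (at x)) (at x)"
  using assms by (auto simp: frechet_derivative_works)

lemma Ck_on_mono: "Ck_on k U f \<Longrightarrow> V \<subseteq> U \<Longrightarrow> Ck_on k V f"
  by (induction k arbitrary: f) (auto intro: continuous_on_subset)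

lemma Ck_on_SucD: "Ck_on (Suc k) U f \<Longrightarrow> Ck_on k U f"
proof (induction k arbitrary: f)
  case 0
  then show ?case
    by (auto intro!: continuous_at_imp_continuous_on differentiable_imp_continuous_within)
next
  case (Suc k)
  then show ?case by (metis Ck_on.simps(2))
qed

lemma Ck_on_local:
  assumes "\<And>x. x \<in> U \<Longrightarrow> \<exists>V. open V \<and> x \<in> V \<and> Ck_on k V f"
  shows "Ck_on k U f"
  using assms
proof (induction k arbitrary: f)
  case 0
  then show ?case
    by (auto intro!: continuous_at_imp_continuous_on simp: continuous_on_eq_continuous_at)
       (metis continuous_on_eq_continuous_at)
next
  case (Suc k)
  show ?case
    unfolding Ck_on.simps
  proof (intro conjI ballI allI)
    show "f differentiable at x" if "x \<in> U" for x
      using Suc.prems[OF that] by auto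
    show "Ck_on k U (\<lambda>x. frechet_derivative f (at x) v)" for v
      using Suc.prems by (intro Suc.IH) (metis Ck_on.simps(2))
  qed
qed

lemma Ck_on_const [simp]: "Ck_on k U (\<lambda>x. c)"
  by (induction k arbitrary: c) auto

lemma Ck_on_bounded_linear:
  assumes "open U" "bounded_linear L"
  shows "Ck_on k U L"
proof (cases k)
  case 0
  then show ?thesis using assms by (simp add: linear_continuous_on)
next
  case (Suc j)
  have "Ck_on (Suc j) U L"
    by (rule Ck_on_SucI[where f' = "\<lambda>x. L"])
       (use assms in \<open>auto simp: bounded_linear_imp_has_derivative\<close>)
  then show ?thesis using Suc by simp
qed

lemma Ck_on_add:
  assumes "open U"
  shows "Ck_on k U f \<Longrightarrow> Ck_on k U g \<Longrightarrow> Ck_on k U (\<lambda>x. f x + g x)"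
proof (induction k arbitrary: f g)
  case 0
  then show ?case by (auto intro: continuous_intros)
next
  case (Suc k)
  show ?case
    by (rule Ck_on_SucI[OF assms has_derivative_add[OF Ck_on_Suc_has_derivative[OF Suc.prems(1)]
            Ck_on_Suc_has_derivative[OF Suc.prems(2)]]])
       (use Suc in auto)
qed

text \<open>The product rule gives a sum of two products of the same kind with factors of one order
  less, so the induction closes when it ranges over all \<open>f\<close> and \<open>g\<close>. The
  bilinear form serves multiplication, scaling and inner products at once.\<close>

lemma (in bounded_bilinear) Ck_on_prod:
  assumes "open U"
  shows "Ck_on k U f \<Longrightarrow> Ck_on k U g \<Longrightarrow> Ck_on k U (\<lambda>x. prod (f x) (g x))"
proof (induction k arbitrary: f g)
  case 0
  then show ?case by (auto intro: continuous_on)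
next
  case (Suc k)
  show ?case
    by (rule Ck_on_SucI[OF assms FDERIV[OF Ck_on_Suc_has_derivative[OF Suc.prems(1)]
            Ck_on_Suc_has_derivative[OF Suc.prems(2)]]])
       (use Suc.prems in \<open>auto intro!: Ck_on_add[OF assms] Suc.IH
          Ck_on_SucD[OF Suc.prems(1)] Ck_on_SucD[OF Suc.prems(2)]\<close>)
qed

lemmas Ck_on_mult = bounded_bilinear.Ck_on_prod[OF bounded_bilinear_mult]
lemmas Ck_on_scaleR = bounded_bilinear.Ck_on_prod[OF bounded_bilinear_scaleR]
lemmas Ck_on_inner = bounded_bilinear.Ck_on_prod[OF bounded_bilinear_inner]

lemma Ck_on_sum:
  assumes "open U" "\<And>i. i \<in> I \<Longrightarrow> Ck_on k U (f i)"
  shows "Ck_on k U (\<lambda>x. \<Sum>i\<in>I. f i x)"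
  using assms(2)
  by (induction I rule: infinite_finite_induct) (auto intro!: Ck_on_add[OF assms(1)])

text \<open>\<open>Ck_on\<close> controls derivatives in fixed directions only, whereas the chain
  rule differentiates \<open>g\<close> in a direction that varies with \<open>x\<close>. Expanding
  this direction in the basis of the middle space leaves fixed basis directions with smooth
  coefficients, which is why that space is Euclidean.\<close>

lemma Ck_on_compose:
  fixes f :: "'a::real_normed_vector \<Rightarrow> 'b::euclidean_space"
  assumes "open U" "open V" "f ` U \<subseteq> V"
  shows "Ck_on k V g \<Longrightarrow> Ck_on k U f \<Longrightarrow> Ck_on k U (\<lambda>x. g (f x))"
proof (induction k arbitrary: g)
  case 0
  then show ?case using assms by (auto intro: continuous_on_compose2)
next
  case (Suc k)
  have g': "(g has_derivative frechet_derivative g (at (f x))) (at (f x))" if "x \<in> U" for x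
    using Ck_on_Suc_has_derivative[OF Suc.prems(1)] assms(3) that by auto
  have f': "(f has_derivative frechet_derivative f (at x)) (at x)" if "x \<in> U" for x
    by (rule Ck_on_Suc_has_derivative[OF Suc.prems(2) that])
  have eq: "frechet_derivative g (at (f x)) (frechet_derivative f (at x) v) =
      (\<Sum>b\<in>Basis. (frechet_derivative f (at x) v \<bullet> b) *\<^sub>R frechet_derivative g (at (f x)) b)"
    if "x \<in> U" for x v
  proof -
    have "linear (frechet_derivative g (at (f x)))"
      using g'[OF that] has_derivative_linear by blast
    then show ?thesis
      by (subst (1) euclidean_representation[symmetric]) (simp add: linear_sum linear_cmul)
  qed
  show ?case
  proof (rule Ck_on_SucI[OF assms(1)])
    show "((\<lambda>x. g (f x)) has_derivative
       (\<lambda>v. frechet_derivative g (at (f x)) (frechet_derivative f (at x) v))) (at x)" if "x \<in> U" for x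
      using diff_chain_at[OF f' g'] that by (simp add: comp_def)
    show "Ck_on k U (\<lambda>x. frechet_derivative g (at (f x)) (frechet_derivative f (at x) v))" for v
    proof (subst Ck_on_cong[OF assms(1) eq])
      show "Ck_on k U (\<lambda>x. \<Sum>b\<in>Basis. (frechet_derivative f (at x) v \<bullet> b) *\<^sub>R
          frechet_derivative g (at (f x)) b)"
        using Suc.prems Ck_on_SucD
        by (intro Ck_on_sum Ck_on_scaleR Ck_on_inner Suc.IH assms(1)) auto
    qed
  qed
qed

lemma Ck_on_inverse:
  fixes f :: "'a::real_normed_vector \<Rightarrow> real"
  assumes "open U" "\<And>x. x \<in> U \<Longrightarrow> f x \<noteq> 0"
  shows "Ck_on k U f \<Longrightarrow> Ck_on k U (\<lambda>x. inverse (f x))"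
proof (induction k)
  case 0
  then show ?case using assms by (auto intro!: continuous_intros)
next
  case (Suc k)
  show ?case
  proof (rule Ck_on_SucI[OF assms(1)])
    show "((\<lambda>x. inverse (f x)) has_derivative
       (\<lambda>v. (-1) * (inverse (f x) * frechet_derivative f (at x) v * inverse (f x)))) (at x)" if "x \<in> U" for x
      using Deriv.has_derivative_inverse[OF assms(2)[OF that] Ck_on_Suc_has_derivative[OF Suc.prems that]]
      by simp
    show "Ck_on k U (\<lambda>x. (-1) * (inverse (f x) * frechet_derivative f (at x) v * inverse (f x)))" for v
      using Suc Ck_on_SucD[OF Suc.prems] by (intro Ck_on_mult assms(1)) auto
  qed
qed

lemma Cinf_cong: "open U \<Longrightarrow> (\<And>x. x \<in> U \<Longrightarrow> f x = g x) \<Longrightarrow> Cinf U f \<longleftrightarrow> Cinf U g"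
  unfolding Cinf_def using Ck_on_cong by blast

lemma Cinf_mono: "Cinf U f \<Longrightarrow> V \<subseteq> U \<Longrightarrow> Cinf V f"
  unfolding Cinf_def using Ck_on_mono by blast

lemma Cinf_local: "(\<And>x. x \<in> U \<Longrightarrow> \<exists>V. open V \<and> x \<in> V \<and> Cinf V f) \<Longrightarrow> Cinf U f"
  unfolding Cinf_def by (meson Ck_on_local)

lemma Cinf_const [simp]: "Cinf U (\<lambda>x. c)"
  unfolding Cinf_def by simp

lemma Cinf_linear:
  fixes L :: "'a::euclidean_space \<Rightarrow> 'b::real_normed_vector"
  shows "open U \<Longrightarrow> linear L \<Longrightarrow> Cinf U L"
  unfolding Cinf_def using Ck_on_bounded_linear by (blast dest: linear_linear[THEN iffD2])

lemma Cinf_ident [simp]: "open U \<Longrightarrow> Cinf U (\<lambda>x. x)"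
  unfolding Cinf_def using Ck_on_bounded_linear bounded_linear_ident by blast

lemma Cinf_add: "open U \<Longrightarrow> Cinf U f \<Longrightarrow> Cinf U g \<Longrightarrow> Cinf U (\<lambda>x. f x + g x)"
  unfolding Cinf_def by (blast intro: Ck_on_add)

lemma Cinf_mult:
  "open U \<Longrightarrow> Cinf U f \<Longrightarrow> Cinf U g \<Longrightarrow> Cinf U (\<lambda>x. f x * g x :: 'b::real_normed_algebra)"
  unfolding Cinf_def by (blast intro: Ck_on_mult)

lemma Cinf_inner:
  "open U \<Longrightarrow> Cinf U f \<Longrightarrow> Cinf U g \<Longrightarrow> Cinf U (\<lambda>x. f x \<bullet> g x)"
  unfolding Cinf_def by (blast intro: Ck_on_inner)

lemma Cinf_scaleR:
  "open U \<Longrightarrow> Cinf U f \<Longrightarrow> Cinf U g \<Longrightarrow> Cinf U (\<lambda>x. f x *\<^sub>R g x)"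
  unfolding Cinf_def by (blast intro: Ck_on_scaleR)

lemma Cinf_sum:
  "open U \<Longrightarrow> (\<And>i. i \<in> I \<Longrightarrow> Cinf U (f i)) \<Longrightarrow> Cinf U (\<lambda>x. \<Sum>i\<in>I. f i x)"
  unfolding Cinf_def by (blast intro: Ck_on_sum)

lemma Cinf_compose:
  fixes f :: "'a::real_normed_vector \<Rightarrow> 'b::euclidean_space"
  shows "open U \<Longrightarrow> open V \<Longrightarrow> f ` U \<subseteq> V \<Longrightarrow> Cinf V g \<Longrightarrow> Cinf U f \<Longrightarrow> Cinf U (\<lambda>x. g (f x))"
  unfolding Cinf_def by (blast intro: Ck_on_compose)

lemma Cinf_inverse:
  fixes f :: "'a::real_normed_vector \<Rightarrow> real"
  shows "open U \<Longrightarrow> (\<And>x. x \<in> U \<Longrightarrow> f x \<noteq> 0) \<Longrightarrow> Cinf U f \<Longrightarrow> Cinf U (\<lambda>x. inverse (f x))"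
  unfolding Cinf_def by (blast intro: Ck_on_inverse)

lemma Cinf_diff:
  "open U \<Longrightarrow> Cinf U f \<Longrightarrow> Cinf U g \<Longrightarrow> Cinf U (\<lambda>x. f x - g x)"
  using Cinf_add[of U f "\<lambda>x. (-1) *\<^sub>R g x"] Cinf_scaleR[of U "\<lambda>_. -1" g] by simp

lemma Cinf_has_derivative:
  "Cinf U f \<Longrightarrow> x \<in> U \<Longrightarrow> (f has_derivative frechet_derivative f (at x)) (at x)"
  unfolding Cinf_def by (blast intro: Ck_on_Suc_has_derivative)

lemma Cinf_frechet_derivative: "Cinf U f \<Longrightarrow> Cinf U (\<lambda>x. frechet_derivative f (at x) v)"
  unfolding Cinf_def by (metis Ck_on.simps(2))

lemma Cinf_continuous_on: "Cinf U f \<Longrightarrow> continuous_on U f"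
  unfolding Cinf_def by (metis Ck_on.simps(1))

text \<open>All derivatives of \<open>exp (- 1 / t)\<close> are combinations of the functions \<open>exp (- 1 / t) / t ^ n\<close>.\<close>

definition flat_fun :: "nat \<Rightarrow> real \<Rightarrow> real" where
  "flat_fun n t = (if t > 0 then exp (- (1 / t)) / t ^ n else 0)"

text \<open>With \<open>s = 1 / t\<close> the right-hand limit becomes that of
  \<open>s ^ n / exp s\<close> at infinity.\<close>

lemma flat_fun_tendsto_0: "(flat_fun n \<longlongrightarrow> 0) (at 0)"
proof -
  have "((\<lambda>t::real. exp (- (1 / t)) / t ^ n) \<longlongrightarrow> 0) (at_right 0)"
  proof -
    have "((\<lambda>s::real. s ^ n / exp s) \<longlongrightarrow> 0) at_top"
      by (rule tendsto_power_div_exp_0)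
    then have "((\<lambda>t::real. inverse t ^ n / exp (inverse t)) \<longlongrightarrow> 0) (at_right 0)"
      by (rule filterlim_compose[OF _ filterlim_inverse_at_top_right])
    then show ?thesis
      by (simp add: exp_minus field_simps)
  qed
  moreover have "eventually (\<lambda>t::real. exp (- (1 / t)) / t ^ n = flat_fun n t) (at_right 0)"
    by (simp add: eventually_at_filter flat_fun_def)
  ultimately have r: "(flat_fun n \<longlongrightarrow> 0) (at_right 0)"
    using Lim_transform_eventually by blast
  have "eventually (\<lambda>t::real. 0 = flat_fun n t) (at_left 0)"
    by (simp add: eventually_at_filter flat_fun_def)
  then have l: "(flat_fun n \<longlongrightarrow> 0) (at_left 0)"
    using Lim_transform_eventually[OF tendsto_const] by blast
  show ?thesis using l r by (simp add: filterlim_split_at)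
qed

text \<open>The shift by 2 is the derivative of \<open>- 1 / t\<close> in the exponent, the shift by
  1 that of the power in the denominator.\<close>

lemma flat_fun_has_derivative:
  "(flat_fun n has_real_derivative (flat_fun (n + 2) t - real n * flat_fun (n + 1) t)) (at t)"
proof (cases t "0::real" rule: linorder_cases)
  case less
  have "((\<lambda>t. 0) has_real_derivative 0) (at t)" by simp
  then have "(flat_fun n has_real_derivative 0) (at t)"
    by (rule has_field_derivative_transform_within_open[of _ _ _ "{..<0}"])
       (use less in \<open>auto simp: flat_fun_def\<close>)
  then show ?thesis using less by (simp add: flat_fun_def)
next
  case equal
  \<comment> \<open>The difference quotient at 0 is again a flat function, so the derivative there
    is the limit already computed.\<close>
  have "flat_fun n h / h = flat_fun (n + 1) h" for h
    by (simp add: flat_fun_def)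
  then have "(flat_fun n has_real_derivative 0) (at 0)"
    using flat_fun_tendsto_0[of "n+1"] by (simp add: DERIV_def flat_fun_def[of n 0])
  then show ?thesis using equal by (simp add: flat_fun_def)
next
  case greater
  have "((\<lambda>t. exp (- (1 / t)) / t ^ n) has_real_derivative
    (flat_fun (n + 2) t - real n * flat_fun (n + 1) t)) (at t)"
  proof -
    have e: "((\<lambda>t. exp (- (1 / t))) has_real_derivative exp (- (1 / t)) / t\<^sup>2) (at t)"
      using greater by (auto intro!: derivative_eq_intros simp: power2_eq_square)
    have p: "((\<lambda>t. t ^ n) has_real_derivative real n * t ^ n / t) (at t)"
      using DERIV_pow[of n t] greater by (cases n) auto
    show ?thesis
      by (rule DERIV_cong[OF DERIV_divide[OF e p]])
         (use greater in \<open>auto simp: flat_fun_def field_simps power2_eq_square\<close>)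
  qed
  then show ?thesis
    by (rule has_field_derivative_transform_within_open[of _ _ _ "{0<..}"])
       (use greater in \<open>auto simp: flat_fun_def\<close>)
qed

lemma Ck_on_flat_fun: "Ck_on k UNIV (flat_fun n)"
proof (induction k arbitrary: n)
  case 0
  show ?case
    by (auto intro!: continuous_at_imp_continuous_on DERIV_isCont flat_fun_has_derivative)
next
  case (Suc k)
  show ?case
  proof (rule Ck_on_SucI)
    show "(flat_fun n has_derivative
        (\<lambda>v. (flat_fun (n + 2) t + (- real n) * flat_fun (n + 1) t) * v)) (at t)" for t
      using flat_fun_has_derivative[of n t] by (simp add: has_field_derivative_def)
    show "Ck_on k UNIV (\<lambda>t. (flat_fun (n + 2) t + (- real n) * flat_fun (n + 1) t) * v)" for v
      by (intro Ck_on_mult Ck_on_add Suc.IH) auto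
  qed simp
qed

lemma bump_euclidean:
  fixes a :: "'a::euclidean_space"
  assumes "r > 0"
  obtains \<beta> :: "'a \<Rightarrow> real" where "Cinf UNIV \<beta>" "\<And>z. z \<in> ball a (r/2) \<Longrightarrow> \<beta> z = 1"
    "\<And>z. z \<notin> ball a r \<Longrightarrow> \<beta> z = 0" "\<And>z. 0 \<le> \<beta> z" "\<And>z. \<beta> z \<le> 1"
proof -
  let ?s = "\<lambda>z. (z - a) \<bullet> (z - a)"
  let ?f = "\<lambda>z. flat_fun 0 (r\<^sup>2 - ?s z)" and ?g = "\<lambda>z. flat_fun 0 (?s z - r\<^sup>2/4)"
  \<comment> \<open>\<open>?f\<close> is positive exactly inside radius \<open>r\<close> and
    \<open>?g\<close> exactly outside radius \<open>r / 2\<close>. Hence the denominator never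
    vanishes, and the quotient is 1 where \<open>?g\<close> is 0. Squared distances keep everything
    smooth at the centre, unlike the norm.\<close>
  define \<beta> where "\<beta> = (\<lambda>z. ?f z * inverse (?f z + ?g z))"
  have s: "?s z = (dist z a)\<^sup>2" for z by (simp add: dist_norm power2_norm_eq_inner)
  have nn: "flat_fun 0 t \<ge> 0" "flat_fun 0 t > 0 \<longleftrightarrow> t > 0" "flat_fun 0 t = 0 \<longleftrightarrow> t \<le> 0" for t
    by (auto simp: flat_fun_def)
  have pos: "?f z + ?g z > 0" for z
  proof (cases "r\<^sup>2 - ?s z > 0")
    case False
    have "r\<^sup>2 > 0" using assms by simp
    with False have "?s z - r\<^sup>2/4 > 0" by linarith
    then show ?thesis using nn by (metis add_nonneg_pos)
  qed (use nn in \<open>metis add_pos_nonneg\<close>)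
  have F: "Cinf UNIV (flat_fun 0)" by (simp add: Cinf_def Ck_on_flat_fun)
  have S: "Cinf UNIV ?s" by (intro Cinf_inner Cinf_diff) auto
  have "Cinf UNIV ?f" "Cinf UNIV ?g"
    using Cinf_compose[OF open_UNIV open_UNIV subset_UNIV F] Cinf_diff[OF open_UNIV _ S]
      Cinf_diff[OF open_UNIV S] Cinf_const by blast+
  then have "Cinf UNIV \<beta>" unfolding \<beta>_def
    by (intro Cinf_mult Cinf_inverse Cinf_add) (use pos in \<open>auto simp: less_imp_neq[symmetric]\<close>)
  moreover have "\<beta> z = 1" if "z \<in> ball a (r/2)" for z
  proof -
    have "dist z a < r/2" using that by (simp add: dist_commute)
    then have "(dist z a)\<^sup>2 < (r/2)\<^sup>2" by (intro power_strict_mono) auto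
    then have "?g z = 0" unfolding s nn by (simp add: power_divide)
    then show ?thesis using pos[of z] by (simp add: \<beta>_def)
  qed
  moreover have "\<beta> z = 0" if "z \<notin> ball a r" for z
  proof -
    have "dist z a \<ge> r" using that by (simp add: dist_commute)
    then have "(dist z a)\<^sup>2 \<ge> r\<^sup>2" using assms by (intro power_mono) auto
    then have "?f z = 0" unfolding s nn by simp
    then show ?thesis by (simp add: \<beta>_def)
  qed
  moreover have "0 \<le> \<beta> z" "\<beta> z \<le> 1" for z
    using pos[of z] nn(1) by (simp_all add: \<beta>_def field_simps)
  ultimately show ?thesis using that by blast
qed

section \<open>Derivatives as operator-valued maps, integrals with a parameter, Hadamard's
  lemma\<close>

lemma Cinf_blinfun:
  fixes f :: "'a::euclidean_space \<Rightarrow> 'b::real_normed_vector"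
  assumes "Cinf U f"
  obtains f' :: "'a \<Rightarrow> 'a \<Rightarrow>\<^sub>L 'b"
  where "\<And>x. x \<in> U \<Longrightarrow> blinfun_apply (f' x) = frechet_derivative f (at x)" "continuous_on U f'"
proof -
  define f' where "f' = (\<lambda>x. Blinfun (frechet_derivative f (at x)))"
  have "blinfun_apply (f' x) = frechet_derivative f (at x)" if "x \<in> U" for x
    using Cinf_has_derivative[OF assms that]
    by (auto simp: f'_def bounded_linear_Blinfun_apply has_derivative_bounded_linear)
  moreover from this have "continuous_on U f'"
    using Cinf_continuous_on[OF Cinf_frechet_derivative[OF assms]]
    by (intro continuous_on_blinfun_componentwise) (auto cong: continuous_on_cong)
  ultimately show ?thesis using that by blast
qed

text \<open>Each differentiation under the integral brings out one more factor \<open>t\<close> from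
  the chain rule; the power \<open>t ^ m\<close> with arbitrary \<open>m\<close> makes the induction
  go through. The ball is star-shaped around \<open>a\<close>, so the segment stays in the domain of
  \<open>h\<close>.\<close>

lemma Ck_on_parametric_integral:
  fixes h :: "'a::euclidean_space \<Rightarrow> real"
  assumes "Cinf (ball a r) h"
  shows "Ck_on k (ball a r) (\<lambda>x. integral {0..1} (\<lambda>t. t ^ m * h (a + t *\<^sub>R (x - a))))"
  using assms
proof (induction k arbitrary: h m)
  have seg: "a + t *\<^sub>R (x - a) \<in> ball a r" if "x \<in> ball a r" "t \<in> {0..1}" for x t
  proof -
    have "norm (t *\<^sub>R (x - a)) \<le> norm (x - a)"
      using that(2) by (simp add: mult_left_le_one_le)
    then show ?thesis using that(1) by (simp add: dist_norm norm_minus_commute)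
  qed
  have der: "((\<lambda>x. integral {0..1} (\<lambda>t. t ^ m * h (a + t *\<^sub>R (x - a)))) has_derivative
       (\<lambda>v. integral {0..1} (\<lambda>t. t ^ Suc m *
          frechet_derivative h (at (a + t *\<^sub>R (x - a))) v))) (at x)"
    if h: "Cinf (ball a r) h" and x: "x \<in> ball a r" for h :: "'a \<Rightarrow> real" and m x
  proof -
    obtain h' where h': "\<And>x. x \<in> ball a r \<Longrightarrow> blinfun_apply (h' x) = frechet_derivative h (at x)"
      and ch': "continuous_on (ball a r) h'" using Cinf_blinfun[OF h] by blast
    have cs: "continuous_on (ball a r \<times> {0..1}) (\<lambda>z. h' (a + snd z *\<^sub>R (fst z - a)))"
      by (rule continuous_on_compose2[OF ch']) (auto intro!: continuous_intros seg simp del: mem_ball)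
    let ?D = "\<lambda>x t. t ^ Suc m *\<^sub>R h' (a + t *\<^sub>R (x - a))"
    have cD: "continuous_on (ball a r \<times> cbox 0 1) (\<lambda>(x, t). ?D x t)"
      using cs by (auto intro!: continuous_intros simp: case_prod_beta)
    have "((\<lambda>x. integral (cbox 0 1) (\<lambda>t. t ^ m * h (a + t *\<^sub>R (x - a)))) has_derivative
       integral (cbox 0 1) (?D x)) (at x within ball a r)"
    proof (rule leibniz_rule[OF _ _ cD x])
      fix y t assume y: "y \<in> ball a r" and t: "t \<in> cbox 0 (1::real)"
      have m: "a + t *\<^sub>R (y - a) \<in> ball a r" using seg y t by simp
      have "((\<lambda>y. a + t *\<^sub>R (y - a)) has_derivative (\<lambda>v. t *\<^sub>R v)) (at y)"
        by (auto intro!: derivative_eq_intros)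
      from diff_chain_at[OF this Cinf_has_derivative[OF h m]]
      have "((\<lambda>y. t ^ m * h (a + t *\<^sub>R (y - a))) has_derivative
         (\<lambda>v. t ^ m * frechet_derivative h (at (a + t *\<^sub>R (y - a))) (t *\<^sub>R v))) (at y)"
        by (auto intro!: derivative_eq_intros simp: comp_def)
      moreover have "(\<lambda>v. t ^ m * frechet_derivative h (at (a + t *\<^sub>R (y - a))) (t *\<^sub>R v)) =
         blinfun_apply (?D y t)"
        using h'[OF m] by (auto simp: fun_eq_iff blinfun.scaleR_left blinfun.scaleR_right simp flip: h'[OF m])
      ultimately show "((\<lambda>y. t ^ m * h (a + t *\<^sub>R (y - a))) has_derivative
         blinfun_apply (?D y t)) (at y within ball a r)"
        by (simp add: has_derivative_at_withinI)
    next
      fix y assume y: "y \<in> ball a r"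
      show "(\<lambda>t. t ^ m * h (a + t *\<^sub>R (y - a))) integrable_on cbox 0 1"
        by (intro integrable_continuous continuous_intros
            continuous_on_compose2[OF Cinf_continuous_on[OF h]]) (use seg y in auto)
    qed simp
    moreover have "(?D x) integrable_on cbox 0 1"
      by (intro integrable_continuous continuous_intros continuous_on_compose2[OF ch'])
         (use seg x in auto)
    then have "blinfun_apply (integral (cbox 0 1) (?D x)) v =
       integral (cbox 0 1) (\<lambda>t. blinfun_apply (?D x t) v)" for v
      by (rule blinfun_apply_integral)
    moreover have "integral (cbox 0 1) (\<lambda>t. blinfun_apply (?D x t) v) =
       integral {0..1} (\<lambda>t. t ^ Suc m * frechet_derivative h (at (a + t *\<^sub>R (x - a))) v)" for v
      unfolding cbox_interval
      by (rule integral_cong) (use h' seg x in \<open>auto simp: blinfun.scaleR_left\<close>)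
    ultimately have "blinfun_apply (integral (cbox 0 1) (?D x)) =
        (\<lambda>v. integral {0..1} (\<lambda>t. t ^ Suc m * frechet_derivative h (at (a + t *\<^sub>R (x - a))) v))" by auto
    then show ?thesis
      using \<open>(_ has_derivative integral (cbox 0 1) (?D x)) (at x within ball a r)\<close> x
      by (simp add: at_within_open[OF x])
  qed
  {
    case 0
    show ?case
      using der[OF 0] unfolding Ck_on.simps
      by (meson continuous_at_imp_continuous_on has_derivative_continuous)
  next
    case (Suc k)
    show ?case
      by (rule Ck_on_SucI[OF _ der[OF Suc.prems]])
         (simp_all only: open_ball Suc.IH[OF Cinf_frechet_derivative[OF Suc.prems]])
  }
qed

text \<open>The witness is \<open>g b x\<close>, the integral over \<open>t\<close> of the
  derivative of \<open>h\<close> in direction \<open>b\<close> at \<open>a + t (x - a)\<close>; the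
  fundamental theorem of calculus along the segment gives the expansion. The set \<open>B\<close> is
  left free because charts later expand \<open>x - a\<close> in a basis of the model subspace
  only.\<close>

lemma Hadamard:
  fixes h :: "'a::euclidean_space \<Rightarrow> real"
  assumes "Cinf (ball a r) h"
  obtains g where "\<forall>b. Cinf (ball a r) (g b)" "\<forall>b. g b a = frechet_derivative h (at a) b"
    "\<forall>x B c. finite B \<longrightarrow> x \<in> ball a r \<longrightarrow> x - a = (\<Sum>b\<in>B. c b *\<^sub>R b) \<longrightarrow>
        h x = h a + (\<Sum>b\<in>B. c b * g b x)"
proof -
  define g where "g = (\<lambda>b x. integral {0..1} (\<lambda>t. t ^ 0 *
     frechet_derivative h (at (a + t *\<^sub>R (x - a))) b))"
  have "Cinf (ball a r) (g b)" for b
    unfolding g_def Cinf_def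
    using Ck_on_parametric_integral[OF Cinf_frechet_derivative[OF assms]] by blast
  moreover have "g b a = frechet_derivative h (at a) b" for b
    by (simp add: g_def)
  moreover have "h x = h a + (\<Sum>b\<in>B. c b * g b x)"
    if B: "finite B" and x: "x \<in> ball a r" and sum: "x - a = (\<Sum>b\<in>B. c b *\<^sub>R b)" for x B c
  proof -
    have seg: "a + t *\<^sub>R (x - a) \<in> ball a r" if "t \<in> {0..1}" for t
    proof -
      have "norm (t *\<^sub>R (x - a)) \<le> norm (x - a)"
        using that by (simp add: mult_left_le_one_le)
      then show ?thesis using x by (simp add: dist_norm norm_minus_commute)
    qed
    have int: "(\<lambda>t. frechet_derivative h (at (a + t *\<^sub>R (x - a))) b) integrable_on {0..1}" for b
      by (intro integrable_continuous_interval
          continuous_on_compose2[OF Cinf_continuous_on[OF Cinf_frechet_derivative[OF assms]]] continuous_intros)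
         (use seg in auto)
    have "((\<lambda>t. frechet_derivative h (at (a + t *\<^sub>R (x - a))) (x - a)) has_integral
       (h (a + 1 *\<^sub>R (x - a)) - h (a + 0 *\<^sub>R (x - a)))) {0..1}"
    proof (rule fundamental_theorem_of_calculus)
      fix t assume t: "t \<in> {0..1::real}"
      have "((\<lambda>t. a + t *\<^sub>R (x - a)) has_derivative (\<lambda>s. s *\<^sub>R (x - a))) (at t)"
        by (auto intro!: derivative_eq_intros)
      from diff_chain_at[OF this Cinf_has_derivative[OF assms seg[OF t]]]
      have "((\<lambda>t. h (a + t *\<^sub>R (x - a))) has_derivative
         (\<lambda>s. frechet_derivative h (at (a + t *\<^sub>R (x - a))) (s *\<^sub>R (x - a)))) (at t)"
        by (simp add: comp_def)
      moreover have "linear (frechet_derivative h (at (a + t *\<^sub>R (x - a))))"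
        using Cinf_has_derivative[OF assms seg[OF t]] has_derivative_linear by blast
      ultimately show "((\<lambda>t. h (a + t *\<^sub>R (x - a))) has_vector_derivative
         frechet_derivative h (at (a + t *\<^sub>R (x - a))) (x - a)) (at t within {0..1})"
        by (simp add: has_vector_derivative_def linear_cmul has_derivative_at_withinI)
    qed simp
    then have "h x - h a = integral {0..1} (\<lambda>t. frechet_derivative h (at (a + t *\<^sub>R (x - a))) (x - a))"
      by (simp add: integral_unique)
    also have "\<dots> = integral {0..1} (\<lambda>t. \<Sum>b\<in>B. c b * frechet_derivative h (at (a + t *\<^sub>R (x - a))) b)"
    proof (rule integral_cong)
      fix t assume t: "t \<in> {0..1::real}"
      have "linear (frechet_derivative h (at (a + t *\<^sub>R (x - a))))"
        using Cinf_has_derivative[OF assms seg[OF t]] has_derivative_linear by blast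
      then show "frechet_derivative h (at (a + t *\<^sub>R (x - a))) (x - a) =
         (\<Sum>b\<in>B. c b * frechet_derivative h (at (a + t *\<^sub>R (x - a))) b)"
        by (subst (2) sum) (simp add: linear_sum linear_cmul)
    qed
    also have "\<dots> = (\<Sum>b\<in>B. c b * g b x)"
      using int integrable_on_mult_right by (subst integral_sum) (auto simp: g_def B)
    finally show ?thesis by simp
  qed
  ultimately show ?thesis by (intro that[of g]) simp_all
qed

section \<open>Derivations and vector fields of a ring of smooth functions\<close>

lemma tangentI:
  assumes "\<And>f. f \<notin> smooth_funs M \<Longrightarrow> u f = 0"
    "\<And>f h. f \<in> smooth_funs M \<Longrightarrow> h \<in> smooth_funs M \<Longrightarrow> u (\<lambda>x. f x + h x) = u f + u h"
    "\<And>f c. f \<in> smooth_funs M \<Longrightarrow> u (\<lambda>x. c * f x) = c * u f"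
    "\<And>f h. f \<in> smooth_funs M \<Longrightarrow> h \<in> smooth_funs M \<Longrightarrow> u (\<lambda>x. f x * h x) = f p * u h + h p * u f"
  shows "u \<in> tangent M p"
  using assms by (simp add: tangent_def)

lemma
  assumes "u \<in> tangent M p"
  shows tangent_outside: "f \<notin> smooth_funs M \<Longrightarrow> u f = 0"
    and tangent_add_fun: "f \<in> smooth_funs M \<Longrightarrow> h \<in> smooth_funs M \<Longrightarrow> u (\<lambda>x. f x + h x) = u f + u h"
    and tangent_cmult_fun: "f \<in> smooth_funs M \<Longrightarrow> u (\<lambda>x. c * f x) = c * u f"
    and tangent_mult_fun: "f \<in> smooth_funs M \<Longrightarrow> h \<in> smooth_funs M \<Longrightarrow>
      u (\<lambda>x. f x * h x) = f p * u h + h p * u f"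
  using assms by (simp_all add: tangent_def)

lemma sum_fun_apply: "(\<Sum>i\<in>I. F i) x = (\<Sum>i\<in>I. F i x)"
  for F :: "'i \<Rightarrow> 'b \<Rightarrow> 'c::comm_monoid_add"
  by (induction I rule: infinite_finite_induct) auto

lemma tscale_apply [simp]: "tscale c u f = c * u f"
  by (simp add: tscale_def)

lemma tscale_0 [simp]: "tscale c 0 = 0" "tscale 0 u = 0"
  by (auto simp: tscale_def)

lemma tscale_1 [simp]: "tscale 1 u = u"
  by (simp add: tscale_def)

lemma tscale_minus_1: "tscale (-1) u = - u"
  by (auto simp: tscale_def)

lemma tangent_0 [simp]: "0 \<in> tangent M p"
  by (intro tangentI) auto

lemma tangent_add: "u \<in> tangent M p \<Longrightarrow> w \<in> tangent M p \<Longrightarrow> u + w \<in> tangent M p"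
  by (auto simp: tangent_def algebra_simps)

lemma tangent_tscale: "u \<in> tangent M p \<Longrightarrow> tscale c u \<in> tangent M p"
  by (auto simp: tangent_def algebra_simps)

lemma tangent_uminus: "u \<in> tangent M p \<Longrightarrow> - u \<in> tangent M p"
  using tangent_tscale[of u M p "-1"] by (simp add: tscale_minus_1)

lemma tangent_diff: "u \<in> tangent M p \<Longrightarrow> w \<in> tangent M p \<Longrightarrow> u - w \<in> tangent M p"
  using tangent_add[OF _ tangent_uminus] by fastforce

lemma tangent_sum: "(\<And>i. i \<in> I \<Longrightarrow> u i \<in> tangent M p) \<Longrightarrow> (\<Sum>i\<in>I. u i) \<in> tangent M p"
  by (induction I rule: infinite_finite_induct) (auto intro: tangent_add)

lemma vfieldsI:
  assumes "\<And>p. p \<in> points M \<Longrightarrow> X p \<in> tangent M p" "\<And>p. p \<notin> points M \<Longrightarrow> X p = 0"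
    "\<And>f. f \<in> smooth_funs M \<Longrightarrow> (\<lambda>p. X p f) \<in> smooth_funs M"
  shows "X \<in> vfields M"
  using assms by (simp add: vfields_def)

lemma
  assumes "X \<in> vfields M"
  shows vfields_tangent: "p \<in> points M \<Longrightarrow> X p \<in> tangent M p"
    and vfields_outside: "p \<notin> points M \<Longrightarrow> X p = 0"
    and vfields_smooth: "f \<in> smooth_funs M \<Longrightarrow> (\<lambda>p. X p f) \<in> smooth_funs M"
  using assms by (simp_all add: vfields_def)

text \<open>These are the 1-forms, as functionals linear over smooth functions. Equations are
  required at points of \<open>M\<close> only, since values elsewhere carry no meaning.\<close>

definition module_functional ::
  "('m, 'z) smooth_space_scheme \<Rightarrow> ('m vfield \<Rightarrow> 'm \<Rightarrow> real) \<Rightarrow> bool" where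
  "module_functional M L \<longleftrightarrow> (\<forall>Z\<in>vfields M. L Z \<in> smooth_funs M \<and>
     (\<forall>W\<in>vfields M. \<forall>p\<in>points M. L (Z + W) p = L Z p + L W p) \<and>
     (\<forall>a\<in>smooth_funs M. \<forall>p\<in>points M. L (fscale a Z) p = a p * L Z p))"

text \<open>With \<open>U = UNIV\<close>, \<open>local_in\<close> also says that values outside
  \<open>points M\<close> are irrelevant. \<open>bump\<close> is what makes derivations of globally
  defined functions depend on germs only.\<close>

locale smooth_ring =
  fixes M :: "('m::topological_space, 'z) smooth_space_scheme"
  assumes const_in: "(\<lambda>_. c) \<in> smooth_funs M"
    and add_in: "f \<in> smooth_funs M \<Longrightarrow> h \<in> smooth_funs M \<Longrightarrow> (\<lambda>x. f x + h x) \<in> smooth_funs M"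
    and mult_in: "f \<in> smooth_funs M \<Longrightarrow> h \<in> smooth_funs M \<Longrightarrow> (\<lambda>x. f x * h x) \<in> smooth_funs M"
    and local_in: "(\<And>p. p \<in> points M \<Longrightarrow>
        \<exists>U h. open U \<and> p \<in> U \<and> h \<in> smooth_funs M \<and> (\<forall>x\<in>U \<inter> points M. f x = h x)) \<Longrightarrow>
        f \<in> smooth_funs M"
    and bump: "open U \<Longrightarrow> p \<in> U \<Longrightarrow> p \<in> points M \<Longrightarrow> \<exists>b\<in>smooth_funs M. \<exists>V. open V \<and> p \<in> V \<and>
        (\<forall>x\<in>V \<inter> points M. b x = 1) \<and> (\<forall>x\<in>points M - U. b x = 0)"
begin

lemma cmult_in: "f \<in> smooth_funs M \<Longrightarrow> (\<lambda>x. c * f x) \<in> smooth_funs M"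
  by (rule mult_in[OF const_in])

lemma diff_in: "f \<in> smooth_funs M \<Longrightarrow> h \<in> smooth_funs M \<Longrightarrow> (\<lambda>x. f x - h x) \<in> smooth_funs M"
  using add_in[OF _ cmult_in[of h "-1"]] by simp

lemma sum_in: "(\<And>i. i \<in> I \<Longrightarrow> f i \<in> smooth_funs M) \<Longrightarrow> (\<lambda>x. \<Sum>i\<in>I. f i x) \<in> smooth_funs M"
  by (induction I rule: infinite_finite_induct) (auto intro: add_in const_in)

lemma cong_in: "f \<in> smooth_funs M \<Longrightarrow> (\<And>x. x \<in> points M \<Longrightarrow> h x = f x) \<Longrightarrow> h \<in> smooth_funs M"
  by (rule local_in) (auto intro!: exI[of _ UNIV])

lemma tangent_const: "u \<in> tangent M p \<Longrightarrow> u (\<lambda>_. c) = 0"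
  using tangent_mult_fun[OF _ const_in const_in, of u p 1 1]
    tangent_cmult_fun[OF _ const_in, of u p c 1] by simp

lemma tangent_diff_fun:
  "u \<in> tangent M p \<Longrightarrow> f \<in> smooth_funs M \<Longrightarrow> h \<in> smooth_funs M \<Longrightarrow> u (\<lambda>x. f x - h x) = u f - u h"
  using tangent_add_fun[OF _ _ cmult_in, of u p f h "-1"] tangent_cmult_fun[of u M p h "-1"] by simp

lemma tangent_sum_fun:
  "u \<in> tangent M p \<Longrightarrow> (\<And>i. i \<in> I \<Longrightarrow> f i \<in> smooth_funs M) \<Longrightarrow>
    u (\<lambda>x. \<Sum>i\<in>I. f i x) = (\<Sum>i\<in>I. u (f i))"
  by (induction I rule: infinite_finite_induct)
     (auto simp: tangent_const tangent_add_fun[OF _ _ sum_in])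

text \<open>Tangent vectors see functions on the whole type, hence the cut-off \<open>c\<close> has to be 1 outside
  \<open>points M\<close> as well.\<close>

lemma tangent_cong_local:
  assumes u: "u \<in> tangent M p" and p: "p \<in> points M" "open U" "p \<in> U"
    and f: "f \<in> smooth_funs M" "h \<in> smooth_funs M" "\<And>x. x \<in> U \<Longrightarrow> x \<in> points M \<Longrightarrow> f x = h x"
  shows "u f = u h"
proof -
  obtain b V where b: "b \<in> smooth_funs M" "p \<in> V" "\<forall>x\<in>V \<inter> points M. b x = 1"
    "\<forall>x\<in>points M - U. b x = 0" using bump[OF p(2,3,1)] by blast
  define c where "c = (\<lambda>x. if x \<in> points M then 1 - b x else 1)"
  have c: "c \<in> smooth_funs M"
    by (rule cong_in[OF diff_in[OF const_in[of 1] b(1)]]) (simp add: c_def)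
  let ?d = "\<lambda>x. f x - h x"
  have d: "?d \<in> smooth_funs M" using f by (intro diff_in)
  \<comment> \<open>Both factors of \<open>?d x * c x\<close> vanish at \<open>p\<close>, so the
    Leibniz rule makes \<open>u\<close> zero on the product, and the product is \<open>?d\<close>
    itself.\<close>
  have "c p = 0" using b p by (simp add: c_def)
  moreover have "?d p = 0" using f(3) p by simp
  moreover have "(\<lambda>x. ?d x * c x) = ?d" using f(3) b(4) by (fastforce simp: c_def)
  ultimately have "u ?d = 0" using tangent_mult_fun[OF u d c] by simp
  then show ?thesis using tangent_diff_fun[OF u f(1,2)] by simp
qed

lemma tangent_cong:
  assumes "u \<in> tangent M p" "p \<in> points M" "f \<in> smooth_funs M" "\<And>x. x \<in> points M \<Longrightarrow> h x = f x"
  shows "u h = u f"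
  using tangent_cong_local[OF assms(1,2) open_UNIV UNIV_I cong_in[OF assms(3,4)] assms(3)] assms(4) by blast

lemma vfields_0 [simp]: "0 \<in> vfields M"
  by (auto intro!: vfieldsI const_in)

lemma vfields_add: "X \<in> vfields M \<Longrightarrow> Y \<in> vfields M \<Longrightarrow> X + Y \<in> vfields M"
  by (intro vfieldsI) (auto simp: vfields_tangent vfields_outside vfields_smooth intro: tangent_add add_in)

lemma vfields_fscale: "a \<in> smooth_funs M \<Longrightarrow> X \<in> vfields M \<Longrightarrow> fscale a X \<in> vfields M"
  by (intro vfieldsI)
     (auto simp: fscale_def vfields_tangent vfields_outside vfields_smooth intro: tangent_tscale mult_in)

lemma fscale_minus_1: "fscale (\<lambda>_. -1) X = - X"
  by (auto simp: fscale_def tscale_minus_1)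

lemma vfields_uminus: "X \<in> vfields M \<Longrightarrow> - X \<in> vfields M"
  using vfields_fscale[OF const_in, of X "-1"] by (simp add: fscale_minus_1)

lemma vfields_diff: "X \<in> vfields M \<Longrightarrow> Y \<in> vfields M \<Longrightarrow> X - Y \<in> vfields M"
  using vfields_add[OF _ vfields_uminus] by fastforce

lemma vfields_sum: "(\<And>i. i \<in> I \<Longrightarrow> X i \<in> vfields M) \<Longrightarrow> (\<Sum>i\<in>I. X i) \<in> vfields M"
  by (induction I rule: infinite_finite_induct) (auto intro: vfields_add)

lemma vfields_bracket:
  assumes X: "X \<in> vfields M" and Y: "Y \<in> vfields M"
  shows "bracket M X Y \<in> vfields M"
proof (rule vfieldsI)
  note s = vfields_smooth[OF X] vfields_smooth[OF Y]
  fix p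
  assume p: "p \<in> points M"
  note t = vfields_tangent[OF X p] vfields_tangent[OF Y p]
  show "bracket M X Y p \<in> tangent M p"
  proof (rule tangentI)
    fix f h
    assume f: "f \<in> smooth_funs M" and h: "h \<in> smooth_funs M"
    have "X p (\<lambda>q. Y q (\<lambda>x. f x + h x)) = X p (\<lambda>q. Y q f) + X p (\<lambda>q. Y q h)"
      if X: "X \<in> vfields M" and Y: "Y \<in> vfields M" for X Y
    proof -
      have "X p (\<lambda>q. Y q (\<lambda>x. f x + h x)) = X p (\<lambda>q. Y q f + Y q h)"
        by (rule tangent_cong[OF vfields_tangent[OF X p] p add_in[OF vfields_smooth[OF Y f] vfields_smooth[OF Y h]]])
           (rule tangent_add_fun[OF vfields_tangent[OF Y] f h])
      also have "\<dots> = X p (\<lambda>q. Y q f) + X p (\<lambda>q. Y q h)"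
        by (rule tangent_add_fun[OF vfields_tangent[OF X p] vfields_smooth[OF Y f] vfields_smooth[OF Y h]])
      finally show ?thesis .
    qed
    from this[OF X Y] this[OF Y X]
    show "bracket M X Y p (\<lambda>x. f x + h x) = bracket M X Y p f + bracket M X Y p h"
      using f h add_in by (simp add: bracket_def)
    \<comment> \<open>The cross terms \<open>Y p h * X p f\<close> and \<open>Y p f * X p h\<close>
      are exchanged by swapping \<open>X\<close> and \<open>Y\<close>, so they cancel in the
      bracket. The inner Leibniz rule holds only at points of \<open>M\<close>, hence the detour
      through \<open>tangent_cong\<close>.\<close>
    have e1: "X p (\<lambda>q. Y q (\<lambda>x. f x * h x)) =
       f p * X p (\<lambda>q. Y q h) + Y p h * X p f + (h p * X p (\<lambda>q. Y q f) + Y p f * X p h)"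
      if X: "X \<in> vfields M" and Y: "Y \<in> vfields M" for X Y
    proof -
      note s = vfields_smooth[OF X] vfields_smooth[OF Y]
      note t = vfields_tangent[OF X p] vfields_tangent[OF Y p]
      have "X p (\<lambda>q. Y q (\<lambda>x. f x * h x)) = X p (\<lambda>q. f q * Y q h + h q * Y q f)"
        by (rule tangent_cong[OF t(1) p add_in[OF mult_in[OF f s(2)[OF h]] mult_in[OF h s(2)[OF f]]]])
           (rule tangent_mult_fun[OF vfields_tangent[OF Y] f h])
      then show ?thesis
        by (simp add: tangent_add_fun[OF t(1) mult_in[OF f s(2)[OF h]] mult_in[OF h s(2)[OF f]]]
            tangent_mult_fun[OF t(1) f s(2)[OF h]] tangent_mult_fun[OF t(1) h s(2)[OF f]])
    qed
    show "bracket M X Y p (\<lambda>x. f x * h x) = f p * bracket M X Y p h + h p * bracket M X Y p f"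
      using f h mult_in by (simp add: bracket_def e1[OF X Y] e1[OF Y X] algebra_simps)
  next
    fix f c
    assume f: "f \<in> smooth_funs M"
    have "X p (\<lambda>q. Y q (\<lambda>x. c * f x)) = c * X p (\<lambda>q. Y q f)" if X: "X \<in> vfields M" and Y: "Y \<in> vfields M" for X Y
    proof -
      have "X p (\<lambda>q. Y q (\<lambda>x. c * f x)) = X p (\<lambda>q. c * Y q f)"
        by (rule tangent_cong[OF vfields_tangent[OF X p] p cmult_in[OF vfields_smooth[OF Y f]]])
           (rule tangent_cmult_fun[OF vfields_tangent[OF Y] f])
      then show ?thesis using tangent_cmult_fun[OF vfields_tangent[OF X p] vfields_smooth[OF Y f]] by simp
    qed
    with X Y show "bracket M X Y p (\<lambda>x. c * f x) = c * bracket M X Y p f"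
      using f cmult_in by (simp add: bracket_def algebra_simps)
  qed (simp add: bracket_def)
next
  show "bracket M X Y p = 0" if "p \<notin> points M" for p
    using vfields_outside[OF X that] vfields_outside[OF Y that] by (auto simp: bracket_def)
  show "(\<lambda>p. bracket M X Y p f) \<in> smooth_funs M" if f: "f \<in> smooth_funs M" for f
    using f by (auto simp: bracket_def intro!: diff_in vfields_smooth[OF X] vfields_smooth[OF Y])
qed

text \<open>The gluing principle for fields defined point by point: lifts, projections and Riesz
  representatives become smooth through a local formula.\<close>

lemma vfields_localI:
  assumes "\<And>p. p \<notin> points M \<Longrightarrow> X p = 0"
    "\<And>p. p \<in> points M \<Longrightarrow> \<exists>U Y. open U \<and> p \<in> U \<and> Y \<in> vfields M \<and> (\<forall>q\<in>U \<inter> points M. X q = Y q)"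
  shows "X \<in> vfields M"
proof (rule vfieldsI)
  show "X p \<in> tangent M p" if "p \<in> points M" for p
    using assms(2)[OF that] that vfields_tangent by fastforce
  show "(\<lambda>p. X p f) \<in> smooth_funs M" if f: "f \<in> smooth_funs M" for f
    by (rule local_in) (metis assms(2) vfields_smooth[OF _ f])
qed (fact assms(1))

end

text \<open>The axiom asks for a local dual basis only; the fields in it may be linearly dependent.
  In this form it passes from a manifold to its submanifolds without a count of dimensions.\<close>

locale smooth_fun_space = smooth_ring M
  for M :: "('m::topological_space, 'z) smooth_space_scheme" +
  assumes frame: "p \<in> points M \<Longrightarrow> \<exists>X e U. finite X \<and> X \<subseteq> smooth_funs M \<and> (\<forall>x\<in>X. e x \<in> vfields M) \<and>
        open U \<and> p \<in> U \<and>
        (\<forall>q\<in>U \<inter> points M. \<forall>u\<in>tangent M q. u = (\<Sum>x\<in>X. tscale (u x) (e x q)))"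
begin

text \<open>Freezing the coefficients of the dual basis expansion at their values for
  \<open>u\<close> gives a global field.\<close>

lemma extend_tangent:
  assumes "p \<in> points M" "u \<in> tangent M p"
  obtains X where "X \<in> vfields M" "X p = u"
proof -
  obtain X e U where e: "finite X" "X \<subseteq> smooth_funs M" "\<forall>x\<in>X. e x \<in> vfields M" "open U" "p \<in> U"
    "\<forall>q\<in>U \<inter> points M. \<forall>u\<in>tangent M q. u = (\<Sum>x\<in>X. tscale (u x) (e x q))"
    using frame[OF assms(1)] by (elim exE conjE) (rule that)
  show ?thesis
  proof (rule that)
    show "(\<Sum>x\<in>X. fscale (\<lambda>_. u x) (e x)) \<in> vfields M"
      using e(3) by (intro vfields_sum vfields_fscale const_in) blast
    have "u = (\<Sum>x\<in>X. tscale (u x) (e x p))"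
      using e(6) IntI[OF e(5) assms(1)] assms(2) by blast
    then show "(\<Sum>x\<in>X. fscale (\<lambda>_. u x) (e x)) p = u"
      unfolding sum_fun_apply fscale_def by (rule sym)
  qed
qed

lemma bracket_add:
  assumes "X \<in> vfields M" "Y \<in> vfields M" "Z \<in> vfields M" "p \<in> points M"
  shows "bracket M (X + Y) Z p = bracket M X Z p + bracket M Y Z p"
proof (rule ext)
  fix f
  show "bracket M (X + Y) Z p f = (bracket M X Z p + bracket M Y Z p) f"
    using tangent_add_fun[OF vfields_tangent[OF assms(3,4)] vfields_smooth[OF assms(1)] vfields_smooth[OF assms(2)], of f f]
    by (simp add: bracket_def)
qed

lemma bracket_fscale:
  assumes "X \<in> vfields M" "Z \<in> vfields M" "p \<in> points M" "a \<in> smooth_funs M"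
  shows "bracket M (fscale a X) Z p = tscale (a p) (bracket M X Z p) - tscale (Z p a) (X p)"
proof (rule ext)
  fix f
  show "bracket M (fscale a X) Z p f = (tscale (a p) (bracket M X Z p) - tscale (Z p a) (X p)) f"
    using tangent_mult_fun[OF vfields_tangent[OF assms(2,3)] assms(4) vfields_smooth[OF assms(1)], of f]
      tangent_outside[OF vfields_tangent[OF assms(1,3)]]
    by (auto simp: bracket_def fscale_def algebra_simps)
qed

lemma bracket_skew: "bracket M X Y p = - bracket M Y X p"
  by (auto simp: bracket_def)

lemma bracket_add_right:
  assumes "X \<in> vfields M" "Y \<in> vfields M" "Z \<in> vfields M" "p \<in> points M"
  shows "bracket M Z (X + Y) p = bracket M Z X p + bracket M Z Y p"
  using bracket_add[OF assms] bracket_skew[of Z] by simp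

lemma bracket_fscale_right:
  assumes "X \<in> vfields M" "Z \<in> vfields M" "p \<in> points M" "a \<in> smooth_funs M"
  shows "bracket M Z (fscale a X) p = tscale (a p) (bracket M Z X p) + tscale (Z p a) (X p)"
  using bracket_fscale[OF assms] bracket_skew[of Z] by (auto simp: fun_eq_iff)

lemma module_functional_sum:
  assumes "module_functional M L" "\<And>i. i \<in> I \<Longrightarrow> Z i \<in> vfields M" "finite I" "p \<in> points M"
  shows "L (\<Sum>i\<in>I. Z i) p = (\<Sum>i\<in>I. L (Z i) p)"
  using assms(3,2)
proof (induction I)
  case empty
  have z: "fscale (\<lambda>_. 0) 0 = (0 :: 'm vfield)" by (auto simp: fscale_def)
  have "L (fscale (\<lambda>_. 0) 0) p = 0 * L 0 p"
    using assms(1,4) const_in[of 0] vfields_0 unfolding module_functional_def by blast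
  then have "L 0 p = 0" unfolding z by simp
  then show ?case unfolding sum.empty .
next
  case (insert i I)
  have "L (Z i + sum Z I) p = L (Z i) p + L (sum Z I) p"
    using assms(1,4) insert.prems vfields_sum[of I Z] unfolding module_functional_def by blast
  also have "L (sum Z I) p = (\<Sum>i\<in>I. L (Z i) p)"
    using insert.IH insert.prems by blast
  finally show ?case unfolding sum.insert[OF insert.hyps] .
qed

text \<open>Multiplication by a cut-off supported in \<open>U\<close> makes the two fields equal
  everywhere, while linearity over functions takes the cut-off out again with value 1 at
  \<open>p\<close>.\<close>

lemma module_functional_cong:
  assumes L: "module_functional M L" and Z: "Z \<in> vfields M" "W \<in> vfields M"
    and p: "p \<in> points M" "open U" "p \<in> U" and eq: "\<And>q. q \<in> U \<Longrightarrow> q \<in> points M \<Longrightarrow> Z q = W q"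
  shows "L Z p = L W p"
proof -
  obtain b V where b: "b \<in> smooth_funs M" "p \<in> V" "\<forall>x\<in>V \<inter> points M. b x = 1"
    "\<forall>x\<in>points M - U. b x = 0" using bump[OF p(2,3,1)] by blast
  have "fscale b Z q = fscale b W q" for q
    using eq[of q] b(4) vfields_outside[OF Z(1), of q] vfields_outside[OF Z(2), of q]
    by (cases "q \<in> points M"; cases "q \<in> U") (auto simp: fscale_def)
  then have "fscale b Z = fscale b W" by blast
  moreover have "L (fscale b Z) p = b p * L Z p" "L (fscale b W) p = b p * L W p"
    using L Z b(1) p(1) unfolding module_functional_def by blast+
  moreover have "b p = 1" using b p by blast
  ultimately show ?thesis by simp
qed

text \<open>The dual basis expansion of \<open>Z\<close> is valid only on \<open>U\<close>; locality
  of \<open>L\<close> is what permits inserting it.\<close>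

lemma module_functional_expand:
  assumes L: "module_functional M L" and X: "finite X" "X \<subseteq> smooth_funs M" "\<forall>x\<in>X. e x \<in> vfields M"
    and U: "open U" "\<forall>q\<in>U \<inter> points M. \<forall>u\<in>tangent M q. u = (\<Sum>x\<in>X. tscale (u x) (e x q))"
    and q: "q \<in> U" "q \<in> points M" and Z: "Z \<in> vfields M"
  shows "L Z q = (\<Sum>x\<in>X. Z q x * L (e x) q)"
proof -
  let ?W = "\<Sum>x\<in>X. fscale (\<lambda>q. Z q x) (e x)"
  have zx: "(\<lambda>q. Z q x) \<in> smooth_funs M" if "x \<in> X" for x
    using vfields_smooth[OF Z] X that by blast
  have W: "fscale (\<lambda>q. Z q x) (e x) \<in> vfields M" if "x \<in> X" for x
    using X zx that by (auto intro: vfields_fscale)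
  have "L Z q = L ?W q"
  proof (rule module_functional_cong[OF L Z vfields_sum[OF W] q(2) U(1) q(1)])
    fix r assume "r \<in> U" "r \<in> points M"
    then have "Z r = (\<Sum>x\<in>X. tscale (Z r x) (e x r))"
      using U(2) vfields_tangent[OF Z] by blast
    then show "Z r = ?W r" unfolding sum_fun_apply fscale_def .
  qed
  also have "\<dots> = (\<Sum>x\<in>X. L (fscale (\<lambda>q. Z q x) (e x)) q)"
    by (rule module_functional_sum[OF L W X(1) q(2)])
  also have "\<dots> = (\<Sum>x\<in>X. Z q x * L (e x) q)"
    using L zx X q by (intro sum.cong) (auto simp: module_functional_def)
  finally show ?thesis .
qed

end

section \<open>The Levi-Civita connection\<close>

text \<open>The Riesz property is added in a second locale, because for manifolds it is proved with
  the metric rules collected here.\<close>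

locale metric_fun_space = smooth_fun_space M
  for M :: "('m::topological_space, 'z) riem_space_scheme" +
  assumes metric_pos: "p \<in> points M \<Longrightarrow> u \<in> tangent M p \<Longrightarrow> u \<noteq> 0 \<Longrightarrow> metric_tensor M p u u > 0"
    and metric_sym: "p \<in> points M \<Longrightarrow> u \<in> tangent M p \<Longrightarrow> w \<in> tangent M p \<Longrightarrow>
      metric_tensor M p u w = metric_tensor M p w u"
    and metric_tscale: "p \<in> points M \<Longrightarrow> u \<in> tangent M p \<Longrightarrow> w \<in> tangent M p \<Longrightarrow>
      metric_tensor M p (tscale c u) w = c * metric_tensor M p u w"
    and metric_add: "p \<in> points M \<Longrightarrow> u \<in> tangent M p \<Longrightarrow> w \<in> tangent M p \<Longrightarrow> z \<in> tangent M p \<Longrightarrow>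
      metric_tensor M p (u + w) z = metric_tensor M p u z + metric_tensor M p w z"
    and metric_smooth: "X \<in> vfields M \<Longrightarrow> Y \<in> vfields M \<Longrightarrow>
      (\<lambda>p. metric_tensor M p (X p) (Y p)) \<in> smooth_funs M"
begin

abbreviation ip :: "'m vfield \<Rightarrow> 'm vfield \<Rightarrow> 'm \<Rightarrow> real" where
  "ip X Y \<equiv> \<lambda>p. metric_tensor M p (X p) (Y p)"

context
  fixes p assumes p: "p \<in> points M"
begin

lemma metric_tscale_right: "u \<in> tangent M p \<Longrightarrow> w \<in> tangent M p \<Longrightarrow>
    metric_tensor M p w (tscale c u) = c * metric_tensor M p w u"
  using metric_sym[OF p] metric_tscale[OF p] tangent_tscale by metis

lemma metric_add_right: "u \<in> tangent M p \<Longrightarrow> w \<in> tangent M p \<Longrightarrow> z \<in> tangent M p \<Longrightarrow>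
    metric_tensor M p z (u + w) = metric_tensor M p z u + metric_tensor M p z w"
  using metric_sym[OF p] metric_add[OF p] tangent_add by metis

lemma metric_uminus: "u \<in> tangent M p \<Longrightarrow> w \<in> tangent M p \<Longrightarrow>
    metric_tensor M p (- u) w = - metric_tensor M p u w"
  using metric_tscale[OF p, of u w "-1"] by (simp add: tscale_minus_1)

lemma metric_uminus_right: "u \<in> tangent M p \<Longrightarrow> w \<in> tangent M p \<Longrightarrow>
    metric_tensor M p w (- u) = - metric_tensor M p w u"
  using metric_tscale_right[of u w "-1"] by (simp add: tscale_minus_1)

lemma metric_diff: "u \<in> tangent M p \<Longrightarrow> w \<in> tangent M p \<Longrightarrow> z \<in> tangent M p \<Longrightarrow>
    metric_tensor M p (u - w) z = metric_tensor M p u z - metric_tensor M p w z"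
  using metric_add[OF p, of u "- w" z] metric_uminus[of w z] by (simp add: tangent_uminus)

lemma metric_diff_right: "u \<in> tangent M p \<Longrightarrow> w \<in> tangent M p \<Longrightarrow> z \<in> tangent M p \<Longrightarrow>
    metric_tensor M p z (u - w) = metric_tensor M p z u - metric_tensor M p z w"
  using metric_add_right[of u "- w" z] metric_uminus_right[of w z] by (simp add: tangent_uminus)

lemma metric_0: "w \<in> tangent M p \<Longrightarrow> metric_tensor M p 0 w = 0"
  using metric_tscale[OF p tangent_0, of w 0] by simp

lemma metric_0_right: "w \<in> tangent M p \<Longrightarrow> metric_tensor M p w 0 = 0"
  using metric_0 metric_sym[OF p] tangent_0 by metis

lemma metric_sum: "finite I \<Longrightarrow> (\<And>i. i \<in> I \<Longrightarrow> u i \<in> tangent M p) \<Longrightarrow> w \<in> tangent M p \<Longrightarrow>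
    metric_tensor M p (\<Sum>i\<in>I. u i) w = (\<Sum>i\<in>I. metric_tensor M p (u i) w)"
  by (induction I rule: finite_induct) (auto simp: metric_0 metric_add[OF p] tangent_sum)

lemma metric_sum_right: "finite I \<Longrightarrow> (\<And>i. i \<in> I \<Longrightarrow> u i \<in> tangent M p) \<Longrightarrow> w \<in> tangent M p \<Longrightarrow>
    metric_tensor M p w (\<Sum>i\<in>I. u i) = (\<Sum>i\<in>I. metric_tensor M p w (u i))"
  by (induction I rule: finite_induct) (auto simp: metric_0_right metric_add_right tangent_sum)

lemma metric_eqI:
  assumes "u \<in> tangent M p" "w \<in> tangent M p"
    "\<And>z. z \<in> tangent M p \<Longrightarrow> metric_tensor M p u z = metric_tensor M p w z"
  shows "u = w"
proof (rule ccontr)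
  assume "u \<noteq> w"
  moreover have "metric_tensor M p (u - w) (u - w) = 0"
    using assms by (simp add: metric_diff tangent_diff)
  ultimately show False
    using metric_pos[OF p tangent_diff[OF assms(1,2)]] by simp
qed

end

text \<open>Orthogonal projection onto the span of a finite set, described through the double complement.\<close>

lemma orthogonal_decomposition:
  assumes p: "p \<in> points M" and A: "finite A" "A \<subseteq> tangent M p"
  shows "\<forall>u\<in>tangent M p. \<exists>h\<in>tangent M p. (\<forall>a\<in>A. metric_tensor M p (u - h) a = 0) \<and>
    (\<forall>w\<in>tangent M p. (\<forall>a\<in>A. metric_tensor M p w a = 0) \<longrightarrow> metric_tensor M p h w = 0)"
  using A
proof (induction A)
  case empty
  show ?case using metric_0[OF p] by (auto intro!: bexI[of _ 0])
next
  case (insert a A)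
  note rules = metric_add[OF p] metric_add_right[OF p] metric_diff[OF p] metric_diff_right[OF p]
    metric_tscale[OF p] metric_tscale_right[OF p] tangent_add tangent_diff tangent_tscale
  have a: "a \<in> tangent M p" and A: "\<And>b. b \<in> A \<Longrightarrow> b \<in> tangent M p" using insert.prems by auto
  note IH = insert.IH[OF conjunct2[OF insert.prems[unfolded insert_subset]]]
  obtain b where b: "b \<in> tangent M p" and ab: "\<forall>x\<in>A. metric_tensor M p (a - b) x = 0"
    and bw: "\<forall>w\<in>tangent M p. (\<forall>x\<in>A. metric_tensor M p w x = 0) \<longrightarrow> metric_tensor M p b w = 0"
    using IH[rule_format, OF a] by (elim bexE conjE) (rule that)
  \<comment> \<open>The Gram-Schmidt step: \<open>b\<close> is the projection of \<open>a\<close> to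
    the span of \<open>A\<close>, so \<open>n\<close> is the new direction orthogonal to
    \<open>A\<close>.\<close>
  define n where "n = a - b"
  have n: "n \<in> tangent M p" using a b by (simp add: n_def tangent_diff)
  show ?case
  proof
    fix u assume u: "u \<in> tangent M p"
    obtain h where h: "h \<in> tangent M p" and uh: "\<forall>x\<in>A. metric_tensor M p (u - h) x = 0"
      and hw: "\<forall>w\<in>tangent M p. (\<forall>x\<in>A. metric_tensor M p w x = 0) \<longrightarrow> metric_tensor M p h w = 0"
      using IH[rule_format, OF u] by (elim bexE conjE) (rule that)
    \<comment> \<open>If \<open>a\<close> already lies in the span of \<open>A\<close>, then
      \<open>n = 0\<close>; division by zero gives \<open>c = 0\<close>, and the old projection
      \<open>h\<close> is kept.\<close>
    define c where "c = metric_tensor M p (u - h) n / metric_tensor M p n n"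
    define k where "k = h + tscale c n"
    have k: "k \<in> tangent M p" using h n by (simp add: k_def rules)
    have uk: "metric_tensor M p (u - k) x = 0" if "x \<in> A" for x
      using uh[rule_format, OF that] ab[rule_format, OF that] A[OF that] u h n
      by (simp add: k_def n_def[symmetric] rules)
    have "metric_tensor M p (u - k) a = metric_tensor M p (u - k) n + metric_tensor M p (u - k) b"
      using u k a b by (simp add: n_def rules)
    also have "metric_tensor M p (u - k) b = 0"
      using bw uk u k b by (simp add: metric_sym[OF p, of b] rules)
    also have "metric_tensor M p (u - k) n = 0"
    proof (cases "n = 0")
      case True
      then show ?thesis using metric_0_right[OF p] u k by (simp add: rules)
    next
      case False
      then have "metric_tensor M p n n \<noteq> 0" using metric_pos[OF p n] by simp
      then show ?thesis using u h n by (simp add: k_def c_def rules)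
    qed
    finally have ua: "metric_tensor M p (u - k) a = 0" unfolding add_0_left .
    have kw: "metric_tensor M p k w = 0"
      if w: "w \<in> tangent M p" and wA: "\<forall>x\<in>insert a A. metric_tensor M p w x = 0" for w
    proof -
      have wA': "\<forall>x\<in>A. metric_tensor M p w x = 0" and wa: "metric_tensor M p a w = 0"
        using wA metric_sym[OF p a w] by auto
      then show ?thesis
        using hw[rule_format, OF w] bw[rule_format, OF w] w a b h n by (simp add: k_def n_def rules)
    qed
    show "\<exists>h\<in>tangent M p. (\<forall>x\<in>insert a A. metric_tensor M p (u - h) x = 0) \<and>
      (\<forall>w\<in>tangent M p. (\<forall>x\<in>insert a A. metric_tensor M p w x = 0) \<longrightarrow> metric_tensor M p h w = 0)"
    proof (intro bexI[OF _ k] conjI ballI impI)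
      show "metric_tensor M p (u - k) x = 0" if "x \<in> insert a A" for x
        using that ua uk by (elim insertE) (simp only:, rule uk)
      show "metric_tensor M p k w = 0"
        if "w \<in> tangent M p" "\<forall>x\<in>insert a A. metric_tensor M p w x = 0" for w
        by (rule kw[OF that])
    qed
  qed
qed

lemma vfields_eqI:
  assumes "X \<in> vfields M" "Y \<in> vfields M"
    "\<And>p Z. p \<in> points M \<Longrightarrow> Z \<in> vfields M \<Longrightarrow> metric_tensor M p (X p) (Z p) = metric_tensor M p (Y p) (Z p)"
  shows "X = Y"
proof (rule ext)
  fix p
  show "X p = Y p"
  proof (cases "p \<in> points M")
    case True
    then show ?thesis
      by (metis metric_eqI[OF True vfields_tangent[OF assms(1) True] vfields_tangent[OF assms(2) True]]
          extend_tangent assms(3))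
  qed (simp add: vfields_outside[OF assms(1)] vfields_outside[OF assms(2)])
qed

end

locale riemannian_fun_space = metric_fun_space M
  for M :: "('m::topological_space, 'z) riem_space_scheme" +
  assumes riesz_local: "module_functional M L \<Longrightarrow> p \<in> points M \<Longrightarrow>
      \<exists>W\<in>vfields M. \<exists>U. open U \<and> p \<in> U \<and>
        (\<forall>q\<in>U \<inter> points M. \<forall>Z\<in>vfields M. metric_tensor M q (W q) (Z q) = L Z q)"
begin

text \<open>Every tangent vector extends to a field, so a representing vector is unique at each
  point. Local representatives therefore agree on overlaps and glue.\<close>

lemma riesz:
  assumes L: "module_functional M L"
  shows "\<exists>W. W \<in> vfields M \<and> (\<forall>p\<in>points M. \<forall>Z\<in>vfields M. metric_tensor M p (W p) (Z p) = L Z p)"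
proof -
  let ?P = "\<lambda>p w. w \<in> tangent M p \<and> (\<forall>Z\<in>vfields M. metric_tensor M p w (Z p) = L Z p)"
  define W where "W = (\<lambda>p. if p \<in> points M then THE w. ?P p w else 0)"
  have uniq: "w = w'" if "p \<in> points M" "?P p w" "?P p w'" for p w w'
  proof (rule metric_eqI[OF that(1)])
    fix z assume "z \<in> tangent M p"
    then obtain Z where "Z \<in> vfields M" "Z p = z" by (rule extend_tangent[OF \<open>p \<in> points M\<close>])
    then show "metric_tensor M p w z = metric_tensor M p w' z" using that by auto
  qed (use that in auto)
  have W: "\<exists>U Y. open U \<and> p \<in> U \<and> Y \<in> vfields M \<and>
     (\<forall>q\<in>U \<inter> points M. W q = Y q \<and> (\<forall>Z\<in>vfields M. metric_tensor M q (Y q) (Z q) = L Z q))"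
    if "p \<in> points M" for p
  proof -
    from riesz_local[OF L \<open>p \<in> points M\<close>] obtain Y where Y0: "Y \<in> vfields M"
      and "\<exists>U. open U \<and> p \<in> U \<and>
        (\<forall>q\<in>U \<inter> points M. \<forall>Z\<in>vfields M. metric_tensor M q (Y q) (Z q) = L Z q)"
      by (rule bexE)
    then obtain U where "open U \<and> p \<in> U \<and>
        (\<forall>q\<in>U \<inter> points M. \<forall>Z\<in>vfields M. metric_tensor M q (Y q) (Z q) = L Z q)"
      by (elim exE)
    with Y0 have Y: "Y \<in> vfields M" "open U" "p \<in> U"
      "\<forall>q\<in>U \<inter> points M. \<forall>Z\<in>vfields M. metric_tensor M q (Y q) (Z q) = L Z q"
      by simp_all
    have "W q = Y q" if "q \<in> U \<inter> points M" for q
    proof -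
      have q: "q \<in> points M" using that by simp
      have PY: "?P q (Y q)" using Y(4) that vfields_tangent[OF Y(1) q] by simp
      have "(THE w. ?P q w) = Y q"
        by (rule the_equality[of "?P q", OF PY]) (rule uniq[OF q _ PY])
      then show ?thesis using q by (simp add: W_def)
    qed
    then show ?thesis using Y by (intro exI[of _ U] exI[of _ Y]) simp
  qed
  have "W \<in> vfields M"
  proof (rule vfields_localI)
    show "W p = 0" if "p \<notin> points M" for p
      using that by (simp add: W_def)
    show "\<exists>U Y. open U \<and> p \<in> U \<and> Y \<in> vfields M \<and> (\<forall>q\<in>U \<inter> points M. W q = Y q)" if "p \<in> points M" for p
      using W[OF that] by (elim exE) (intro exI, auto)
  qed
  moreover have "metric_tensor M p (W p) (Z p) = L Z p" if "p \<in> points M" "Z \<in> vfields M" for p Z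
  proof -
    from W[OF that(1)] obtain U Y where "p \<in> U" "\<forall>q\<in>U \<inter> points M. W q = Y q \<and>
       (\<forall>Z\<in>vfields M. metric_tensor M q (Y q) (Z q) = L Z q)" by (elim exE) auto
    then show ?thesis using that by simp
  qed
  ultimately show ?thesis by (intro exI[of _ W]) simp
qed

definition grad :: "('m \<Rightarrow> real) \<Rightarrow> 'm vfield" where
  "grad f = (SOME W. W \<in> vfields M \<and>
     (\<forall>p\<in>points M. \<forall>Z\<in>vfields M. metric_tensor M p (W p) (Z p) = Z p f))"

lemma
  assumes f: "f \<in> smooth_funs M"
  shows vfields_grad: "grad f \<in> vfields M"
    and metric_grad: "p \<in> points M \<Longrightarrow> u \<in> tangent M p \<Longrightarrow> metric_tensor M p (grad f p) u = u f"
proof -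
  have "module_functional M (\<lambda>Z p. Z p f)"
    unfolding module_functional_def using f by (simp add: vfields_smooth fscale_def)
  from riesz[OF this] have g: "grad f \<in> vfields M \<and>
     (\<forall>p\<in>points M. \<forall>Z\<in>vfields M. metric_tensor M p (grad f p) (Z p) = Z p f)"
    unfolding grad_def by (rule someI_ex)
  then show "grad f \<in> vfields M" by (rule conjunct1)
  assume p: "p \<in> points M" and u: "u \<in> tangent M p"
  obtain Z where "Z \<in> vfields M" "Z p = u" by (rule extend_tangent[OF p u])
  then show "metric_tensor M p (grad f p) u = u f" using g p by auto
qed

section \<open>The Koszul formula, and existence of the Levi-Civita connection\<close>

lemma tangent_ip_add:
  assumes "u \<in> tangent M p" "p \<in> points M" "X \<in> vfields M" "Y \<in> vfields M" "Z \<in> vfields M"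
  shows "u (\<lambda>q. metric_tensor M q (X q + Y q) (Z q)) = u (ip X Z) + u (ip Y Z)"
    "u (\<lambda>q. metric_tensor M q (Z q) (X q + Y q)) = u (ip Z X) + u (ip Z Y)"
proof -
  have "u (\<lambda>q. metric_tensor M q (X q + Y q) (Z q)) = u (\<lambda>q. ip X Z q + ip Y Z q)"
    by (rule tangent_cong[OF assms(1,2)])
       (use assms in \<open>auto intro!: add_in metric_smooth simp: metric_add vfields_tangent\<close>)
  then show "u (\<lambda>q. metric_tensor M q (X q + Y q) (Z q)) = u (ip X Z) + u (ip Y Z)"
    using assms by (simp add: tangent_add_fun[OF assms(1)] metric_smooth)
  have "u (\<lambda>q. metric_tensor M q (Z q) (X q + Y q)) = u (\<lambda>q. ip Z X q + ip Z Y q)"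
    by (rule tangent_cong[OF assms(1,2)])
       (use assms in \<open>auto intro!: add_in metric_smooth simp: metric_add_right vfields_tangent\<close>)
  then show "u (\<lambda>q. metric_tensor M q (Z q) (X q + Y q)) = u (ip Z X) + u (ip Z Y)"
    using assms by (simp add: tangent_add_fun[OF assms(1)] metric_smooth)
qed

lemma tangent_ip_fscale:
  assumes "u \<in> tangent M p" "p \<in> points M" "X \<in> vfields M" "Z \<in> vfields M" "a \<in> smooth_funs M"
  shows "u (ip (fscale a X) Z) = a p * u (ip X Z) + u a * ip X Z p"
    "u (ip Z (fscale a X)) = a p * u (ip Z X) + u a * ip Z X p"
proof -
  have "u (ip (fscale a X) Z) = u (\<lambda>q. a q * ip X Z q)"
    by (rule tangent_cong[OF assms(1,2)])
       (use assms in \<open>auto intro!: mult_in metric_smooth simp: metric_tscale vfields_tangent fscale_def\<close>)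
  then show "u (ip (fscale a X) Z) = a p * u (ip X Z) + u a * ip X Z p"
    using assms by (simp add: tangent_mult_fun[OF assms(1)] metric_smooth)
  have "u (ip Z (fscale a X)) = u (\<lambda>q. a q * ip Z X q)"
    by (rule tangent_cong[OF assms(1,2)])
       (use assms in \<open>auto intro!: mult_in metric_smooth simp: metric_tscale_right vfields_tangent fscale_def\<close>)
  then show "u (ip Z (fscale a X)) = a p * u (ip Z X) + u a * ip Z X p"
    using assms by (simp add: tangent_mult_fun[OF assms(1)] metric_smooth)
qed

lemma tangent_ip_sym:
  assumes "u \<in> tangent M p" "p \<in> points M" "X \<in> vfields M" "Z \<in> vfields M"
  shows "u (ip X Z) = u (ip Z X)"
  by (rule tangent_cong[OF assms(1,2) metric_smooth[OF assms(4,3)]])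
     (rule metric_sym[OF _ vfields_tangent[OF assms(3)] vfields_tangent[OF assms(4)]])

text \<open>Half of the usual right-hand side, so that it equals \<open>g(D X Y, Z)\<close> without
  a factor.\<close>

definition koszul :: "'m vfield \<Rightarrow> 'm vfield \<Rightarrow> 'm vfield \<Rightarrow> 'm \<Rightarrow> real" where
  "koszul X Y Z p = (1/2) * (X p (ip Y Z) + Y p (ip X Z) - Z p (ip X Y) +
     ip (bracket M X Y) Z p - ip (bracket M X Z) Y p - ip (bracket M Y Z) X p)"

lemma koszul_smooth:
  assumes "X \<in> vfields M" "Y \<in> vfields M" "Z \<in> vfields M"
  shows "koszul X Y Z \<in> smooth_funs M"
proof -
  note m = metric_smooth[OF assms(1,2)] metric_smooth[OF assms(1,3)] metric_smooth[OF assms(2,3)]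
    metric_smooth[OF vfields_bracket[OF assms(1,2)] assms(3)]
    metric_smooth[OF vfields_bracket[OF assms(1,3)] assms(2)]
    metric_smooth[OF vfields_bracket[OF assms(2,3)] assms(1)]
  show ?thesis
    unfolding koszul_def[abs_def]
    by (intro cmult_in add_in diff_in m vfields_smooth[OF assms(1) m(3)] vfields_smooth[OF assms(2) m(2)]
        vfields_smooth[OF assms(3) m(1)])
qed

lemmas ip_rules = metric_add metric_add_right metric_diff metric_diff_right metric_tscale
  metric_tscale_right metric_uminus metric_uminus_right
lemmas vec_rules = vfields_tangent tangent_add tangent_diff tangent_tscale tangent_uminus
  vfields_bracket vfields_add vfields_fscale

text \<open>For \<open>fscale a Z\<close> the terms with \<open>X p a\<close> and
  \<open>Y p a\<close> from the metric products cancel against those from the brackets with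
  \<open>Z\<close>. This linearity in the last argument is what makes \<open>riesz\<close>
  applicable.\<close>

lemma module_functional_koszul:
  assumes XY: "X \<in> vfields M" "Y \<in> vfields M"
  shows "module_functional M (koszul X Y)"
  unfolding module_functional_def
proof (intro ballI conjI)
  fix Z p assume Z: "Z \<in> vfields M" and p: "p \<in> points M"
  note sym = metric_sym[OF p vfields_tangent[OF XY(1) p] vfields_tangent[OF XY(2) p]]
    metric_sym[OF p vfields_tangent[OF XY(1) p] vfields_tangent[OF Z p]]
    metric_sym[OF p vfields_tangent[OF XY(2) p] vfields_tangent[OF Z p]]
  show "koszul X Y (Z + W) p = koszul X Y Z p + koszul X Y W p" if W: "W \<in> vfields M" for W
    using XY Z W p by (simp add: koszul_def tangent_ip_add[OF _ p] bracket_add_right ip_rules vec_rules algebra_simps)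
  show "koszul X Y (fscale a Z) p = a p * koszul X Y Z p" if a: "a \<in> smooth_funs M" for a
    using XY Z a p
    by (simp add: koszul_def tangent_ip_fscale[OF _ p] bracket_fscale_right ip_rules vec_rules, simp add: fscale_def ip_rules vec_rules sym algebra_simps)
qed (rule koszul_smooth[OF XY])

text \<open>Metric compatibility rewrites the three derivatives and vanishing torsion the three
  brackets; what remains is \<open>g(D X Y, Z)\<close>. The connection is thereby determined on
  vector fields, and later comparisons of connections reduce to comparing Koszul
  expressions.\<close>

lemma is_levi_civita_koszul:
  assumes D: "is_levi_civita M D" and XYZ: "X \<in> vfields M" "Y \<in> vfields M" "Z \<in> vfields M" and p: "p \<in> points M"
  shows "metric_tensor M p (D X Y p) (Z p) = koszul X Y Z p"
proof -
  have in_D: "D X Y \<in> vfields M" if "X \<in> vfields M" "Y \<in> vfields M" for X Y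
    using D that unfolding is_levi_civita_def affine_connection_def by simp
  have comp: "X p (ip Y Z) = metric_tensor M p (D X Y p) (Z p) + metric_tensor M p (Y p) (D X Z p)"
    if "X \<in> vfields M" "Y \<in> vfields M" "Z \<in> vfields M" for X Y Z
    using D that p unfolding is_levi_civita_def by simp
  have tor: "bracket M X Y p = D X Y p - D Y X p" if "X \<in> vfields M" "Y \<in> vfields M" for X Y
  proof -
    have "D X Y - D Y X = bracket M X Y" using D that unfolding is_levi_civita_def by simp
    from fun_cong[OF this, of p] show ?thesis by simp
  qed
  show ?thesis
    using XYZ p unfolding koszul_def
    by (simp add: comp tor ip_rules vec_rules in_D metric_sym[OF p, of "D _ _ p"])
qed

text \<open>\<open>D X Y\<close> is the Riesz representative of \<open>koszul X Y\<close>. By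
  nondegeneracy, the equations between fields are tested against a further field \<open>V\<close>;
  each axiom then becomes an identity between Koszul expressions.\<close>

lemma levi_civita_exists: "\<exists>D. is_levi_civita M D"
proof -
  let ?P = "\<lambda>X Y W. W \<in> vfields M \<and>
     (\<forall>p\<in>points M. \<forall>Z\<in>vfields M. metric_tensor M p (W p) (Z p) = koszul X Y Z p)"
  define D where "D = (\<lambda>X Y. SOME W. ?P X Y W)"
  have PD: "?P X Y (D X Y)" if "X \<in> vfields M" "Y \<in> vfields M" for X Y
    unfolding D_def using riesz[OF module_functional_koszul[OF that]] by (rule someI_ex)
  have in_D: "D X Y \<in> vfields M" if "X \<in> vfields M" "Y \<in> vfields M" for X Y
    using PD[OF that] by (rule conjunct1)
  have D: "metric_tensor M p (D X Y p) (Z p) = koszul X Y Z p"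
    if "X \<in> vfields M" "Y \<in> vfields M" "Z \<in> vfields M" "p \<in> points M" for X Y Z p
    using PD[OF that(1,2)] that(3,4) by simp
  have symZ: "metric_tensor M p (X p) (Y p) = metric_tensor M p (Y p) (X p)"
    if "X \<in> vfields M" "Y \<in> vfields M" "p \<in> points M" for X Y p
    using metric_sym[OF that(3) vfields_tangent[OF that(1,3)] vfields_tangent[OF that(2,3)]] .
  have D': "metric_tensor M p (Z p) (D X Y p) = koszul X Y Z p"
    if "X \<in> vfields M" "Y \<in> vfields M" "Z \<in> vfields M" "p \<in> points M" for X Y Z p
    using D[OF that] symZ[OF in_D[OF that(1,2)] that(3,4)] by simp
  have "is_levi_civita M D"
    unfolding is_levi_civita_def affine_connection_def
  proof (intro ballI conjI)
    fix X Y assume X: "X \<in> vfields M" and Y: "Y \<in> vfields M"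
    show "D X Y \<in> vfields M" by (rule in_D[OF X Y])
    {
      fix Z assume Z: "Z \<in> vfields M"
      show "D (X + Y) Z = D X Z + D Y Z"
      proof (rule vfields_eqI)
        fix p V assume p: "p \<in> points M" and V: "V \<in> vfields M"
        show "metric_tensor M p (D (X + Y) Z p) (V p) = metric_tensor M p ((D X Z + D Y Z) p) (V p)"
          using X Y Z V p
          by (simp add: D vfields_add in_D ip_rules vec_rules koszul_def tangent_ip_add[OF _ p] bracket_add algebra_simps)
      qed (use X Y Z in_D vfields_add in auto)
      show "D X (Y + Z) = D X Y + D X Z"
      proof (rule vfields_eqI)
        fix p V assume p: "p \<in> points M" and V: "V \<in> vfields M"
        show "metric_tensor M p (D X (Y + Z) p) (V p) = metric_tensor M p ((D X Y + D X Z) p) (V p)"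
          using X Y Z V p
          by (simp add: D vfields_add in_D ip_rules vec_rules koszul_def tangent_ip_add[OF _ p]
              bracket_add bracket_add_right algebra_simps)
      qed (use X Y Z in_D vfields_add in auto)
    }
    {
      fix a assume a: "a \<in> smooth_funs M"
      show "D (fscale a X) Y = fscale a (D X Y)"
      proof (rule vfields_eqI)
        fix p V assume p: "p \<in> points M" and V: "V \<in> vfields M"
        have "metric_tensor M p (fscale a (D X Y) p) (V p) = a p * koszul X Y V p"
          using X Y V p a by (simp add: fscale_def D in_D ip_rules vec_rules)
        moreover have "koszul (fscale a X) Y V p = a p * koszul X Y V p"
          using X Y V p a
          by (simp add: koszul_def tangent_ip_fscale[OF _ p] bracket_fscale ip_rules vec_rules,
              simp add: fscale_def ip_rules vec_rules symZ[OF X Y] symZ[OF Y V] symZ[OF X V] algebra_simps)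
        ultimately show "metric_tensor M p (D (fscale a X) Y p) (V p) = metric_tensor M p (fscale a (D X Y) p) (V p)"
          using X Y V p a by (simp add: D vfields_fscale)
      qed (use X Y a in_D vfields_fscale in auto)
      show "D X (fscale a Y) = fscale (\<lambda>p. X p a) Y + fscale a (D X Y)"
      proof (rule vfields_eqI)
        fix p V assume p: "p \<in> points M" and V: "V \<in> vfields M"
        have "metric_tensor M p ((fscale (\<lambda>p. X p a) Y + fscale a (D X Y)) p) (V p) =
            X p a * metric_tensor M p (Y p) (V p) + a p * koszul X Y V p"
          using X Y V p a by (simp add: fscale_def D in_D ip_rules vec_rules)
        moreover have "koszul X (fscale a Y) V p = X p a * metric_tensor M p (Y p) (V p) + a p * koszul X Y V p"
          using X Y V p a
          by (simp add: koszul_def tangent_ip_fscale[OF _ p] bracket_fscale bracket_fscale_right ip_rules vec_rules,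
              simp add: fscale_def ip_rules vec_rules symZ[OF X Y] symZ[OF Y V] symZ[OF X V] algebra_simps)
        ultimately show "metric_tensor M p (D X (fscale a Y) p) (V p) =
            metric_tensor M p ((fscale (\<lambda>p. X p a) Y + fscale a (D X Y)) p) (V p)"
          using X Y V p a by (simp add: D vfields_fscale)
      qed (use vfields_add[OF vfields_fscale[OF vfields_smooth[OF X a] Y] vfields_fscale[OF a in_D[OF X Y]]]
          in_D[OF X vfields_fscale[OF a Y]] in auto)
    }
    show "D X Y - D Y X = bracket M X Y"
    proof (rule vfields_eqI)
      fix p V assume p: "p \<in> points M" and V: "V \<in> vfields M"
      \<comment> \<open>All terms symmetric in \<open>X\<close> and \<open>Y\<close> disappear; the
        two halves of the bracket term add up.\<close>
      have "koszul X Y V p - koszul Y X V p = metric_tensor M p (bracket M X Y p) (V p)"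
        using X Y V p tangent_ip_sym[OF vfields_tangent[OF V p] p X Y]
        by (simp add: koszul_def bracket_skew[of Y X] ip_rules vec_rules algebra_simps)
      then show "metric_tensor M p ((D X Y - D Y X) p) (V p) = metric_tensor M p (bracket M X Y p) (V p)"
        using X Y V p by (simp add: D in_D ip_rules vec_rules)
    qed (use X Y in_D vfields_diff vfields_bracket in auto)
    fix Z p assume Z: "Z \<in> vfields M" and p: "p \<in> points M"
    note s = tangent_ip_sym[OF vfields_tangent[OF _ p] p]
    \<comment> \<open>In \<open>koszul X Y Z + koszul X Z Y\<close> everything cancels except the
      two halves of \<open>X p (ip Y Z)\<close>.\<close>
    show "X p (ip Y Z) = metric_tensor M p (D X Y p) (Z p) + metric_tensor M p (Y p) (D X Z p)"
      using X Y Z p s[OF X Y Z] s[OF Y X Z] s[OF Z X Y] bracket_skew[of Z Y p] bracket_skew[of Z X p] bracket_skew[of Y X p]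
      by (simp add: D D' koszul_def ip_rules vec_rules algebra_simps)
  qed
  then show ?thesis by (intro exI[of _ D])
qed

lemma is_levi_civita_levi_civita: "is_levi_civita M (levi_civita M)"
  unfolding levi_civita_def using levi_civita_exists by (rule someI_ex)

lemmas levi_civita_koszul = is_levi_civita_koszul[OF is_levi_civita_levi_civita]

lemma
  assumes "X \<in> vfields M" "Y \<in> vfields M"
  shows levi_civita_vfields: "levi_civita M X Y \<in> vfields M"
    and levi_civita_torsion: "levi_civita M X Y - levi_civita M Y X = bracket M X Y"
    and levi_civita_add: "Z \<in> vfields M \<Longrightarrow> levi_civita M X (Y + Z) = levi_civita M X Y + levi_civita M X Z"
    and levi_civita_metric: "Z \<in> vfields M \<Longrightarrow> p \<in> points M \<Longrightarrow> X p (ip Y Z) =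
      metric_tensor M p (levi_civita M X Y p) (Z p) + metric_tensor M p (Y p) (levi_civita M X Z p)"
  using is_levi_civita_levi_civita assms
  by (simp_all add: is_levi_civita_def affine_connection_def)

end

section \<open>Charts of smooth manifolds\<close>

text \<open>The model space is only the span of \<open>B\<close>, yet \<open>D\<close> is open in
  the whole Euclidean space: \<kappa> is the chart inverse precomposed with orthogonal projection.
  Hence \<psi> after \<kappa> is the projection and not the identity, and all calculus takes place
  on open sets. \<open>extend_in\<close> is the device for extending compactly supported functions
  by zero.\<close>

locale manifold_chart =
  fixes M :: "('m::t2_space, 'z) smooth_space_scheme"
    and B :: "'a::euclidean_space set" and U \<psi> D \<kappa>
  assumes finite_B: "finite B" and ortho: "\<And>b c. b \<in> B \<Longrightarrow> c \<in> B \<Longrightarrow> b \<bullet> c = (if b = c then 1 else 0)"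
    and U_sub: "U \<subseteq> points M" and U_open: "openin (top_of_set (points M)) U"
    and D_open: "open D" and cont_\<psi>: "continuous_on U \<psi>" and cont_\<kappa>: "continuous_on D \<kappa>"
    and \<kappa>_in: "z \<in> D \<Longrightarrow> \<kappa> z \<in> U" and \<psi>_in: "q \<in> U \<Longrightarrow> \<psi> q \<in> D"
    and \<kappa>_\<psi>: "q \<in> U \<Longrightarrow> \<kappa> (\<psi> q) = q"
    and \<psi>_\<kappa>: "z \<in> D \<Longrightarrow> \<psi> (\<kappa> z) = (\<Sum>b\<in>B. (z \<bullet> b) *\<^sub>R b)"
    and smooth_\<kappa>: "f \<in> smooth_funs M \<Longrightarrow> Cinf D (\<lambda>z. f (\<kappa> z))"
    and extend_in: "compact K \<Longrightarrow> K \<subseteq> U \<Longrightarrow> (\<And>q. q \<notin> K \<Longrightarrow> f q = 0) \<Longrightarrow>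
      Cinf D (\<lambda>z. f (\<kappa> z)) \<Longrightarrow> f \<in> smooth_funs M"
begin

definition P :: "'a \<Rightarrow> 'a" where "P z = (\<Sum>b\<in>B. (z \<bullet> b) *\<^sub>R b)"

lemma linear_P: "linear P"
  unfolding P_def by (intro linearI) (simp_all add: inner_left_distrib scaleR_left_distrib sum.distrib scaleR_sum_right)

lemma continuous_P: "continuous_on S P"
  using linear_P linear_continuous_on linear_conv_bounded_linear by blast

lemma P_inner: "c \<in> B \<Longrightarrow> P z \<bullet> c = z \<bullet> c"
  by (simp add: P_def inner_sum_left ortho finite_B if_distrib[of "\<lambda>x. _ * x"] sum.delta' cong: if_cong)

lemma P_\<psi>: "q \<in> U \<Longrightarrow> P (\<psi> q) = \<psi> q"
  using \<psi>_\<kappa>[OF \<psi>_in] \<kappa>_\<psi> unfolding P_def by simp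

lemma chart_nhd:
  assumes "open S"
  obtains V where "open V" "V \<inter> points M = {q \<in> U. \<psi> q \<in> S}"
proof -
  have "openin (top_of_set U) (U \<inter> \<psi> -` S)"
    by (rule continuous_openin_preimage_gen[OF cont_\<psi> assms])
  then have "openin (top_of_set (points M)) (U \<inter> \<psi> -` S)"
    using U_open openin_trans by blast
  then obtain V where "open V" "U \<inter> \<psi> -` S = points M \<inter> V" by (auto simp: openin_open)
  then show ?thesis using that[of V] by auto
qed

lemma chart_bump:
  assumes "p \<in> U" "open W" "p \<in> W" "open D'" "\<psi> p \<in> D'"
  obtains \<beta> :: "'a \<Rightarrow> real" and r where "r > 0" "Cinf UNIV \<beta>" "\<And>z. z \<in> ball (\<psi> p) (r/2) \<Longrightarrow> \<beta> z = 1"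
    "\<And>z. z \<notin> cball (\<psi> p) r \<Longrightarrow> \<beta> z = 0" "\<And>z. 0 \<le> \<beta> z" "\<And>z. \<beta> z \<le> 1"
    "cball (\<psi> p) r \<subseteq> D" "cball (\<psi> p) r \<subseteq> D'" "\<kappa> ` cball (\<psi> p) r \<subseteq> W"
proof -
  have "open (D \<inter> \<kappa> -` W)"
    using continuous_open_preimage[OF cont_\<kappa> D_open assms(2)] .
  then have "open ((D \<inter> \<kappa> -` W) \<inter> D')" using assms(4) by blast
  moreover have "\<psi> p \<in> (D \<inter> \<kappa> -` W) \<inter> D'"
    using assms \<psi>_in \<kappa>_\<psi> by simp
  ultimately obtain r where r: "r > 0" "cball (\<psi> p) r \<subseteq> (D \<inter> \<kappa> -` W) \<inter> D'"
    using open_contains_cball by blast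
  obtain \<beta> :: "'a \<Rightarrow> real" where \<beta>: "Cinf UNIV \<beta>" "\<And>z. z \<in> ball (\<psi> p) (r/2) \<Longrightarrow> \<beta> z = 1"
    "\<And>z. z \<notin> ball (\<psi> p) r \<Longrightarrow> \<beta> z = 0" "\<And>z. 0 \<le> \<beta> z" "\<And>z. \<beta> z \<le> 1"
    using bump_euclidean[OF r(1)] by metis
  show ?thesis
    by (rule that[OF r(1) \<beta>(1,2) _ \<beta>(4,5)]) (use r \<beta>(3) ball_subset_cball[of "\<psi> p" r] in auto)
qed

text \<open>Extension by zero of a cut-off function in the chart; \<open>g\<close> matters only
  where \<beta> does not vanish, so it may be defined on a small set.\<close>

definition from_chart :: "('a \<Rightarrow> real) \<Rightarrow> ('a \<Rightarrow> real) \<Rightarrow> 'm \<Rightarrow> real" where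
  "from_chart \<beta> g q = (if q \<in> U then \<beta> (\<psi> q) * g (\<psi> q) else 0)"

text \<open>The support lies in the image of a closed ball, which is compact, so
  \<open>extend_in\<close> applies. In the chart the function reads \<beta> times \<open>g\<close>
  after the projection \<open>P\<close>: it is smooth where \<open>P z\<close> lies in
  \<open>D'\<close>, and identically 0 where \<open>P z\<close> is off the closed ball. These two
  open sets cover the chart domain.\<close>

lemma from_chart_in:
  assumes \<beta>: "Cinf UNIV \<beta>" "\<And>z. z \<notin> cball a r \<Longrightarrow> \<beta> z = 0" "cball a r \<subseteq> D"
    and g: "open D'" "Cinf D' g" "cball a r \<subseteq> D'"
  shows "from_chart \<beta> g \<in> smooth_funs M"
proof (rule extend_in)
  show "compact (\<kappa> ` cball a r)"
    by (rule compact_continuous_image[OF continuous_on_subset[OF cont_\<kappa> \<beta>(3)] compact_cball])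
  show "\<kappa> ` cball a r \<subseteq> U" using \<beta>(3) \<kappa>_in by blast
  show "from_chart \<beta> g q = 0" if "q \<notin> \<kappa> ` cball a r" for q
  proof (cases "q \<in> U")
    case True
    then have "\<psi> q \<notin> cball a r" using that \<kappa>_\<psi> by (metis image_eqI)
    then show ?thesis using \<beta>(2) by (simp add: from_chart_def)
  qed (simp add: from_chart_def)
  have eq: "from_chart \<beta> g (\<kappa> z) = \<beta> (P z) * g (P z)" if "z \<in> D" for z
    using that \<kappa>_in \<psi>_\<kappa> by (simp add: from_chart_def P_def)
  have "Cinf D (\<lambda>z. \<beta> (P z) * g (P z))"
  proof (rule Cinf_local)
    fix z assume "z \<in> D"
    show "\<exists>V. open V \<and> z \<in> V \<and> Cinf V (\<lambda>z. \<beta> (P z) * g (P z))"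
    proof (cases "P z \<in> cball a r")
      case True
      have o: "open (P -` D')" using continuous_open_preimage[OF continuous_P open_UNIV g(1)] by simp
      have "Cinf (P -` D') (\<lambda>z. \<beta> (P z) * g (P z))"
        by (intro Cinf_mult o Cinf_compose[OF o open_UNIV _ \<beta>(1)] Cinf_compose[OF o g(1) _ g(2)]
            Cinf_linear linear_P) auto
      then show ?thesis using o True g(3) by blast
    next
      case False
      have o: "open (P -` (- cball a r))"
        using continuous_open_preimage[OF continuous_P[of UNIV] open_UNIV, of "- cball a r"] closed_cball open_Compl
        by auto
      have "Cinf (P -` (- cball a r)) (\<lambda>z. \<beta> (P z) * g (P z))"
        using Cinf_const[of _ "0::real"] \<beta>(2) by (subst Cinf_cong[OF o, of _ "\<lambda>_. 0"]) auto
      then show ?thesis using o False by blast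
    qed
  qed
  then show "Cinf D (\<lambda>z. from_chart \<beta> g (\<kappa> z))"
    by (subst Cinf_cong[OF D_open eq])
qed

text \<open>The bounds 0 and 1 are recorded for \<open>atlas_local_inverse\<close>, where they keep
  a denominator positive.\<close>

lemma chart_bump_in:
  assumes "p \<in> U" "open W" "p \<in> W"
  shows "\<exists>b\<in>smooth_funs M. \<exists>V. open V \<and> p \<in> V \<and>
        (\<forall>x\<in>V \<inter> points M. b x = 1) \<and> (\<forall>x\<in>points M - W. b x = 0) \<and> (\<forall>x. 0 \<le> b x \<and> b x \<le> 1)"
proof -
  obtain \<beta> :: "'a \<Rightarrow> real" and r where r: "r > 0" "Cinf UNIV \<beta>" "\<And>z. z \<in> ball (\<psi> p) (r/2) \<Longrightarrow> \<beta> z = 1"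
    "\<And>z. z \<notin> cball (\<psi> p) r \<Longrightarrow> \<beta> z = 0" "\<And>z. 0 \<le> \<beta> z" "\<And>z. \<beta> z \<le> 1"
    "cball (\<psi> p) r \<subseteq> D" "\<kappa> ` cball (\<psi> p) r \<subseteq> W"
    using chart_bump[OF assms open_UNIV] by (metis UNIV_I)
  obtain V where V: "open V" "V \<inter> points M = {q \<in> U. \<psi> q \<in> ball (\<psi> p) (r/2)}"
    using chart_nhd[OF open_ball] by blast
  let ?b = "from_chart \<beta> (\<lambda>_. 1)"
  have "?b \<in> smooth_funs M"
    by (rule from_chart_in[OF r(2,4,7) open_UNIV]) auto
  moreover have "p \<in> V" using V(2) assms(1) U_sub r(1) by (auto simp: set_eq_iff)
  moreover have "?b x = 1" if "x \<in> V \<inter> points M" for x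
    using that r(3) unfolding V(2) by (simp add: from_chart_def)
  moreover have "?b x = 0" if "x \<in> points M - W" for x
  proof (cases "x \<in> U")
    case True
    then have "\<psi> x \<notin> cball (\<psi> p) r" using that r(8) \<kappa>_\<psi> by (metis DiffD2 image_eqI subsetD)
    then show ?thesis using r(4) by (simp add: from_chart_def)
  qed (simp add: from_chart_def)
  moreover have "0 \<le> ?b x \<and> ?b x \<le> 1" for x using r(5,6) by (simp add: from_chart_def)
  ultimately show ?thesis using V(1) by blast
qed

end

lemma orthonormal_basis_inner:
  assumes "subspace (E :: 'a::euclidean_space set)"
  obtains B where "finite B" "B \<subseteq> E" "span B = E"
    "\<And>b c. b \<in> B \<Longrightarrow> c \<in> B \<Longrightarrow> b \<bullet> c = (if b = c then 1 else 0)"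
proof -
  obtain B where B: "B \<subseteq> E" "pairwise orthogonal B" "\<And>x. x \<in> B \<Longrightarrow> norm x = 1"
    "independent B" "span B = E" using orthonormal_basis_subspace[OF assms] by metis
  have "b \<bullet> c = (if b = c then 1 else 0)" if "b \<in> B" "c \<in> B" for b c
    using B(2,3) that by (auto simp: pairwise_def orthogonal_def norm_eq_1)
  then show ?thesis by (rule that[OF independent_imp_finite[OF B(4)] B(1,5)])
qed

section \<open>Atlases, their rings of smooth functions, and the charts they provide\<close>

locale smooth_atlas_space =
  fixes M :: "('m::t2_space, 'z) smooth_space_scheme" and E :: "'a::euclidean_space set" and A B
  assumes atlas: "smooth_atlas E (points M) A" and funs: "smooth_funs M = atlas_smooth_funs A"
    and B: "finite B" "span B = E" "\<And>b c. b \<in> B \<Longrightarrow> c \<in> B \<Longrightarrow> b \<bullet> c = (if b = c then 1 else 0)"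
begin

text \<open>Orthogonal projection onto \<open>E\<close>. Preimages under it turn relatively open
  subsets of \<open>E\<close> into open sets of the Euclidean space.\<close>

definition pr :: "'a \<Rightarrow> 'a" where "pr z = (\<Sum>b\<in>B. (z \<bullet> b) *\<^sub>R b)"

lemma linear_pr: "linear pr"
  unfolding pr_def by (intro linearI) (simp_all add: inner_left_distrib scaleR_left_distrib sum.distrib scaleR_sum_right)

lemma open_pr_vimage: "open S \<Longrightarrow> open (pr -` S)"
  using continuous_open_preimage[of UNIV pr S] linear_pr linear_continuous_on linear_conv_bounded_linear
  by (metis Int_UNIV_left open_UNIV)

lemma pr_in: "pr z \<in> E"
  unfolding pr_def B(2)[symmetric] by (intro span_sum span_scale span_base)

lemma pr_id: "z \<in> E \<Longrightarrow> pr z = z"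
proof -
  assume "z \<in> E"
  then obtain c where "z = (\<Sum>b\<in>B. c b *\<^sub>R b)" using B(1,2) span_finite by blast
  moreover from this have "z \<bullet> b = c b" if "b \<in> B" for b
    using that B(1,3) by (simp add: inner_sum_left if_distrib[of "\<lambda>x. _ * x"] sum.delta' cong: if_cong)
  ultimately show ?thesis by (simp add: pr_def)
qed

lemma open_pr_vimage_openin: "openin (top_of_set E) S \<Longrightarrow> open (pr -` S)"
proof -
  assume "openin (top_of_set E) S"
  then obtain T where "open T" "S = E \<inter> T" by (auto simp: openin_open)
  moreover from this have "pr -` S = pr -` T" using pr_in by auto
  ultimately show ?thesis using open_pr_vimage by simp
qed

text \<open>Extending \<open>f\<close> constantly in the directions orthogonal to \<open>E\<close>
  is one canonical extension; it replaces the local choices of extensions in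
  \<open>smooth_on\<close>.\<close>

lemma smooth_on_iff:
  assumes S: "openin (top_of_set E) S"
  shows "smooth_on S f \<longleftrightarrow> Cinf (pr -` S) (\<lambda>z. f (pr z))"
proof
  have o: "open (pr -` S)" by (rule open_pr_vimage_openin[OF S])
  have SE: "S \<subseteq> E" using S openin_imp_subset by blast
  show "Cinf (pr -` S) (\<lambda>z. f (pr z))" if s: "smooth_on S f"
  proof (rule Cinf_local)
    fix z assume z: "z \<in> pr -` S"
    then obtain U h where U: "open U" "pr z \<in> U" "\<forall>k. Ck_on k U h" "\<forall>y\<in>U \<inter> S. h y = f y"
      using s unfolding smooth_on_def by blast
    let ?V = "pr -` S \<inter> pr -` U"
    have V: "open ?V" using o open_pr_vimage[OF U(1)] by blast
    have "Cinf ?V (\<lambda>z. h (pr z))"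
      by (rule Cinf_compose[OF V U(1) _ _ Cinf_linear[OF V linear_pr]])
         (use U(3) in \<open>auto simp: Cinf_def\<close>)
    then have "Cinf ?V (\<lambda>z. f (pr z))"
      using U(4) by (subst Cinf_cong[OF V, of _ "\<lambda>z. h (pr z)"]) auto
    then show "\<exists>V. open V \<and> z \<in> V \<and> Cinf V (\<lambda>z. f (pr z))" using V z U(2) by blast
  qed
  show "smooth_on S f" if "Cinf (pr -` S) (\<lambda>z. f (pr z))"
    unfolding smooth_on_def
  proof
    fix x assume x: "x \<in> S"
    show "\<exists>U h. open U \<and> x \<in> U \<and> (\<forall>k. Ck_on k U h) \<and> (\<forall>y\<in>U \<inter> S. h y = f y)"
      using that o x SE pr_id
      by (intro exI[of _ "pr -` S"] exI[of _ "\<lambda>z. f (pr z)"]) (auto simp: Cinf_def subset_iff)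
  qed
qed

lemma
  assumes "(U, \<psi>) \<in> A"
  shows chart_sub: "U \<subseteq> points M"
    and chart_openin: "openin (top_of_set (points M)) U"
    and chart_image: "openin (top_of_set E) (\<psi> ` U)"
    and chart_homeo: "homeomorphism U (\<psi> ` U) \<psi> (inv_into U \<psi>)"
  using atlas assms unfolding smooth_atlas_def by blast+

lemma transition:
  assumes "(U, \<psi>) \<in> A" "(V, \<theta>) \<in> A"
  shows "openin (top_of_set E) (\<psi> ` (U \<inter> V))"
    "Cinf (pr -` (\<psi> ` (U \<inter> V))) (\<lambda>z. \<theta> (inv_into U \<psi> (pr z)))"
proof -
  obtain T where T: "open T" "V = points M \<inter> T"
    using chart_openin[OF assms(2)] by (auto simp: openin_open)
  then have "U \<inter> V = U \<inter> T" using chart_sub[OF assms(1)] by blast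
  then have "openin (top_of_set U) (U \<inter> V)" using T(1) by auto
  then have "openin (top_of_set (\<psi> ` U)) (\<psi> ` (U \<inter> V))"
    using homeomorphism_imp_open_map[OF chart_homeo[OF assms(1)]] by blast
  then show o: "openin (top_of_set E) (\<psi> ` (U \<inter> V))"
    using chart_image[OF assms(1)] openin_trans by blast
  have "smooth_on (\<psi> ` (U \<inter> V)) (\<theta> \<circ> inv_into U \<psi>)"
    using atlas assms unfolding smooth_atlas_def by blast
  then show "Cinf (pr -` (\<psi> ` (U \<inter> V))) (\<lambda>z. \<theta> (inv_into U \<psi> (pr z)))"
    using smooth_on_iff[OF o, of "\<theta> \<circ> inv_into U \<psi>"] by (simp only: comp_apply)
qed

lemma smooth_funs_iff:
  "f \<in> smooth_funs M \<longleftrightarrow> (\<forall>(U, \<psi>)\<in>A. Cinf (pr -` (\<psi> ` U)) (\<lambda>z. f (inv_into U \<psi> (pr z))))"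
proof -
  have "smooth_on (\<psi> ` U) (f \<circ> inv_into U \<psi>) \<longleftrightarrow> Cinf (pr -` (\<psi> ` U)) (\<lambda>z. f (inv_into U \<psi> (pr z)))"
    if "(U, \<psi>) \<in> A" for U \<psi>
    using smooth_on_iff[OF chart_image[OF that], of "f \<circ> inv_into U \<psi>"] by simp
  then show ?thesis
    unfolding funs atlas_smooth_funs_def mem_Collect_eq by (intro ball_cong) auto
qed

lemma open_chart_domain: "(U, \<psi>) \<in> A \<Longrightarrow> open (pr -` (\<psi> ` U))"
  by (rule open_pr_vimage_openin[OF chart_image])

lemma chart_inv:
  assumes "(U, \<psi>) \<in> A"
  shows "q \<in> U \<Longrightarrow> inv_into U \<psi> (\<psi> q) = q" "z \<in> pr -` (\<psi> ` U) \<Longrightarrow> inv_into U \<psi> (pr z) \<in> U"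
    "z \<in> pr -` (\<psi> ` U) \<Longrightarrow> \<psi> (inv_into U \<psi> (pr z)) = pr z" "q \<in> U \<Longrightarrow> pr (\<psi> q) = \<psi> q"
proof -
  show "q \<in> U \<Longrightarrow> inv_into U \<psi> (\<psi> q) = q"
    using chart_homeo[OF assms] by (simp add: homeomorphism_def)
  show "z \<in> pr -` (\<psi> ` U) \<Longrightarrow> inv_into U \<psi> (pr z) \<in> U"
    by (auto intro: inv_into_into)
  show "z \<in> pr -` (\<psi> ` U) \<Longrightarrow> \<psi> (inv_into U \<psi> (pr z)) = pr z"
    by (auto intro: f_inv_into_f)
  show "q \<in> U \<Longrightarrow> pr (\<psi> q) = \<psi> q"
    using chart_image[OF assms] openin_imp_subset by (intro pr_id) blast
qed

lemma continuous_chart_inv: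
  assumes "(U, \<psi>) \<in> A"
  shows "continuous_on (pr -` (\<psi> ` U)) (\<lambda>z. inv_into U \<psi> (pr z))"
proof (rule continuous_on_compose2[of "\<psi> ` U"])
  show "continuous_on (\<psi> ` U) (inv_into U \<psi>)"
    using chart_homeo[OF assms] by (simp add: homeomorphism_def)
  show "continuous_on (pr -` \<psi> ` U) pr"
    using linear_pr linear_continuous_on linear_conv_bounded_linear by blast
qed auto

lemma atlas_const_in: "(\<lambda>_. c) \<in> smooth_funs M"
  unfolding smooth_funs_iff by auto

lemma atlas_add_in: "f \<in> smooth_funs M \<Longrightarrow> h \<in> smooth_funs M \<Longrightarrow> (\<lambda>x. f x + h x) \<in> smooth_funs M"
  unfolding smooth_funs_iff using Cinf_add[OF open_chart_domain] by fastforce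

lemma atlas_mult_in: "f \<in> smooth_funs M \<Longrightarrow> h \<in> smooth_funs M \<Longrightarrow> (\<lambda>x. f x * h x) \<in> smooth_funs M"
  unfolding smooth_funs_iff using Cinf_mult[OF open_chart_domain] by fastforce

lemma atlas_inverse_in:
  assumes f: "f \<in> smooth_funs M" and nz: "\<And>p. p \<in> points M \<Longrightarrow> f p \<noteq> 0"
  shows "(\<lambda>x. inverse (f x)) \<in> smooth_funs M"
  unfolding smooth_funs_iff
proof clarify
  fix U \<psi> assume A: "(U, \<psi>) \<in> A"
  show "Cinf (pr -` (\<psi> ` U)) (\<lambda>z. inverse (f (inv_into U \<psi> (pr z))))"
  proof (rule Cinf_inverse[OF open_chart_domain[OF A]])
    show "Cinf (pr -` \<psi> ` U) (\<lambda>z. f (inv_into U \<psi> (pr z)))" using f A unfolding smooth_funs_iff by blast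
    show "f (inv_into U \<psi> (pr z)) \<noteq> 0" if "z \<in> pr -` \<psi> ` U" for z
      using nz chart_inv(2)[OF A that] chart_sub[OF A] by blast
  qed
qed

lemma atlas_local_in:
  assumes "\<And>p. p \<in> points M \<Longrightarrow>
        \<exists>U h. open U \<and> p \<in> U \<and> h \<in> smooth_funs M \<and> (\<forall>x\<in>U \<inter> points M. f x = h x)"
  shows "f \<in> smooth_funs M"
  unfolding smooth_funs_iff
proof clarify
  fix U \<psi> assume A: "(U, \<psi>) \<in> A"
  let ?D = "pr -` (\<psi> ` U)" and ?k = "\<lambda>z. inv_into U \<psi> (pr z)"
  show "Cinf ?D (\<lambda>z. f (?k z))"
  proof (rule Cinf_local)
    fix z assume z: "z \<in> ?D"
    have kp: "?k z \<in> points M" if "z \<in> ?D" for z using chart_inv(2)[OF A that] chart_sub[OF A] by blast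
    obtain W h where W: "open W" "?k z \<in> W" "h \<in> smooth_funs M" "\<forall>x\<in>W \<inter> points M. f x = h x"
      using assms[OF kp[OF z]] by metis
    let ?V = "?D \<inter> ?k -` W"
    have V: "open ?V"
      by (rule continuous_open_preimage[OF continuous_chart_inv[OF A] open_chart_domain[OF A] W(1)])
    have "Cinf ?D (\<lambda>z. h (?k z))" using W(3) A unfolding smooth_funs_iff by blast
    then have "Cinf ?V (\<lambda>z. h (?k z))" by (rule Cinf_mono) auto
    then have "Cinf ?V (\<lambda>z. f (?k z))"
      using W(4) kp by (subst Cinf_cong[OF V, of _ "\<lambda>z. h (?k z)"]) auto
    then show "\<exists>V. open V \<and> z \<in> V \<and> Cinf V (\<lambda>z. f (?k z))" using V z W(2) by blast
  qed
qed

lemma atlas_chart: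
  assumes A: "(U, \<psi>) \<in> A"
  shows "manifold_chart M B U \<psi> (pr -` (\<psi> ` U)) (\<lambda>z. inv_into U \<psi> (pr z))"
proof
  let ?D = "pr -` (\<psi> ` U)" and ?k = "\<lambda>z. inv_into U \<psi> (pr z)"
  show "continuous_on U \<psi>" using chart_homeo[OF A] by (simp add: homeomorphism_def)
  show "\<psi> (?k z) = (\<Sum>b\<in>B. (z \<bullet> b) *\<^sub>R b)" if "z \<in> ?D" for z
    using chart_inv(3)[OF A that] by (simp add: pr_def)
  show "?k (\<psi> q) = q" if "q \<in> U" for q
    using chart_inv(1,4)[OF A that] by simp
  show "\<psi> q \<in> ?D" if "q \<in> U" for q using chart_inv(4)[OF A that] that by simp
  show "Cinf ?D (\<lambda>z. f (?k z))" if "f \<in> smooth_funs M" for f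
    using that A unfolding smooth_funs_iff by blast
  fix K and f :: "'m \<Rightarrow> real"
  assume K: "compact K" "K \<subseteq> U" and f: "\<And>q. q \<notin> K \<Longrightarrow> f q = 0" "Cinf ?D (\<lambda>z. f (?k z))"
  show "f \<in> smooth_funs M"
    unfolding smooth_funs_iff
  proof clarify
    fix V \<theta> assume A': "(V, \<theta>) \<in> A"
    let ?D' = "pr -` (\<theta> ` V)" and ?k' = "\<lambda>z. inv_into V \<theta> (pr z)"
    show "Cinf ?D' (\<lambda>z. f (?k' z))"
    proof (rule Cinf_local)
      fix z assume z: "z \<in> ?D'"
      show "\<exists>V. open V \<and> z \<in> V \<and> Cinf V (\<lambda>z. f (?k' z))"
      proof (cases "?k' z \<in> U")
        case True
        let ?W = "pr -` (\<theta> ` (V \<inter> U))"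
        note t = transition[OF A' A]
        have W: "open ?W" by (rule open_pr_vimage_openin[OF t(1)])
        have kW: "?k' y \<in> U" if "y \<in> ?W" for y
          using that chart_inv(1)[OF A'] by auto
        \<comment> \<open>On the overlap the other chart sees \<open>f\<close> through the
          transition map, so the assumption in the given chart suffices.\<close>
        have "Cinf ?W (\<lambda>y. f (?k (\<psi> (?k' y))))"
        proof (rule Cinf_compose[OF W open_chart_domain[OF A] _ f(2) t(2)])
          show "(\<lambda>y. \<psi> (?k' y)) ` ?W \<subseteq> ?D"
            using kW chart_inv(4)[OF A] by auto
        qed
        then have "Cinf ?W (\<lambda>y. f (?k' y))"
          using kW chart_inv(1,4)[OF A] by (subst (asm) Cinf_cong[OF W, of _ "\<lambda>y. f (?k' y)"]) auto
        moreover have "z \<in> ?W"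
          using z True chart_inv(2,3)[OF A' z] by (metis IntI image_eqI vimageI)
        ultimately show ?thesis using W by blast
      next
        case False
        \<comment> \<open>The Hausdorff property enters here: the compact set \<open>K\<close> is
          closed, so a point outside \<open>U\<close> has a neighbourhood on which \<open>f\<close>
          is 0.\<close>
        have "open (- K)" using K(1) compact_imp_closed by blast
        then have W: "open (?D' \<inter> ?k' -` (- K))"
          by (rule continuous_open_preimage[OF continuous_chart_inv[OF A'] open_chart_domain[OF A']])
        have "Cinf (?D' \<inter> ?k' -` (- K)) (\<lambda>z. f (?k' z))"
          using f(1) by (subst Cinf_cong[OF W, of _ "\<lambda>_. 0"]) auto
        then show ?thesis using W z False K(2) by blast
      qed
    qed
  qed
qed (simp_all only: B chart_sub[OF A] chart_openin[OF A] open_chart_domain[OF A]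
    continuous_chart_inv[OF A] chart_inv(2)[OF A])

lemma atlas_cover: "p \<in> points M \<Longrightarrow> \<exists>U \<psi>. (U, \<psi>) \<in> A \<and> p \<in> U"
  using atlas unfolding smooth_atlas_def by blast

lemma atlas_bump:
  assumes "open W" "p \<in> W" "p \<in> points M"
  shows "\<exists>b\<in>smooth_funs M. \<exists>V. open V \<and> p \<in> V \<and>
        (\<forall>x\<in>V \<inter> points M. b x = 1) \<and> (\<forall>x\<in>points M - W. b x = 0) \<and> (\<forall>x. 0 \<le> b x \<and> b x \<le> 1)"
proof -
  obtain U \<psi> where A: "(U, \<psi>) \<in> A" "p \<in> U" using atlas_cover[OF assms(3)] by blast
  show ?thesis by (rule manifold_chart.chart_bump_in[OF atlas_chart[OF A(1)] A(2) assms(1,2)])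
qed

lemma smooth_ring: "smooth_ring M"
proof
  fix W p assume "open W" "p \<in> W" "p \<in> points M"
  from atlas_bump[OF this] show "\<exists>b\<in>smooth_funs M. \<exists>V. open V \<and> p \<in> V \<and>
        (\<forall>x\<in>V \<inter> points M. b x = 1) \<and> (\<forall>x\<in>points M - W. b x = 0)" by metis
qed (fact atlas_const_in atlas_add_in atlas_mult_in atlas_local_in)+

lemma atlas_local_inverse:
  assumes f: "f \<in> smooth_funs M" and p: "p \<in> points M" and W: "open W" "p \<in> W"
    and nz: "\<And>q. q \<in> W \<Longrightarrow> q \<in> points M \<Longrightarrow> f q \<noteq> 0"
  obtains h V where "h \<in> smooth_funs M" "open V" "p \<in> V" "\<And>q. q \<in> V \<Longrightarrow> q \<in> points M \<Longrightarrow> h q * f q = 1"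
    "\<And>q. q \<in> V \<Longrightarrow> q \<in> points M \<Longrightarrow> q \<in> W"
proof -
  interpret smooth_ring M by (rule smooth_ring)
  obtain b V where b: "b \<in> smooth_funs M" "open V" "p \<in> V" "\<forall>x\<in>V \<inter> points M. b x = 1"
    "\<forall>x\<in>points M - W. b x = 0" "\<forall>x. 0 \<le> b x \<and> b x \<le> 1" using atlas_bump[OF W p] by metis
  \<comment> \<open>A denominator without zeros: inside \<open>W\<close> the square is positive and
    \<open>1 - b x\<close> is nonnegative; outside \<open>W\<close>, where \<open>f\<close> may
    vanish, \<open>b\<close> is 0 and the sum is at least 1. Near \<open>p\<close>, where
    \<open>b\<close> is 1, the quotient of \<open>f\<close> by \<open>?d\<close> is the inverse of
    \<open>f\<close>.\<close>
  let ?d = "\<lambda>x. f x * f x + (1 - b x)"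
  have d: "?d \<in> smooth_funs M" by (intro add_in mult_in diff_in const_in f b)
  have nz': "?d x \<noteq> 0" if "x \<in> points M" for x
  proof (cases "x \<in> W")
    case True
    then have "f x * f x > 0" using not_square_less_zero[of "f x"] nz[OF True that]
      by (simp add: order.strict_iff_order)
    then show ?thesis using b(6)[rule_format, of x] by linarith
  next
    case False
    then have "b x = 0" using b(5) that by blast
    then show ?thesis using zero_le_square[of "f x"] by linarith
  qed
  show ?thesis
  proof (rule that[of "\<lambda>x. f x * inverse (?d x)" V])
    show "(\<lambda>x. f x * inverse (?d x)) \<in> smooth_funs M"
      by (intro mult_in f atlas_inverse_in[OF d nz'])
    show W': "q \<in> W" if "q \<in> V" "q \<in> points M" for q
    proof (rule ccontr)
      assume "q \<notin> W"
      then show False using b(4)[rule_format, of q] b(5)[rule_format, of q] that by simp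
    qed
    show "f q * inverse (?d q) * f q = 1" if "q \<in> V" "q \<in> points M" for q
      using b(4) that nz[OF W'[OF that] that(2)] by (simp add: field_simps)
  qed (use b in auto)
qed

end

lemma smooth_manifold_atlas:
  assumes "smooth_manifold E M"
  obtains A B where "smooth_atlas_space M E A B"
proof -
  have E: "subspace E" using assms by (simp add: smooth_manifold_def)
  obtain A where A: "smooth_atlas E (points M) A" "smooth_funs M = atlas_smooth_funs A"
    using assms by (auto simp: smooth_manifold_def)
  obtain B where "finite B" "B \<subseteq> E" "span B = E"
    "\<And>b c. b \<in> B \<Longrightarrow> c \<in> B \<Longrightarrow> b \<bullet> c = (if b = c then 1 else 0)"
    using orthonormal_basis_inner[OF E] by metis
  then have "smooth_atlas_space M E A B" using A by (intro smooth_atlas_space.intro)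
  then show ?thesis by (rule that)
qed

lemma smooth_manifold_smooth_ring:
  assumes "smooth_manifold E M"
  shows "smooth_ring M"
proof -
  obtain A B where "smooth_atlas_space M E A B" by (rule smooth_manifold_atlas[OF assms])
  then show ?thesis by (rule smooth_atlas_space.smooth_ring)
qed

lemma smooth_manifold_chart:
  fixes E :: "'a::euclidean_space set"
  assumes "smooth_manifold E M" "p \<in> points M"
  obtains B :: "'a set" and U \<psi> D \<kappa> where "manifold_chart M B U \<psi> D \<kappa>" "p \<in> U"
proof -
  obtain A and B :: "'a set" where "smooth_atlas_space M E A B" by (rule smooth_manifold_atlas[OF assms(1)])
  then interpret smooth_atlas_space M E A B .
  obtain U \<psi> where A: "(U, \<psi>) \<in> A" "p \<in> U" using atlas_cover[OF assms(2)] by blast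
  show ?thesis by (rule that[OF atlas_chart[OF A(1)] A(2)])
qed

section \<open>Coordinate vectors and dual frames in a chart\<close>

locale ring_chart = smooth_ring M + manifold_chart M B U \<psi> D \<kappa>
  for M :: "('m::t2_space, 'z) smooth_space_scheme"
    and B :: "'a::euclidean_space set" and U \<psi> D \<kappa>
begin

definition chart_vec :: "'m \<Rightarrow> 'a \<Rightarrow> 'm tvec" where
  "chart_vec q b f = (if f \<in> smooth_funs M then frechet_derivative (\<lambda>z. f (\<kappa> z)) (at (\<psi> q)) b else 0)"

lemma chart_has_derivative:
  "f \<in> smooth_funs M \<Longrightarrow> q \<in> U \<Longrightarrow>
    ((\<lambda>z. f (\<kappa> z)) has_derivative frechet_derivative (\<lambda>z. f (\<kappa> z)) (at (\<psi> q))) (at (\<psi> q))"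
  using Cinf_has_derivative[OF smooth_\<kappa> \<psi>_in] .

lemma chart_vec_eq:
  "f \<in> smooth_funs M \<Longrightarrow> ((\<lambda>z. f (\<kappa> z)) has_derivative f') (at (\<psi> q)) \<Longrightarrow> chart_vec q b f = f' b"
  by (simp add: chart_vec_def frechet_derivative_at[symmetric])

lemma chart_vec_tangent:
  assumes q: "q \<in> U"
  shows "chart_vec q b \<in> tangent M q"
proof (rule tangentI)
  fix f h assume f: "f \<in> smooth_funs M" and h: "h \<in> smooth_funs M"
  note d = chart_has_derivative[OF f q] chart_has_derivative[OF h q]
  show "chart_vec q b (\<lambda>x. f x + h x) = chart_vec q b f + chart_vec q b h"
    using chart_vec_eq[OF add_in[OF f h] has_derivative_add[OF d]] f h by (simp add: chart_vec_def)
  show "chart_vec q b (\<lambda>x. f x * h x) = f q * chart_vec q b h + h q * chart_vec q b f"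
    using chart_vec_eq[OF mult_in[OF f h] has_derivative_mult[OF d]] f h \<kappa>_\<psi>[OF q]
    by (simp add: chart_vec_def)
next
  fix f c assume f: "f \<in> smooth_funs M"
  show "chart_vec q b (\<lambda>x. c * f x) = c * chart_vec q b f"
    using chart_vec_eq[OF cmult_in[OF f] has_derivative_mult_right[OF chart_has_derivative[OF f q]]] f
    by (simp add: chart_vec_def)
qed (simp add: chart_vec_def)

text \<open>Hadamard's lemma in the chart shows that a derivation is determined by its values on the
  coordinate functions.\<close>

lemma tangent_coordinates:
  assumes q: "q \<in> U" and V: "open V" "q \<in> V"
    and x: "\<And>b. b \<in> B \<Longrightarrow> x b \<in> smooth_funs M" "\<And>b y. b \<in> B \<Longrightarrow> y \<in> V \<Longrightarrow> y \<in> U \<Longrightarrow> x b y = \<psi> y \<bullet> b"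
    and u: "u \<in> tangent M q" and f: "f \<in> smooth_funs M"
  shows "u f = (\<Sum>b\<in>B. u (x b) * chart_vec q b f)"
proof -
  have qp: "q \<in> points M" using q U_sub by blast
  obtain s where s: "s > 0" "ball (\<psi> q) s \<subseteq> D"
    using D_open \<psi>_in[OF q] open_contains_ball by blast
  obtain g where "\<forall>b. Cinf (ball (\<psi> q) s) (g b)"
    and "\<forall>b. g b (\<psi> q) = frechet_derivative (\<lambda>z. f (\<kappa> z)) (at (\<psi> q)) b"
    and "\<forall>z C c. finite C \<longrightarrow> z \<in> ball (\<psi> q) s \<longrightarrow> z - \<psi> q = (\<Sum>b\<in>C. c b *\<^sub>R b) \<longrightarrow>
        f (\<kappa> z) = f (\<kappa> (\<psi> q)) + (\<Sum>b\<in>C. c b * g b z)"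
    by (rule Hadamard[OF Cinf_mono[OF smooth_\<kappa>[OF f] s(2)]])
  then have g: "\<And>b. Cinf (ball (\<psi> q) s) (g b)"
    "\<And>b. g b (\<psi> q) = frechet_derivative (\<lambda>z. f (\<kappa> z)) (at (\<psi> q)) b"
    "\<And>z C c. finite C \<Longrightarrow> z \<in> ball (\<psi> q) s \<Longrightarrow> z - \<psi> q = (\<Sum>b\<in>C. c b *\<^sub>R b) \<Longrightarrow>
        f (\<kappa> z) = f (\<kappa> (\<psi> q)) + (\<Sum>b\<in>C. c b * g b z)"
    by simp_all
  obtain \<beta> :: "'a \<Rightarrow> real" and r where r: "r > 0" "Cinf UNIV \<beta>" "\<And>z. z \<in> ball (\<psi> q) (r/2) \<Longrightarrow> \<beta> z = 1"
    "\<And>z. z \<notin> cball (\<psi> q) r \<Longrightarrow> \<beta> z = 0"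
    "cball (\<psi> q) r \<subseteq> D" "cball (\<psi> q) r \<subseteq> ball (\<psi> q) s"
    using chart_bump[OF q open_UNIV _ open_ball, of "\<psi> q" s] s(1) by (metis UNIV_I centre_in_ball)
  let ?G = "\<lambda>b. from_chart \<beta> (g b)"
  have G: "?G b \<in> smooth_funs M" for b
    by (rule from_chart_in[OF r(2,4,5) open_ball g(1) r(6)])
  have Gq: "?G b q = chart_vec q b f" for b
    using r(3)[of "\<psi> q"] r(1) g(2) q f by (simp add: from_chart_def chart_vec_def)
  obtain V' where V': "open V'" "V' \<inter> points M = {y \<in> U. \<psi> y \<in> ball (\<psi> q) (r/2)}"
    using chart_nhd[OF open_ball] by blast
  \<comment> \<open>The Hadamard expansion around \<open>q\<close>, with its coefficients cut off so
    that they are global smooth functions to which \<open>u\<close> can be applied.\<close>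
  let ?h = "\<lambda>y. f q + (\<Sum>b\<in>B. (x b y - x b q) * ?G b y)"
  have xq: "(\<lambda>y. x b y - x b q) \<in> smooth_funs M" if "b \<in> B" for b
    using x(1)[OF that] by (intro diff_in const_in)
  have hs: "(\<lambda>y. (x b y - x b q) * ?G b y) \<in> smooth_funs M" if "b \<in> B" for b
    using xq[OF that] G by (rule mult_in)
  have "u f = u ?h"
  proof (rule tangent_cong_local[OF u qp open_Int[OF V(1) V'(1)] _ f])
    have "q \<in> V' \<inter> points M" unfolding V'(2) using q r(1) by simp
    then show "q \<in> V \<inter> V'" using V by simp
    show "?h \<in> smooth_funs M" by (rule add_in[OF const_in sum_in[OF hs]])
    fix y assume y: "y \<in> V \<inter> V'" "y \<in> points M"
    then have yU: "y \<in> U" and yb: "\<psi> y \<in> ball (\<psi> q) (r/2)" using V'(2) by blast+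
    have "\<psi> y - \<psi> q = P (\<psi> y - \<psi> q)"
      using linear_diff[OF linear_P] P_\<psi>[OF yU] P_\<psi>[OF q] by simp
    then have e: "\<psi> y - \<psi> q = (\<Sum>b\<in>B. ((\<psi> y - \<psi> q) \<bullet> b) *\<^sub>R b)" by (simp add: P_def)
    have "\<psi> y \<in> ball (\<psi> q) r" using yb r(1) by simp
    then have ys: "\<psi> y \<in> ball (\<psi> q) s" using r(6) ball_subset_cball by blast
    have "f y = f q + (\<Sum>b\<in>B. ((\<psi> y - \<psi> q) \<bullet> b) * g b (\<psi> y))"
      using g(3)[OF finite_B ys e] \<kappa>_\<psi>[OF yU] \<kappa>_\<psi>[OF q] by simp
    also have "(\<Sum>b\<in>B. ((\<psi> y - \<psi> q) \<bullet> b) * g b (\<psi> y)) = (\<Sum>b\<in>B. (x b y - x b q) * ?G b y)"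
      using r(3)[OF yb] yU x(2) V(2) y q by (intro sum.cong) (auto simp: from_chart_def inner_diff_left)
    finally show "f y = ?h y" .
  qed
  also have "\<dots> = u (\<lambda>_. f q) + u (\<lambda>y. \<Sum>b\<in>B. (x b y - x b q) * ?G b y)"
    by (rule tangent_add_fun[OF u const_in sum_in[OF hs]])
  also have "\<dots> = (\<Sum>b\<in>B. u (\<lambda>y. (x b y - x b q) * ?G b y))"
    using tangent_const[OF u] tangent_sum_fun[OF u hs] by simp
  also have "\<dots> = (\<Sum>b\<in>B. u (x b) * chart_vec q b f)"
  proof (rule sum.cong)
    \<comment> \<open>The first factor vanishes at \<open>q\<close>, so the Leibniz rule retains
      only the value of the second factor there, which is the coordinate derivative of
      \<open>f\<close>.\<close>
    fix b assume b: "b \<in> B"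
    show "u (\<lambda>y. (x b y - x b q) * ?G b y) = u (x b) * chart_vec q b f"
      using tangent_mult_fun[OF u xq[OF b] G[of b]] tangent_diff_fun[OF u x(1)[OF b] const_in]
      by (simp add: tangent_const[OF u] Gq)
  qed simp
  finally show ?thesis .
qed

text \<open>Coordinate functions and coordinate vectors are cut off by the same bump function to
  become global objects; on \<open>V\<close>, where the bump is 1, they are the genuine ones and
  dual to each other.\<close>

lemma chart_frame_indexed:
  assumes p: "p \<in> U"
  obtains x e V where "\<forall>b\<in>B. x b \<in> smooth_funs M" "\<forall>b\<in>B. e b \<in> vfields M"
    "open V" "p \<in> V" "V \<inter> points M \<subseteq> U"
    "\<forall>q\<in>V \<inter> points M. \<forall>b\<in>B. e b q = chart_vec q b"
    "\<forall>q\<in>V \<inter> points M. \<forall>b\<in>B. x b q = \<psi> q \<bullet> b"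
    "\<forall>q\<in>V \<inter> points M. \<forall>b\<in>B. \<forall>c\<in>B. e b q (x c) = (if b = c then 1 else 0)"
proof -
  have pp: "p \<in> points M" using p U_sub by blast
  obtain \<beta> :: "'a \<Rightarrow> real" and r where r: "r > 0" "Cinf UNIV \<beta>" "\<And>z. z \<in> ball (\<psi> p) (r/2) \<Longrightarrow> \<beta> z = 1"
    "\<And>z. z \<notin> cball (\<psi> p) r \<Longrightarrow> \<beta> z = 0" "cball (\<psi> p) r \<subseteq> D"
    using chart_bump[OF p open_UNIV _ open_UNIV] by (metis UNIV_I)
  obtain V where V: "open V" "V \<inter> points M = {y \<in> U. \<psi> y \<in> ball (\<psi> p) (r/2)}"
    using chart_nhd[OF open_ball] by blast
  define x where "x = (\<lambda>b. from_chart \<beta> (\<lambda>z. z \<bullet> b))"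
  define e where "e = (\<lambda>b q. if q \<in> U then tscale (\<beta> (\<psi> q)) (chart_vec q b) else 0)"
  have x: "x b \<in> smooth_funs M" for b
    unfolding x_def by (rule from_chart_in[OF r(2,4,5) open_UNIV]) (auto intro!: Cinf_inner)
  have "e b \<in> vfields M" for b
  proof (rule vfieldsI)
    show "e b q \<in> tangent M q" for q
      by (auto simp: e_def intro: tangent_tscale chart_vec_tangent)
    show "e b q = 0" if "q \<notin> points M" for q using that U_sub by (auto simp: e_def)
    fix f assume f: "f \<in> smooth_funs M"
    have "(\<lambda>q. e b q f) = from_chart \<beta> (\<lambda>z. frechet_derivative (\<lambda>z. f (\<kappa> z)) (at z) b)"
      using f by (auto simp: e_def from_chart_def chart_vec_def)
    then show "(\<lambda>q. e b q f) \<in> smooth_funs M"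
      using from_chart_in[OF r(2,4,5) D_open Cinf_frechet_derivative[OF smooth_\<kappa>[OF f]] r(5)] by simp
  qed
  moreover have V_sub: "V \<inter> points M \<subseteq> U" using V(2) by auto
  moreover have "p \<in> V"
  proof -
    have "p \<in> V \<inter> points M" unfolding V(2) using p r(1) by simp
    then show ?thesis by simp
  qed
  moreover have ec: "e b q = chart_vec q b" and xc: "x b q = \<psi> q \<bullet> b" if "q \<in> V" "q \<in> points M" for b q
  proof -
    have "q \<in> U" "\<psi> q \<in> ball (\<psi> p) (r/2)" using that V(2) by blast+
    then show "e b q = chart_vec q b" "x b q = \<psi> q \<bullet> b"
      using r(3) by (simp_all add: e_def x_def from_chart_def)
  qed
  moreover have "e b q (x c) = (if b = c then 1 else 0)"
    if q: "q \<in> V" "q \<in> points M" and b: "b \<in> B" "c \<in> B" for q b c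
  proof -
    have qU: "q \<in> U" and qb: "\<psi> q \<in> ball (\<psi> p) (r/2)" using q V(2) by blast+
    \<comment> \<open>On this neighbourhood the cut-off is 1 after projection, so the coordinate
      function pulled back by \<kappa> is the linear function \<open>z \<bullet> c\<close>.\<close>
    let ?S = "D \<inter> P -` ball (\<psi> p) (r/2)"
    have S: "open ?S" using continuous_open_preimage[OF continuous_P D_open open_ball] .
    have "((\<lambda>z. z \<bullet> c) has_derivative (\<lambda>v. v \<bullet> c)) (at (\<psi> q))"
      by (auto intro!: derivative_eq_intros)
    then have "((\<lambda>z. x c (\<kappa> z)) has_derivative (\<lambda>v. v \<bullet> c)) (at (\<psi> q))"
    proof (subst has_derivative_cong_open[OF S, of "\<psi> q" _ "\<lambda>z. z \<bullet> c"])
      show "\<psi> q \<in> ?S" using qb P_\<psi>[OF qU] \<psi>_in[OF qU] by simp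
      show "x c (\<kappa> z) = z \<bullet> c" if "z \<in> ?S" for z
      proof -
        have "\<kappa> z \<in> U" "\<psi> (\<kappa> z) = P z" using that \<kappa>_in \<psi>_\<kappa> by (auto simp: P_def)
        moreover have "\<beta> (P z) = 1" using that r(3) by blast
        ultimately show ?thesis using P_inner[OF b(2)] by (simp add: x_def from_chart_def)
      qed
    qed
    from chart_vec_eq[OF x this] show ?thesis using ec[OF q] ortho[OF b] by simp
  qed
  ultimately show ?thesis by (intro that[of x e V]) (use x V(1) in auto)
qed

text \<open>Every tangent vector is differentiation along a direction of the model space; this
  allows \<open>vertical_vanish\<close> to realise it as the velocity of a curve.\<close>

lemma tangent_in_chart:
  assumes p: "p \<in> U" and u: "u \<in> tangent M p"
  obtains w where "w \<in> span B" "u = chart_vec p w"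
proof -
  obtain x e V where x: "\<forall>b\<in>B. x b \<in> smooth_funs M" and "\<forall>b\<in>B. e b \<in> vfields M"
    and V: "open V" "p \<in> V" and "V \<inter> points M \<subseteq> U"
    and "\<forall>q\<in>V \<inter> points M. \<forall>b\<in>B. e b q = chart_vec q b"
    and xc: "\<forall>q\<in>V \<inter> points M. \<forall>b\<in>B. x b q = \<psi> q \<bullet> b"
    and "\<forall>q\<in>V \<inter> points M. \<forall>b\<in>B. \<forall>c\<in>B. e b q (x c) = (if b = c then 1 else 0)"
    by (rule chart_frame_indexed[OF p])
  define w where "w = (\<Sum>b\<in>B. u (x b) *\<^sub>R b)"
  have "u f = chart_vec p w f" for f
  proof (cases "f \<in> smooth_funs M")
    case True
    have l: "linear (frechet_derivative (\<lambda>z. f (\<kappa> z)) (at (\<psi> p)))"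
      using chart_has_derivative[OF True p] has_derivative_linear by blast
    have "u f = (\<Sum>b\<in>B. u (x b) * chart_vec p b f)"
      by (rule tangent_coordinates[OF p V _ _ u True]) (use x xc U_sub in auto)
    also have "\<dots> = chart_vec p w f"
      using True by (simp add: chart_vec_def w_def linear_sum[OF l] linear_cmul[OF l])
    finally show ?thesis .
  qed (simp add: tangent_outside[OF u] chart_vec_def)
  moreover have "w \<in> span B" unfolding w_def by (intro span_sum span_scale span_base)
  ultimately show ?thesis using that[of w] by blast
qed

text \<open>The frame is indexed by the coordinate functions themselves, so that the Euclidean space
  of the chart disappears from the statement. Distinct basis vectors give distinct functions because
  of the dual values 1 and 0. The last clause, that coordinates separate points, is what later
  recognises points of one fibre.\<close>

lemma chart_frame:
  assumes p: "p \<in> U"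
  obtains X e V where "finite X" "X \<subseteq> smooth_funs M" "\<forall>x\<in>X. e x \<in> vfields M" "open V" "p \<in> V"
    "\<forall>q\<in>V \<inter> points M. \<forall>u\<in>tangent M q. u = (\<Sum>x\<in>X. tscale (u x) (e x q))"
    "\<forall>q\<in>V \<inter> points M. \<forall>x\<in>X. \<forall>y\<in>X. e x q y = (if x = y then 1 else 0)"
    "\<forall>q\<in>V \<inter> points M. \<forall>q'\<in>V \<inter> points M. (\<forall>x\<in>X. x q = x q') \<longrightarrow> q = q'"
proof -
  have pp: "p \<in> points M" using p U_sub by blast
  obtain x e V where x: "\<forall>b\<in>B. x b \<in> smooth_funs M" and e: "\<forall>b\<in>B. e b \<in> vfields M"
    and V: "open V" "p \<in> V" "V \<inter> points M \<subseteq> U"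
    and ec: "\<forall>q\<in>V \<inter> points M. \<forall>b\<in>B. e b q = chart_vec q b"
    and xc: "\<forall>q\<in>V \<inter> points M. \<forall>b\<in>B. x b q = \<psi> q \<bullet> b"
    and exd: "\<forall>q\<in>V \<inter> points M. \<forall>b\<in>B. \<forall>c\<in>B. e b q (x c) = (if b = c then 1 else 0)"
    by (rule chart_frame_indexed[OF p])
  have inj: "inj_on x B"
  proof (rule inj_onI, rule ccontr)
    fix b c assume bc: "b \<in> B" "c \<in> B" "x b = x c" "b \<noteq> c"
    have pV: "p \<in> V \<inter> points M" using V(2) pp by simp
    have "e b p (x b) = 1" using exd[rule_format, OF pV bc(1,1)] by simp
    moreover have "e b p (x c) = 0" using exd[rule_format, OF pV bc(1,2)] bc(4) by simp
    ultimately show False unfolding bc(3) by simp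
  qed
  define i where "i = inv_into B x"
  have i: "i (x b) = b" if "b \<in> B" for b using inj that by (simp add: i_def)
  let ?e = "\<lambda>y. e (i y)"
  have 1: "u = (\<Sum>y\<in>x ` B. tscale (u y) (?e y q))"
    if q: "q \<in> V \<inter> points M" and u: "u \<in> tangent M q" for q u
  proof (rule ext)
    fix f
    have qU: "q \<in> U" using q V(3) by blast
    have "u f = (\<Sum>b\<in>B. u (x b) * chart_vec q b f)"
    proof (cases "f \<in> smooth_funs M")
      case True
      show ?thesis
        by (rule tangent_coordinates[OF qU V(1) _ _ _ u True]) (use q x xc U_sub in auto)
    qed (simp add: tangent_outside[OF u] chart_vec_def)
    also have "\<dots> = (\<Sum>b\<in>B. u (x b) * e b q f)"
      using q ec by (intro sum.cong) auto
    finally show "u f = (\<Sum>y\<in>x ` B. tscale (u y) (?e y q)) f"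
      by (simp add: sum_fun_apply sum.reindex[OF inj] i)
  qed
  have 2: "?e y q y' = (if y = y' then 1 else 0)" if "q \<in> V \<inter> points M" "y \<in> x ` B" "y' \<in> x ` B" for q y y'
    using that exd i inj by (auto simp: inj_on_def)
  have 3: "q = q'" if q: "q \<in> V \<inter> points M" "q' \<in> V \<inter> points M" and eq: "\<forall>y\<in>x ` B. y q = y q'" for q q'
  proof -
    have U: "q \<in> U" "q' \<in> U" using q V(3) by blast+
    have "\<psi> q \<bullet> b = \<psi> q' \<bullet> b" if "b \<in> B" for b using eq that q xc by fastforce
    then have "P (\<psi> q) = P (\<psi> q')" by (simp add: P_def)
    then show ?thesis using U P_\<psi> \<kappa>_\<psi> by metis
  qed
  show ?thesis
    by (rule that[of "x ` B" ?e V]) (use finite_B x e i V 1 2 3 in auto)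
qed

end

lemma smooth_manifold_frame:
  assumes "smooth_manifold E M" "p \<in> points M"
  obtains X e V where "finite X" "X \<subseteq> smooth_funs M" "\<forall>x\<in>X. e x \<in> vfields M" "open V" "p \<in> V"
    "\<forall>q\<in>V \<inter> points M. \<forall>u\<in>tangent M q. u = (\<Sum>x\<in>X. tscale (u x) (e x q))"
    "\<forall>q\<in>V \<inter> points M. \<forall>x\<in>X. \<forall>y\<in>X. e x q y = (if x = y then 1 else 0)"
    "\<forall>q\<in>V \<inter> points M. \<forall>q'\<in>V \<inter> points M. (\<forall>x\<in>X. x q = x q') \<longrightarrow> q = q'"
proof -
  obtain B :: "'a set" and U \<psi> D \<kappa> where "manifold_chart M B U \<psi> D \<kappa>" and p: "p \<in> U"
    by (rule smooth_manifold_chart[OF assms])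
  then interpret ring_chart M B U \<psi> D \<kappa>
    by (intro ring_chart.intro smooth_manifold_smooth_ring[OF assms(1)])
  show ?thesis by (rule chart_frame[OF p], rule that)
qed

lemma smooth_manifold_smooth_fun_space:
  assumes "smooth_manifold E M"
  shows "smooth_fun_space M"
proof -
  interpret smooth_ring M by (rule smooth_manifold_smooth_ring[OF assms])
  show ?thesis
  proof
    fix p assume "p \<in> points M"
    then obtain X e V where "finite X" "X \<subseteq> smooth_funs M" "\<forall>x\<in>X. e x \<in> vfields M" "open V" "p \<in> V"
      "\<forall>q\<in>V \<inter> points M. \<forall>u\<in>tangent M q. u = (\<Sum>x\<in>X. tscale (u x) (e x q))"
      by (rule smooth_manifold_frame[OF assms])
    then show "\<exists>X e U. finite X \<and> X \<subseteq> smooth_funs M \<and> (\<forall>x\<in>X. e x \<in> vfields M) \<and> open U \<and> p \<in> U \<and>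
        (\<forall>q\<in>U \<inter> points M. \<forall>u\<in>tangent M q. u = (\<Sum>x\<in>X. tscale (u x) (e x q)))"
      by (intro exI conjI)
  qed
qed

section \<open>Riemannian manifolds\<close>

lemma riemannian_manifold_metric_fun_space:
  assumes "riemannian_manifold E M"
  shows "metric_fun_space M"
proof -
  interpret smooth_fun_space M
    using assms by (intro smooth_manifold_smooth_fun_space[of E]) (simp add: riemannian_manifold_def)
  show ?thesis
    using assms by unfold_locales (simp_all add: riemannian_manifold_def)
qed

text \<open>Gram-Schmidt for fields. The clause on \<open>X - A\<close> confines \<open>W\<close> to
  the span of the frame fields indexed by \<open>A\<close>, within which its products with these
  fields can be prescribed. The prescribed values \<open>c\<close> vary in the induction, because
  the step uses the hypothesis a second time to project the new frame field.\<close>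

lemma riemannian_manifold_riesz_frame:
  assumes R: "riemannian_manifold E M" and p: "p \<in> points M"
    and X: "finite X" "X \<subseteq> smooth_funs M" "\<forall>x\<in>X. e x \<in> vfields M" "open V" "p \<in> V"
    and dual: "\<forall>q\<in>V \<inter> points M. \<forall>u\<in>tangent M q. u = (\<Sum>x\<in>X. tscale (u x) (e x q))"
    and delta: "\<forall>q\<in>V \<inter> points M. \<forall>x\<in>X. \<forall>y\<in>X. e x q y = (if x = y then 1 else 0)"
    and A: "A \<subseteq> X"
  shows "(\<forall>x\<in>X. c x \<in> smooth_funs M) \<Longrightarrow> \<exists>W U. W \<in> vfields M \<and> open U \<and> p \<in> U \<and>
     (\<forall>q\<in>U \<inter> points M. (\<forall>x\<in>A. metric_tensor M q (W q) (e x q) = c x q) \<and> (\<forall>y\<in>X - A. W q y = 0))"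
  using finite_subset[OF A X(1)] A
proof (induction A arbitrary: c)
  interpret metric_fun_space M by (rule riemannian_manifold_metric_fun_space[OF R])
  case empty
  show ?case
    by (intro exI[of _ "0 :: 'b vfield"] exI[of _ UNIV] conjI vfields_0) simp_all
next
  interpret metric_fun_space M by (rule riemannian_manifold_metric_fun_space[OF R])
  obtain S A' and B' :: "'a set" where "smooth_atlas_space M S A' B'"
    using R smooth_manifold_atlas unfolding riemannian_manifold_def by metis
  then interpret at: smooth_atlas_space M S A' B' .
  case (insert a A)
  have a: "a \<in> X" and AX: "A \<subseteq> X" and ea: "e a \<in> vfields M" and ex: "\<And>x. x \<in> A \<Longrightarrow> e x \<in> vfields M"
    using insert.prems X(3) by auto
  obtain W0 U0 where W0: "W0 \<in> vfields M" and U0: "open U0" "p \<in> U0"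
    and eq0: "\<forall>q\<in>U0 \<inter> points M. (\<forall>x\<in>A. metric_tensor M q (W0 q) (e x q) = c x q) \<and> (\<forall>y\<in>X - A. W0 q y = 0)"
    using insert.IH[OF insert.prems(1) AX] by (elim exE conjE) (rule that)
  have "\<forall>x\<in>X. (\<lambda>q. metric_tensor M q (e a q) (e x q)) \<in> smooth_funs M"
    using metric_smooth[OF ea] X(3) by blast
  from insert.IH[OF this AX]
  obtain W1 U1 where W1: "W1 \<in> vfields M" and U1: "open U1" "p \<in> U1"
    and eq1: "\<forall>q\<in>U1 \<inter> points M. (\<forall>x\<in>A. metric_tensor M q (W1 q) (e x q) = metric_tensor M q (e a q) (e x q)) \<and>
      (\<forall>y\<in>X - A. W1 q y = 0)"
    by (elim exE conjE) (rule that)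
  \<comment> \<open>\<open>W1\<close> is the projection of \<open>e a\<close> to the span of the
    earlier fields. Its coordinate \<open>a\<close> is 0 while that of \<open>e a\<close> is 1, so
    \<open>n\<close> has no zero near \<open>p\<close>.\<close>
  define n where "n = e a - W1"
  have n: "n \<in> vfields M" unfolding n_def by (rule vfields_diff[OF ea W1])
  have nq: "n q = e a q - W1 q" for q by (simp add: n_def)
  let ?f = "\<lambda>q. metric_tensor M q (n q) (n q)"
  have f: "?f \<in> smooth_funs M" by (rule metric_smooth[OF n n])
  have nz: "?f q \<noteq> 0" if "q \<in> U1 \<inter> V" "q \<in> points M" for q
  proof -
    have "e a q a = 1" using delta[rule_format, of q a a] that a by simp
    moreover have "W1 q a = 0" using eq1[rule_format, of q] that a insert.hyps(2) by simp
    ultimately have "n q a \<noteq> 0" by (simp add: nq)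
    then have "n q \<noteq> 0" by auto
    then show ?thesis using metric_pos[OF that(2) vfields_tangent[OF n that(2)]] by simp
  qed
  obtain h V' where h: "h \<in> smooth_funs M" "open V'" "p \<in> V'"
    "\<And>q. q \<in> V' \<Longrightarrow> q \<in> points M \<Longrightarrow> h q * ?f q = 1"
    "\<And>q. q \<in> V' \<Longrightarrow> q \<in> points M \<Longrightarrow> q \<in> U1 \<inter> V"
    using at.atlas_local_inverse[OF f p open_Int[OF U1(1) X(4)] IntI[OF U1(2) X(5)] nz] by metis
  \<comment> \<open>\<open>W0\<close> already has the right products with the earlier fields. Adding
    a multiple of \<open>n\<close>, which is orthogonal to them, corrects the product with
    \<open>e a\<close>; \<open>h\<close> inverts \<open>g(n, n)\<close>.\<close>
  let ?k = "\<lambda>q. (c a q - metric_tensor M q (W0 q) (e a q)) * h q"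
  have k: "?k \<in> smooth_funs M"
    using insert.prems(1) a by (intro mult_in[OF diff_in[OF _ metric_smooth[OF W0 ea]] h(1)]) blast
  let ?W = "W0 + fscale ?k n"
  have W: "?W \<in> vfields M" by (rule vfields_add[OF W0 vfields_fscale[OF k n]])
  have main: "(\<forall>x\<in>insert a A. metric_tensor M q (?W q) (e x q) = c x q) \<and> (\<forall>y\<in>X - insert a A. ?W q y = 0)"
    if q: "q \<in> U0 \<inter> V' \<inter> points M" for q
  proof -
    have qp: "q \<in> points M" and qU: "q \<in> U1 \<inter> points M" and qV: "q \<in> V \<inter> points M" and q0: "q \<in> U0 \<inter> points M"
      using q h(5)[of q] by auto
    note t = vfields_tangent[OF W0 qp] vfields_tangent[OF W1 qp] vfields_tangent[OF n qp]
      vfields_tangent[OF ea qp]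
    have et: "e x q \<in> tangent M q" if "x \<in> A" for x using vfields_tangent[OF ex[OF that] qp] .
    have n0: "metric_tensor M q (n q) (e x q) = 0" if "x \<in> A" for x
      using eq1[rule_format, OF qU] that t et[OF that] by (simp add: nq metric_diff[OF qp])
    \<comment> \<open>Only fields from \<open>A\<close> occur with nonzero coefficient, so
      \<open>n\<close> is orthogonal to \<open>W1\<close> and
      \<open>g(n, e a) = g(n, n)\<close>.\<close>
    have W1s: "W1 q = (\<Sum>x\<in>X. tscale (W1 q x) (e x q))"
      using dual[rule_format, OF qV t(2)] .
    have "metric_tensor M q (n q) (\<Sum>x\<in>X. tscale (W1 q x) (e x q)) =
        (\<Sum>x\<in>X. metric_tensor M q (n q) (tscale (W1 q x) (e x q)))"
      using X(1,3) vfields_tangent[OF _ qp] t(3) by (intro metric_sum_right[OF qp]) (auto intro: tangent_tscale)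
    also have "\<dots> = (\<Sum>x\<in>X. 0)"
    proof (rule sum.cong[OF refl])
      fix x assume x: "x \<in> X"
      then have "e x q \<in> tangent M q" using vfields_tangent[OF _ qp] X(3) by blast
      then show "metric_tensor M q (n q) (tscale (W1 q x) (e x q)) = 0"
        using n0[of x] eq1[rule_format, OF qU] x t(3) by (cases "x \<in> A") (auto simp: metric_tscale_right[OF qp] metric_0_right[OF qp])
    qed
    finally have "metric_tensor M q (n q) (W1 q) = 0" unfolding W1s[symmetric] by simp
    then have nea: "metric_tensor M q (n q) (e a q) = ?f q"
      using t by (simp add: nq metric_diff[OF qp] metric_diff_right[OF qp] tangent_diff)
    have hf: "h q * ?f q = 1" using h(4) q by simp
    have "metric_tensor M q (?W q) (e x q) = c x q" if "x \<in> insert a A" for x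
    proof (cases "x = a")
      case True
      have "metric_tensor M q (?W q) (e a q) = metric_tensor M q (W0 q) (e a q) +
          (c a q - metric_tensor M q (W0 q) (e a q)) * (h q * ?f q)"
        using t nea by (simp add: fscale_def metric_add[OF qp] metric_tscale[OF qp] tangent_tscale)
      then show ?thesis unfolding hf True by simp
    next
      case False
      then have x: "x \<in> A" using that by simp
      show ?thesis
        using eq0[rule_format, OF q0] x t et[OF x] n0[OF x]
        by (simp add: fscale_def metric_add[OF qp] metric_tscale[OF qp] tangent_tscale)
    qed
    moreover have "?W q y = 0" if "y \<in> X - insert a A" for y
      using that eq0[rule_format, OF q0] eq1[rule_format, OF qU] delta[rule_format, OF qV a, of y]
      by (auto simp: fscale_def nq)
    ultimately show ?thesis by blast
  qed
  have "open (U0 \<inter> V')" "p \<in> U0 \<inter> V'" using U0 h(2,3) by auto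
  then show ?case using W main by (intro exI[of _ ?W] exI[of _ "U0 \<inter> V'"]) blast
qed

lemma riemannian_manifold_riemannian_fun_space:
  assumes R: "riemannian_manifold E M"
  shows "riemannian_fun_space M"
proof -
  interpret metric_fun_space M by (rule riemannian_manifold_metric_fun_space[OF R])
  have sm: "smooth_manifold E M" using R by (simp add: riemannian_manifold_def)
  show ?thesis
  proof
    fix L p assume L: "module_functional M L" and p: "p \<in> points M"
    obtain X e V where X: "finite X" "X \<subseteq> smooth_funs M" "\<forall>x\<in>X. e x \<in> vfields M" and V: "open V" "p \<in> V"
      and frame: "\<forall>q\<in>V \<inter> points M. \<forall>u\<in>tangent M q. u = (\<Sum>x\<in>X. tscale (u x) (e x q))"
      and delta: "\<forall>q\<in>V \<inter> points M. \<forall>x\<in>X. \<forall>y\<in>X. e x q y = (if x = y then 1 else 0)"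
      and "\<forall>q\<in>V \<inter> points M. \<forall>q'\<in>V \<inter> points M. (\<forall>x\<in>X. x q = x q') \<longrightarrow> q = q'"
      by (rule smooth_manifold_frame[OF sm p])
    have "\<forall>x\<in>X. L (e x) \<in> smooth_funs M" using L X(3) unfolding module_functional_def by blast
    from riemannian_manifold_riesz_frame[OF R p X V frame delta subset_refl this]
    obtain W U where W: "W \<in> vfields M" and U: "open U" "p \<in> U"
      and eq: "\<forall>q\<in>U \<inter> points M. (\<forall>x\<in>X. metric_tensor M q (W q) (e x q) = L (e x) q) \<and> (\<forall>y\<in>X - X. W q y = 0)"
      by (elim exE conjE) (rule that)
    have "metric_tensor M q (W q) (Z q) = L Z q" if q: "q \<in> U \<inter> V \<inter> points M" and Z: "Z \<in> vfields M" for q Z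
    proof -
      have qp: "q \<in> points M" and qV: "q \<in> V \<inter> points M" and qU: "q \<in> U \<inter> points M" using q by auto
      have et: "e x q \<in> tangent M q" if "x \<in> X" for x using vfields_tangent[OF _ qp] X(3) that by blast
      note Wq = vfields_tangent[OF W qp] and Zq = vfields_tangent[OF Z qp]
      have "metric_tensor M q (W q) (\<Sum>x\<in>X. tscale (Z q x) (e x q)) =
          (\<Sum>x\<in>X. metric_tensor M q (W q) (tscale (Z q x) (e x q)))"
        by (rule metric_sum_right[OF qp X(1) tangent_tscale[OF et] Wq])
      also have "\<dots> = (\<Sum>x\<in>X. Z q x * L (e x) q)"
        using eq[rule_format, OF qU] et Wq by (intro sum.cong) (auto simp: metric_tscale_right[OF qp])
      also have "\<dots> = L Z q"
        using qV by (intro module_functional_expand[OF L X V(1) frame _ _ Z, symmetric]) auto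
      finally show ?thesis unfolding frame[rule_format, OF qV Zq, symmetric] .
    qed
    then show "\<exists>W\<in>vfields M. \<exists>U. open U \<and> p \<in> U \<and>
        (\<forall>q\<in>U \<inter> points M. \<forall>Z\<in>vfields M. metric_tensor M q (W q) (Z q) = L Z q)"
      using W U V by (intro bexI[of _ W] exI[of _ "U \<inter> V"]) auto
  qed
qed

section \<open>Riemannian submersions\<close>

locale submersion =
  M: riemannian_fun_space M + N: riemannian_fun_space N
  for M :: "('m::topological_space, 'y) riem_space_scheme"
    and N :: "('n::topological_space, 'z) riem_space_scheme" and \<pi> :: "'m \<Rightarrow> 'n" +
  assumes proj_points: "\<pi> ` points M = points N" and proj_cont: "continuous_on (points M) \<pi>"
    and pullback: "f \<in> smooth_funs N \<Longrightarrow> f \<circ> \<pi> \<in> smooth_funs M"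
    and dmap_image: "p \<in> points M \<Longrightarrow> dmap N \<pi> ` tangent M p = tangent N (\<pi> p)"
    and isometry: "p \<in> points M \<Longrightarrow> u \<in> horizontal_space M N \<pi> p \<Longrightarrow> w \<in> horizontal_space M N \<pi> p \<Longrightarrow>
      metric_tensor N (\<pi> p) (dmap N \<pi> u) (dmap N \<pi> w) = metric_tensor M p u w"
begin

abbreviation "dpi \<equiv> dmap N \<pi>"
abbreviation "Ver \<equiv> vertical_space M N \<pi>"
abbreviation "Hor \<equiv> horizontal_space M N \<pi>"
abbreviation "gM \<equiv> metric_tensor M"
abbreviation "gN \<equiv> metric_tensor N"
abbreviation "vp \<equiv> vproj M N \<pi>"
abbreviation "hp \<equiv> hproj M N \<pi>"

lemma proj_in: "p \<in> points M \<Longrightarrow> \<pi> p \<in> points N"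
  using proj_points by blast

lemma dpi_add: "dpi (u + w) = dpi u + dpi w"
  by (auto simp: dmap_def fun_eq_iff)

lemma dpi_diff: "dpi (u - w) = dpi u - dpi w"
  by (auto simp: dmap_def fun_eq_iff)

lemma dpi_tscale: "dpi (tscale c u) = tscale c (dpi u)"
  by (auto simp: dmap_def fun_eq_iff)

lemma dpi_0: "dpi 0 = 0"
  by (auto simp: dmap_def fun_eq_iff)

lemma dpi_sum: "dpi (\<Sum>i\<in>I. u i) = (\<Sum>i\<in>I. dpi (u i))"
  by (induction I rule: infinite_finite_induct) (simp_all only: sum.infinite sum.empty sum.insert dpi_0 dpi_add not_False_eq_True)

lemma dpi_apply: "f \<in> smooth_funs N \<Longrightarrow> dpi u f = u (f \<circ> \<pi>)"
  by (simp add: dmap_def)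

lemma dpi_tangent: "p \<in> points M \<Longrightarrow> u \<in> tangent M p \<Longrightarrow> dpi u \<in> tangent N (\<pi> p)"
  using dmap_image by blast

lemma Ver_iff: "u \<in> Ver p \<longleftrightarrow> u \<in> tangent M p \<and> dpi u = 0"
  by (simp add: vertical_space_def)

lemma Hor_tangent: "u \<in> Hor p \<Longrightarrow> u \<in> tangent M p"
  by (simp add: horizontal_space_def)

lemma Ver_tangent: "u \<in> Ver p \<Longrightarrow> u \<in> tangent M p"
  by (simp add: vertical_space_def)

lemma Hor_Ver: "u \<in> Hor p \<Longrightarrow> w \<in> Ver p \<Longrightarrow> gM p u w = 0"
  by (simp add: horizontal_space_def)

lemma Ver_add: "u \<in> Ver p \<Longrightarrow> w \<in> Ver p \<Longrightarrow> u + w \<in> Ver p"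
  by (simp add: Ver_iff dpi_add tangent_add)

lemma Ver_diff: "u \<in> Ver p \<Longrightarrow> w \<in> Ver p \<Longrightarrow> u - w \<in> Ver p"
  by (simp add: Ver_iff dpi_diff tangent_diff)

lemma Ver_tscale: "u \<in> Ver p \<Longrightarrow> tscale c u \<in> Ver p"
  by (simp add: Ver_iff dpi_tscale tangent_tscale)

lemma Ver_0: "0 \<in> Ver p"
  by (simp add: Ver_iff dpi_0)

context
  fixes p assumes p: "p \<in> points M"
begin

lemma Hor_add: "u \<in> Hor p \<Longrightarrow> w \<in> Hor p \<Longrightarrow> u + w \<in> Hor p"
  by (simp add: horizontal_space_def tangent_add M.metric_add[OF p] Ver_tangent)

lemma Hor_diff: "u \<in> Hor p \<Longrightarrow> w \<in> Hor p \<Longrightarrow> u - w \<in> Hor p"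
  by (simp add: horizontal_space_def tangent_diff M.metric_diff[OF p] Ver_tangent)

lemma Hor_tscale: "u \<in> Hor p \<Longrightarrow> tscale c u \<in> Hor p"
  by (simp add: horizontal_space_def tangent_tscale M.metric_tscale[OF p] Ver_tangent)

lemma Hor_0: "0 \<in> Hor p"
  by (simp add: horizontal_space_def M.metric_0[OF p] Ver_tangent)

lemma Hor_sum: "(\<And>i. i \<in> I \<Longrightarrow> u i \<in> Hor p) \<Longrightarrow> (\<Sum>i\<in>I. u i) \<in> Hor p"
  by (induction I rule: infinite_finite_induct) (simp_all add: Hor_0 Hor_add del: zero_fun_apply)

lemma Hor_Ver_0: "u \<in> Hor p \<Longrightarrow> u \<in> Ver p \<Longrightarrow> u = 0"
  using M.metric_pos[OF p Ver_tangent[of u]] Hor_Ver[of u p u] by fastforce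

text \<open>A vertical vector annihilates every pullback, and pairing with the gradient is
  application to the pullback.\<close>

lemma Hor_grad: "f \<in> smooth_funs N \<Longrightarrow> M.grad (f \<circ> \<pi>) p \<in> Hor p"
  unfolding horizontal_space_def
  using vfields_tangent[OF M.vfields_grad[OF pullback] p] M.metric_grad[OF pullback p]
  by (auto simp: Ver_iff simp flip: dpi_apply)

text \<open>Project \<open>u\<close> to the span of the gradients of pulled-back coordinates. The
  remainder is orthogonal to these gradients, so its image under \<open>dpi\<close> kills all
  coordinates of the base and is 0 by the dual basis. No dimension count of the tangent spaces is
  involved.\<close>

lemma splitting_exists:
  assumes u: "u \<in> tangent M p"
  shows "\<exists>w. w \<in> Ver p \<and> u - w \<in> Hor p"
proof -
  from N.frame[OF proj_in[OF p]] obtain Y e U where Y: "finite Y" "Y \<subseteq> smooth_funs N"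
    and U: "\<pi> p \<in> U"
    and frame: "\<forall>q\<in>U \<inter> points N. \<forall>u\<in>tangent N q. u = (\<Sum>y\<in>Y. tscale (u y) (e y q))"
    by (elim exE conjE) (rule that)
  let ?A = "(\<lambda>y. M.grad (y \<circ> \<pi>) p) ` Y"
  have A: "finite ?A" "?A \<subseteq> tangent M p"
    using Y Hor_grad Hor_tangent by auto
  obtain h where h: "h \<in> tangent M p" and uh: "\<forall>a\<in>?A. gM p (u - h) a = 0"
    and hw: "\<forall>w\<in>tangent M p. (\<forall>a\<in>?A. gM p w a = 0) \<longrightarrow> gM p h w = 0"
    using M.orthogonal_decomposition[OF p A, rule_format, OF u] by (elim bexE conjE) (rule that)
  have gr: "gM p w (M.grad (y \<circ> \<pi>) p) = dpi w y" if "y \<in> Y" "w \<in> tangent M p" for y w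
  proof -
    have y: "y \<in> smooth_funs N" using Y that by blast
    show ?thesis
      using M.metric_sym[OF p that(2) Hor_tangent[OF Hor_grad[OF y]]] M.metric_grad[OF pullback[OF y] p that(2)] dpi_apply[OF y]
      by simp
  qed
  have uht: "u - h \<in> tangent M p" using u h by (rule tangent_diff)
  have "dpi (u - h) = (\<Sum>y\<in>Y. tscale (dpi (u - h) y) (e y (\<pi> p)))"
    using frame U proj_in[OF p] dpi_tangent[OF p uht] by blast
  also have "\<dots> = (\<Sum>y\<in>Y. 0)"
    using uh gr[OF _ uht] by (intro sum.cong) auto
  finally have "u - h \<in> Ver p" using uht by (simp add: Ver_iff)
  moreover have "h \<in> Hor p"
    unfolding horizontal_space_def
  proof (intro CollectI conjI ballI h)
    fix w assume w: "w \<in> Ver p"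
    then have "\<forall>a\<in>?A. gM p w a = 0" using gr Ver_tangent[OF w] by (auto simp: Ver_iff)
    then show "gM p h w = 0" using hw Ver_tangent[OF w] by blast
  qed
  ultimately show ?thesis by (intro exI[of _ "u - h"]) simp
qed

lemma splitting_unique:
  assumes "w \<in> Ver p" "u - w \<in> Hor p" "w' \<in> Ver p" "u - w' \<in> Hor p"
  shows "w = w'"
proof -
  have "w - w' = (u - w') - (u - w)" by simp
  then have "w - w' \<in> Hor p" using Hor_diff[OF assms(4,2)] by simp
  from Hor_Ver_0[OF this Ver_diff[OF assms(1,3)]] show ?thesis by simp
qed

lemma vproj_eqI:
  assumes "w \<in> Ver p" "u - w \<in> Hor p"
  shows "vp p u = w"
  unfolding vproj_def by (rule the_equality) (use assms splitting_unique in auto)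

lemma hproj_eqI:
  assumes "u - w \<in> Ver p" "w \<in> Hor p"
  shows "hp p u = w"
  using vproj_eqI[OF assms(1)] assms(2) by (simp add: hproj_def)

lemma vproj_Ver: "u \<in> tangent M p \<Longrightarrow> vp p u \<in> Ver p"
  and hproj_Hor: "u \<in> tangent M p \<Longrightarrow> hp p u \<in> Hor p"
  using splitting_exists vproj_eqI unfolding hproj_def by fastforce+

lemma vproj_hproj: "u = vp p u + hp p u"
  by (simp add: hproj_def)

lemma vproj_of_Ver: "u \<in> Ver p \<Longrightarrow> vp p u = u"
  by (rule vproj_eqI) (simp_all add: Hor_0)

lemma vproj_of_Hor: "u \<in> Hor p \<Longrightarrow> vp p u = 0"
  by (rule vproj_eqI) (simp_all add: Ver_0)

lemma vproj_add: "u \<in> tangent M p \<Longrightarrow> w \<in> tangent M p \<Longrightarrow> vp p (u + w) = vp p u + vp p w"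
proof (rule vproj_eqI)
  assume u: "u \<in> tangent M p" and w: "w \<in> tangent M p"
  show "vp p u + vp p w \<in> Ver p" using u w by (intro Ver_add vproj_Ver)
  have "u + w - (vp p u + vp p w) = hp p u + hp p w" by (simp add: hproj_def)
  then show "u + w - (vp p u + vp p w) \<in> Hor p" using Hor_add[OF hproj_Hor[OF u] hproj_Hor[OF w]] by simp
qed

lemma metric_vproj: "u \<in> tangent M p \<Longrightarrow> w \<in> Ver p \<Longrightarrow> gM p (vp p u) w = gM p u w"
  using Hor_Ver[OF hproj_Hor, of u w] unfolding hproj_def
  by (simp add: M.metric_diff[OF p] Ver_tangent vproj_Ver)

text \<open>One horizontal argument suffices: the vertical part of \<open>u\<close> is lost under
  \<open>dpi\<close> and is orthogonal to \<open>h\<close>.\<close>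

lemma metric_Hor:
  assumes u: "u \<in> tangent M p" and h: "h \<in> Hor p"
  shows "gN (\<pi> p) (dpi u) (dpi h) = gM p u h"
proof -
  have d: "dpi (vp p u) = 0" using vproj_Ver[OF u] by (simp add: Ver_iff)
  then have "dpi u = dpi (hp p u)" unfolding hproj_def dpi_diff by simp
  then have "gN (\<pi> p) (dpi u) (dpi h) = gM p (hp p u) h" using isometry[OF p hproj_Hor[OF u] h] by simp
  also have "\<dots> = gM p u h - gM p (vp p u) h"
    unfolding hproj_def using u h vproj_Ver[OF u] by (simp add: M.metric_diff[OF p] Ver_tangent Hor_tangent)
  also have "gM p (vp p u) h = 0"
    using Hor_Ver[OF h vproj_Ver[OF u]] M.metric_sym[OF p Ver_tangent[OF vproj_Ver[OF u]] Hor_tangent[OF h]] by simp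
  finally show ?thesis by simp
qed

lemma horizontal_preimage_exists:
  assumes "w \<in> tangent N (\<pi> p)"
  shows "\<exists>h. h \<in> Hor p \<and> dpi h = w"
proof -
  obtain u where u: "u \<in> tangent M p" "w = dpi u" using assms dmap_image[OF p] by blast
  have "dpi (vp p u) = 0" using vproj_Ver[OF u(1)] by (simp add: Ver_iff)
  then have "dpi (hp p u) = w" unfolding hproj_def dpi_diff u(2) by simp
  then show ?thesis using hproj_Hor[OF u(1)] by blast
qed

lemma horizontal_preimage_unique:
  assumes "h \<in> Hor p" "h' \<in> Hor p" "dpi h = dpi h'"
  shows "h = h'"
proof -
  have "h - h' \<in> Ver p" using assms by (simp add: Ver_iff dpi_diff tangent_diff Hor_tangent)
  from Hor_Ver_0[OF Hor_diff[OF assms(1,2)] this] show ?thesis by simp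
qed

lemma dpi_grad:
  assumes f: "f \<in> smooth_funs N"
  shows "dpi (M.grad (f \<circ> \<pi>) p) = N.grad f (\<pi> p)"
proof (rule N.metric_eqI[OF proj_in[OF p]])
  have t: "M.grad (f \<circ> \<pi>) p \<in> tangent M p" using Hor_tangent[OF Hor_grad[OF f]] .
  show "dpi (M.grad (f \<circ> \<pi>) p) \<in> tangent N (\<pi> p)" by (rule dpi_tangent[OF p t])
  show "N.grad f (\<pi> p) \<in> tangent N (\<pi> p)" by (rule vfields_tangent[OF N.vfields_grad[OF f] proj_in[OF p]])
  fix z assume z: "z \<in> tangent N (\<pi> p)"
  obtain h where h: "h \<in> Hor p" "dpi h = z" using horizontal_preimage_exists[OF z] by blast
  have "gN (\<pi> p) (dpi (M.grad (f \<circ> \<pi>) p)) z = gM p (M.grad (f \<circ> \<pi>) p) h"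
    using metric_Hor[OF t h(1)] h(2) by simp
  also have "\<dots> = z f"
    using M.metric_grad[OF pullback[OF f] p Hor_tangent[OF h(1)]] h(2) dpi_apply[OF f, of h] by simp
  also have "\<dots> = gN (\<pi> p) (N.grad f (\<pi> p)) z"
    using N.metric_grad[OF f proj_in[OF p] z] by simp
  finally show "gN (\<pi> p) (dpi (M.grad (f \<circ> \<pi>) p)) z = gN (\<pi> p) (N.grad f (\<pi> p)) z" .
qed

end

section \<open>Smoothness of horizontal lifts and of the two projections\<close>

definition lift :: "'n vfield \<Rightarrow> 'm vfield" where
  "lift X p = (if p \<in> points M then THE h. h \<in> Hor p \<and> dpi h = X (\<pi> p) else 0)"

lemma lift_eqI:
  assumes "p \<in> points M" "h \<in> Hor p" "dpi h = X (\<pi> p)"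
  shows "lift X p = h"
  unfolding lift_def using assms horizontal_preimage_unique[OF assms(1)] by (auto intro!: the_equality)

lemma
  assumes "p \<in> points M" "X \<in> vfields N"
  shows lift_Hor: "lift X p \<in> Hor p" and dpi_lift: "dpi (lift X p) = X (\<pi> p)"
proof -
  obtain h where h: "h \<in> Hor p" "dpi h = X (\<pi> p)"
    using horizontal_preimage_exists[OF assms(1) vfields_tangent[OF assms(2) proj_in[OF assms(1)]]] by blast
  then show "lift X p \<in> Hor p" "dpi (lift X p) = X (\<pi> p)" using lift_eqI[of p h X, OF assms(1) h] by simp_all
qed

lemma lift_outside: "p \<notin> points M \<Longrightarrow> lift X p = 0"
  by (simp add: lift_def)

lemma preimage_nhd:
  assumes "open U" "p \<in> points M" "\<pi> p \<in> U"
  obtains V where "open V" "p \<in> V" "\<forall>q\<in>V \<inter> points M. \<pi> q \<in> U"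
proof -
  have "openin (top_of_set (points M)) (points M \<inter> \<pi> -` U)"
    by (rule continuous_openin_preimage_gen[OF proj_cont assms(1)])
  then obtain V where "open V" "points M \<inter> \<pi> -` U = points M \<inter> V" by (auto simp: openin_open)
  then show ?thesis using assms by (intro that[of V]) auto
qed

text \<open>On the base, a dual basis gives \<open>X\<close> as the sum over \<open>y\<close> of
  \<open>g(X, e y)\<close> times the gradient of \<open>y\<close>. Gradients of pullbacks are
  horizontal and project to gradients, so the same sum with pulled-back coefficients is a local
  formula for the lift.\<close>

lemma vfields_lift:
  assumes X: "X \<in> vfields N"
  shows "lift X \<in> vfields M"
proof (rule M.vfields_localI)
  show "lift X p = 0" if "p \<notin> points M" for p using that by (rule lift_outside)
  fix p assume p: "p \<in> points M"
  from N.frame[OF proj_in[OF p]] obtain Y e U where Y: "finite Y" "Y \<subseteq> smooth_funs N"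
    and e: "\<forall>y\<in>Y. e y \<in> vfields N" and U: "open U" "\<pi> p \<in> U"
    and frame: "\<forall>q\<in>U \<inter> points N. \<forall>u\<in>tangent N q. u = (\<Sum>y\<in>Y. tscale (u y) (e y q))"
    by (elim exE conjE) (rule that)
  obtain V where V: "open V" "p \<in> V" "\<forall>q\<in>V \<inter> points M. \<pi> q \<in> U" by (rule preimage_nhd[OF U(1) p U(2)])
  let ?c = "\<lambda>y q. gN (\<pi> q) (X (\<pi> q)) (e y (\<pi> q))"
  let ?W = "\<Sum>y\<in>Y. fscale (?c y) (M.grad (y \<circ> \<pi>))"
  have c: "?c y \<in> smooth_funs M" if "y \<in> Y" for y
    using pullback[OF N.metric_smooth[OF X e[rule_format, OF that]]] by (simp add: comp_def)
  have W: "?W \<in> vfields M"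
    using Y c by (intro M.vfields_sum M.vfields_fscale M.vfields_grad pullback) auto
  have "lift X q = ?W q" if q: "q \<in> V \<inter> points M" for q
  proof (rule lift_eqI)
    show qp: "q \<in> points M" using q by simp
    have nq: "\<pi> q \<in> U \<inter> points N" "\<pi> q \<in> points N" using q V(3) proj_in[OF qp] by auto
    have Wq: "?W q = (\<Sum>y\<in>Y. tscale (?c y q) (M.grad (y \<circ> \<pi>) q))"
      by (simp only: sum_fun_apply fscale_def)
    show "?W q \<in> Hor q"
      unfolding Wq using Y by (intro Hor_sum[OF qp] Hor_tscale[OF qp] Hor_grad[OF qp]) auto
    have eq: "dpi (?W q) = (\<Sum>y\<in>Y. tscale (?c y q) (N.grad y (\<pi> q)))"
      unfolding Wq dpi_sum dpi_tscale using Y by (intro sum.cong) (auto simp: dpi_grad[OF qp])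
    have gt: "N.grad y (\<pi> q) \<in> tangent N (\<pi> q)" if "y \<in> Y" for y
      using vfields_tangent[OF N.vfields_grad nq(2)] Y that by blast
    have et: "e y (\<pi> q) \<in> tangent N (\<pi> q)" if "y \<in> Y" for y
      using vfields_tangent[OF e[rule_format, OF that] nq(2)] .
    note Xq = vfields_tangent[OF X nq(2)]
    show "dpi (?W q) = X (\<pi> q)"
      unfolding eq
    proof (rule N.metric_eqI[OF nq(2)])
      show "(\<Sum>y\<in>Y. tscale (?c y q) (N.grad y (\<pi> q))) \<in> tangent N (\<pi> q)"
        by (intro tangent_sum tangent_tscale gt)
      fix z assume z: "z \<in> tangent N (\<pi> q)"
      have "gN (\<pi> q) (\<Sum>y\<in>Y. tscale (?c y q) (N.grad y (\<pi> q))) z =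
          (\<Sum>y\<in>Y. gN (\<pi> q) (tscale (?c y q) (N.grad y (\<pi> q))) z)"
        by (rule N.metric_sum[OF nq(2) Y(1) tangent_tscale[OF gt] z])
      also have "\<dots> = (\<Sum>y\<in>Y. gN (\<pi> q) (X (\<pi> q)) (tscale (z y) (e y (\<pi> q))))"
      proof (rule sum.cong[OF refl])
        fix y assume y: "y \<in> Y"
        then have "y \<in> smooth_funs N" using Y by blast
        from N.metric_grad[OF this nq(2) z]
        show "gN (\<pi> q) (tscale (?c y q) (N.grad y (\<pi> q))) z = gN (\<pi> q) (X (\<pi> q)) (tscale (z y) (e y (\<pi> q)))"
          using gt[OF y] et[OF y] z Xq by (simp add: N.metric_tscale[OF nq(2)] N.metric_tscale_right[OF nq(2)])
      qed
      also have "\<dots> = gN (\<pi> q) (X (\<pi> q)) (\<Sum>y\<in>Y. tscale (z y) (e y (\<pi> q)))"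
        by (rule N.metric_sum_right[OF nq(2) Y(1) tangent_tscale[OF et] Xq, symmetric])
      also have "(\<Sum>y\<in>Y. tscale (z y) (e y (\<pi> q))) = z"
        by (rule frame[rule_format, OF nq(1) z, symmetric])
      finally show "gN (\<pi> q) (\<Sum>y\<in>Y. tscale (?c y q) (N.grad y (\<pi> q))) z = gN (\<pi> q) (X (\<pi> q)) z" .
    qed (rule Xq)
  qed
  then show "\<exists>U Y. open U \<and> p \<in> U \<and> Y \<in> vfields M \<and> (\<forall>q\<in>U \<inter> points M. lift X q = Y q)"
    using V W by (intro exI[of _ V] exI[of _ ?W]) simp
qed

lemma app_apply: "p \<in> points M \<Longrightarrow> app M t X p = t p (X p)"
  by (simp add: app_def)

text \<open>The local formula is the sum over \<open>y\<close> of \<open>X (y o \<pi>)\<close> times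
  the lift of \<open>e y\<close>: it is horizontal and has the same image under \<open>dpi\<close>
  as \<open>X\<close>.\<close>

lemma vfields_hproj:
  assumes X: "X \<in> vfields M"
  shows "app M hp X \<in> vfields M"
proof (rule M.vfields_localI)
  show "app M hp X p = 0" if "p \<notin> points M" for p using that by (simp add: app_def)
  fix p assume p: "p \<in> points M"
  from N.frame[OF proj_in[OF p]] obtain Y e U where Y: "finite Y" "Y \<subseteq> smooth_funs N"
    and e: "\<forall>y\<in>Y. e y \<in> vfields N" and U: "open U" "\<pi> p \<in> U"
    and frame: "\<forall>q\<in>U \<inter> points N. \<forall>u\<in>tangent N q. u = (\<Sum>y\<in>Y. tscale (u y) (e y q))"
    by (elim exE conjE) (rule that)
  obtain V where V: "open V" "p \<in> V" "\<forall>q\<in>V \<inter> points M. \<pi> q \<in> U" by (rule preimage_nhd[OF U(1) p U(2)])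
  let ?W = "\<Sum>y\<in>Y. fscale (\<lambda>q. X q (y \<circ> \<pi>)) (lift (e y))"
  have W: "?W \<in> vfields M"
    using Y e vfields_smooth[OF X pullback] by (intro M.vfields_sum M.vfields_fscale vfields_lift) auto
  have "app M hp X q = ?W q" if q: "q \<in> V \<inter> points M" for q
  proof -
    have qp: "q \<in> points M" using q by simp
    have nq: "\<pi> q \<in> U \<inter> points N" using q V(3) proj_in[OF qp] by auto
    note Xq = vfields_tangent[OF X qp]
    have Wq: "?W q = (\<Sum>y\<in>Y. tscale (X q (y \<circ> \<pi>)) (lift (e y) q))"
      by (simp only: sum_fun_apply fscale_def)
    have H: "?W q \<in> Hor q"
      unfolding Wq using e by (intro Hor_sum[OF qp] Hor_tscale[OF qp] lift_Hor[OF qp]) auto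
    have "dpi (?W q) = (\<Sum>y\<in>Y. tscale (dpi (X q) y) (e y (\<pi> q)))"
      unfolding Wq dpi_sum dpi_tscale using e Y by (intro sum.cong) (auto simp: dpi_lift[OF qp] dpi_apply)
    also have "\<dots> = dpi (X q)"
      by (rule frame[rule_format, OF nq dpi_tangent[OF qp Xq], symmetric])
    finally have "X q - ?W q \<in> Ver q" using Xq Hor_tangent[OF H] by (simp add: Ver_iff dpi_diff tangent_diff)
    from hproj_eqI[OF qp this H] show ?thesis using qp by (simp add: app_def)
  qed
  then show "\<exists>U Y. open U \<and> p \<in> U \<and> Y \<in> vfields M \<and> (\<forall>q\<in>U \<inter> points M. app M hp X q = Y q)"
    using V W by (intro exI[of _ V] exI[of _ ?W]) simp
qed

lemma vfields_vproj:
  assumes X: "X \<in> vfields M"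
  shows "app M vp X \<in> vfields M"
proof -
  have "app M vp X = X - app M hp X"
    using vfields_outside[OF X] by (auto simp: app_def hproj_def fun_eq_iff)
  then show ?thesis using M.vfields_diff[OF X vfields_hproj[OF X]] by simp
qed

subsection \<open>Horizontal lifts\<close>

lemma lift_apply_pullback:
  assumes "p \<in> points M" "X \<in> vfields N" "f \<in> smooth_funs N"
  shows "lift X p (f \<circ> \<pi>) = X (\<pi> p) f"
  using dpi_lift[OF assms(1,2)] dpi_apply[OF assms(3), of "lift X p"] by simp

lemma tangent_lift_pullback:
  assumes "p \<in> points M" "X \<in> vfields N" "f \<in> smooth_funs N" "\<And>q. q \<in> points M \<Longrightarrow> h q = f (\<pi> q)"
  shows "lift X p h = X (\<pi> p) f"
proof -
  have "lift X p h = lift X p (f \<circ> \<pi>)"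
    by (rule M.tangent_cong[OF vfields_tangent[OF vfields_lift[OF assms(2)] assms(1)] assms(1) pullback[OF assms(3)]])
       (simp add: assms(4))
  then show ?thesis using lift_apply_pullback[OF assms(1-3)] by simp
qed

lemma metric_lift:
  assumes "p \<in> points M" "X \<in> vfields N" "Y \<in> vfields N"
  shows "gM p (lift X p) (lift Y p) = gN (\<pi> p) (X (\<pi> p)) (Y (\<pi> p))"
  using isometry[OF assms(1) lift_Hor[OF assms(1,2)] lift_Hor[OF assms(1,3)]] dpi_lift assms by simp

text \<open>Applying a lift to a pullback gives the pullback of the derivative on the base, and this
  can be iterated.\<close>

lemma dpi_bracket_lift:
  assumes p: "p \<in> points M" and X: "X \<in> vfields N" and Y: "Y \<in> vfields N"
  shows "dpi (bracket M (lift X) (lift Y) p) = bracket N X Y (\<pi> p)"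
proof
  fix f
  show "dpi (bracket M (lift X) (lift Y) p) f = bracket N X Y (\<pi> p) f"
  proof (cases "f \<in> smooth_funs N")
    case f: True
    have "lift X p (\<lambda>q. lift Y q (f \<circ> \<pi>)) = X (\<pi> p) (\<lambda>r. Y r f)"
      by (rule tangent_lift_pullback[OF p X vfields_smooth[OF Y f] lift_apply_pullback[OF _ Y f]])
    moreover have "lift Y p (\<lambda>q. lift X q (f \<circ> \<pi>)) = Y (\<pi> p) (\<lambda>r. X r f)"
      by (rule tangent_lift_pullback[OF p Y vfields_smooth[OF X f] lift_apply_pullback[OF _ X f]])
    ultimately show ?thesis using f pullback[OF f] by (simp add: dpi_apply bracket_def)
  qed (simp add: dmap_def bracket_def)
qed

lemma metric_bracket_lift:
  assumes p: "p \<in> points M" and X: "X \<in> vfields N" and Y: "Y \<in> vfields N" and Z: "Z \<in> vfields N"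
  shows "gM p (bracket M (lift X) (lift Y) p) (lift Z p) = gN (\<pi> p) (bracket N X Y (\<pi> p)) (Z (\<pi> p))"
  using metric_Hor[OF p vfields_tangent[OF M.vfields_bracket[OF vfields_lift[OF X] vfields_lift[OF Y]] p] lift_Hor[OF p Z]]
    dpi_bracket_lift[OF p X Y] dpi_lift[OF p Z] by simp

text \<open>All six terms descend. The bracket of two lifts may have a vertical part, but it is
  paired with a horizontal field.\<close>

lemma koszul_lift:
  assumes p: "p \<in> points M" and X: "X \<in> vfields N" and Y: "Y \<in> vfields N" and Z: "Z \<in> vfields N"
  shows "M.koszul (lift X) (lift Y) (lift Z) p = N.koszul X Y Z (\<pi> p)"
  unfolding M.koszul_def N.koszul_def
  using tangent_lift_pullback[OF p X N.metric_smooth[OF Y Z] metric_lift[OF _ Y Z]]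
    tangent_lift_pullback[OF p Y N.metric_smooth[OF X Z] metric_lift[OF _ X Z]]
    tangent_lift_pullback[OF p Z N.metric_smooth[OF X Y] metric_lift[OF _ X Y]]
    metric_bracket_lift[OF p] X Y Z by simp

lemma dpi_levi_civita_lift:
  assumes p: "p \<in> points M" and X: "X \<in> vfields N" and Y: "Y \<in> vfields N"
  shows "dpi (levi_civita M (lift X) (lift Y) p) = levi_civita N X Y (\<pi> p)"
proof (rule N.metric_eqI[OF proj_in[OF p]])
  note D = vfields_tangent[OF M.levi_civita_vfields[OF vfields_lift[OF X] vfields_lift[OF Y]] p]
  show "dpi (levi_civita M (lift X) (lift Y) p) \<in> tangent N (\<pi> p)" by (rule dpi_tangent[OF p D])
  show "levi_civita N X Y (\<pi> p) \<in> tangent N (\<pi> p)"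
    by (rule vfields_tangent[OF N.levi_civita_vfields[OF X Y] proj_in[OF p]])
  fix z assume z: "z \<in> tangent N (\<pi> p)"
  obtain Z where Z: "Z \<in> vfields N" "Z (\<pi> p) = z" by (rule N.extend_tangent[OF proj_in[OF p] z])
  have "gN (\<pi> p) (dpi (levi_civita M (lift X) (lift Y) p)) z = gM p (levi_civita M (lift X) (lift Y) p) (lift Z p)"
    using metric_Hor[OF p D lift_Hor[OF p Z(1)]] dpi_lift[OF p Z(1)] Z(2) by simp
  also have "\<dots> = N.koszul X Y Z (\<pi> p)"
    using M.levi_civita_koszul[OF vfields_lift[OF X] vfields_lift[OF Y] vfields_lift[OF Z(1)] p]
      koszul_lift[OF p X Y Z(1)] by simp
  also have "\<dots> = gN (\<pi> p) (levi_civita N X Y (\<pi> p)) z"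
    using N.levi_civita_koszul[OF X Y Z(1) proj_in[OF p]] Z(2) by simp
  finally show "gN (\<pi> p) (dpi (levi_civita M (lift X) (lift Y) p)) z = gN (\<pi> p) (levi_civita N X Y (\<pi> p)) z" .
qed

lemma lift_diff:
  assumes "X \<in> vfields N" "Y \<in> vfields N"
  shows "lift (X - Y) = lift X - lift Y"
proof
  fix p
  show "lift (X - Y) p = (lift X - lift Y) p"
  proof (cases "p \<in> points M")
    case p: True
    show ?thesis
      by (rule lift_eqI[OF p]) (use assms p in \<open>simp_all add: Hor_diff lift_Hor dpi_lift dpi_diff\<close>)
  qed (simp add: lift_outside)
qed

lemma levi_civita_zero_right:
  assumes "X \<in> vfields M"
  shows "levi_civita M X 0 = 0"
proof -
  have "levi_civita M X (0 + 0) = levi_civita M X 0 + levi_civita M X 0"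
    using assms by (intro M.levi_civita_add) auto
  then show ?thesis unfolding add_0_left by (metis add_cancel_left_left)
qed

section \<open>Lifting connection and curvature when \<open>A\<close> vanishes\<close>

context
  assumes A: "oneill_A_vanishes M N \<pi>"
begin

lemma levi_civita_lift:
  assumes X: "X \<in> vfields N" and Y: "Y \<in> vfields N"
  shows "levi_civita M (lift X) (lift Y) = lift (levi_civita N X Y)"
proof
  fix p
  let ?D = "levi_civita M (lift X) (lift Y)"
  note lX = vfields_lift[OF X] and lY = vfields_lift[OF Y]
  have D: "?D \<in> vfields M" by (rule M.levi_civita_vfields[OF lX lY])
  show "?D p = lift (levi_civita N X Y) p"
  proof (cases "p \<in> points M")
    case p: True
    have h: "app M hp (lift Z) = lift Z" and v: "app M vp (lift Z) = 0" if "Z \<in> vfields N" for Z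
      using vproj_of_Hor lift_Hor[OF _ that] by (auto simp: app_def hproj_def fun_eq_iff lift_outside)
    have "oneill_A M N \<pi> (lift X) (lift Y) p = 0"
      using A lX lY by (simp add: oneill_A_vanishes_def)
    \<comment> \<open>For lifts the second summand of \<open>A\<close> is zero because
      \<open>lift Y\<close> has no vertical part; the vanishing of \<open>A\<close> thus says that
      the covariant derivative is horizontal, and its projection to the base is known.\<close>
    then have "(app M vp ?D + app M hp 0) p = 0"
      unfolding oneill_A_def Let_def h[OF X] h[OF Y] v[OF Y] levi_civita_zero_right[OF lX] .
    then have "vp p (?D p) + hp p 0 = 0"
      unfolding plus_fun_apply[of "app M vp ?D"] app_apply[OF p] by (simp only: zero_fun_apply)
    moreover have "hp p 0 = 0" by (rule hproj_eqI[OF p]) (simp_all add: Ver_0 Hor_0[OF p])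
    ultimately have "vp p (?D p) = 0" by simp
    then have "?D p \<in> Hor p"
      using hproj_Hor[OF p vfields_tangent[OF D p]] by (simp add: hproj_def)
    then show ?thesis
      using lift_eqI[of p _ "levi_civita N X Y", OF p _ dpi_levi_civita_lift[OF p X Y]] by simp
  qed (simp add: lift_outside vfields_outside[OF D])
qed

text \<open>Vanishing torsion on both sides turns brackets into differences of covariant
  derivatives; in particular the bracket of two lifts is horizontal.\<close>

lemma bracket_lift:
  assumes X: "X \<in> vfields N" and Y: "Y \<in> vfields N"
  shows "bracket M (lift X) (lift Y) = lift (bracket N X Y)"
  using M.levi_civita_torsion[OF vfields_lift[OF X] vfields_lift[OF Y]] N.levi_civita_torsion[OF X Y]
    lift_diff[OF N.levi_civita_vfields[OF X Y] N.levi_civita_vfields[OF Y X]]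
    levi_civita_lift[OF X Y] levi_civita_lift[OF Y X] by simp

lemma riemann_lift:
  assumes p: "p \<in> points M" and X: "X \<in> vfields N" and Y: "Y \<in> vfields N" and Z: "Z \<in> vfields N" and W: "W \<in> vfields N"
  shows "riemann M (lift X) (lift Y) (lift Z) (lift W) p = riemann N X Y Z W (\<pi> p)"
proof -
  note D = N.levi_civita_vfields
  have "curvature_op M (lift X) (lift Y) (lift Z) = lift (curvature_op N X Y Z)"
    using X Y Z by (simp add: curvature_op_def Let_def levi_civita_lift bracket_lift D N.vfields_bracket lift_diff N.vfields_diff)
  moreover have "curvature_op N X Y Z \<in> vfields N"
    using X Y Z by (simp add: curvature_op_def Let_def D N.vfields_bracket N.vfields_diff)
  ultimately show ?thesis using metric_lift[OF p _ W] by (simp add: riemann_def)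
qed

end

end

lemma riemannian_submersion_submersion:
  assumes "riemannian_submersion E E' M N \<pi>"
  shows "submersion M N \<pi>"
proof -
  interpret M: riemannian_fun_space M
    using assms by (intro riemannian_manifold_riemannian_fun_space[of E]) (simp add: riemannian_submersion_def)
  interpret N: riemannian_fun_space N
    using assms by (intro riemannian_manifold_riemannian_fun_space[of E']) (simp add: riemannian_submersion_def)
  show ?thesis
    using assms by unfold_locales (simp_all add: riemannian_submersion_def smooth_map_def)
qed

section \<open>Contact-complex submersions\<close>

locale contact_submersion = submersion M N \<pi>
  for M :: "('m::topological_space, 'y) contact_space_scheme"
    and N :: "('n::topological_space, 'z) hermitian_space_scheme" and \<pi> :: "'m \<Rightarrow> 'n" +
  assumes phi_endo: "smooth_endomorphism_field M (phi_tensor M)"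
    and xi_vfields: "xi_field M \<in> vfields M"
    and eta_xi: "p \<in> points M \<Longrightarrow> eta_form M p (xi_field M p) = 1"
    and phi_phi: "p \<in> points M \<Longrightarrow> u \<in> tangent M p \<Longrightarrow>
      phi_tensor M p (phi_tensor M p u) = - u + tscale (eta_form M p u) (xi_field M p)"
    and phi_metric: "p \<in> points M \<Longrightarrow> u \<in> tangent M p \<Longrightarrow> w \<in> tangent M p \<Longrightarrow>
      metric_tensor M p (phi_tensor M p u) (phi_tensor M p w) =
        metric_tensor M p u w - eta_form M p u * eta_form M p w"
    and J_endo: "smooth_endomorphism_field N (J_tensor N)"
    and J_J: "r \<in> points N \<Longrightarrow> z \<in> tangent N r \<Longrightarrow> J_tensor N r (J_tensor N r z) = - z"
    and J_dpi: "p \<in> points M \<Longrightarrow> u \<in> tangent M p \<Longrightarrow>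
      J_tensor N (\<pi> p) (dmap N \<pi> u) = dmap N \<pi> (phi_tensor M p u)"
begin

abbreviation "phi \<equiv> phi_tensor M"
abbreviation "xi \<equiv> xi_field M"
abbreviation "eta \<equiv> eta_form M"
abbreviation "J \<equiv> J_tensor N"

lemma vfields_phi: "X \<in> vfields M \<Longrightarrow> app M phi X \<in> vfields M"
  using phi_endo by (simp add: smooth_endomorphism_field_def)

lemma vfields_J: "X \<in> vfields N \<Longrightarrow> app N J X \<in> vfields N"
  using J_endo by (simp add: smooth_endomorphism_field_def)

lemma J_0: "r \<in> points N \<Longrightarrow> J r 0 = 0"
proof -
  assume r: "r \<in> points N"
  have "J r (tscale 0 0) = tscale 0 (J r 0)"
    by (rule bspec[OF bspec[OF J_endo[unfolded smooth_endomorphism_field_def, THEN conjunct1] r] tangent_0,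
          THEN conjunct2, THEN conjunct2, THEN spec])
  then show ?thesis by simp
qed

section \<open>Pointwise algebra of the almost contact structure and of the splitting\<close>

context
  fixes p assumes p: "p \<in> points M"
begin

lemma phi_tangent: "u \<in> tangent M p \<Longrightarrow> phi p u \<in> tangent M p"
  and phi_add: "u \<in> tangent M p \<Longrightarrow> w \<in> tangent M p \<Longrightarrow> phi p (u + w) = phi p u + phi p w"
  and phi_tscale: "u \<in> tangent M p \<Longrightarrow> phi p (tscale c u) = tscale c (phi p u)"
  using phi_endo p by (simp_all add: smooth_endomorphism_field_def)

lemma phi_0: "phi p 0 = 0"
  using phi_tscale[OF tangent_0, of 0] by simp

lemma xi_tangent: "xi p \<in> tangent M p"
  by (rule vfields_tangent[OF xi_vfields p])

lemma phi_diff: "u \<in> tangent M p \<Longrightarrow> w \<in> tangent M p \<Longrightarrow> phi p (u - w) = phi p u - phi p w"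
  using phi_add[of "u - w" w] by (simp add: tangent_diff)

text \<open>The square of \<phi> kills \<xi>, so applying the structure equation to \<phi>\<xi>
  shows \<phi>\<xi> = c\<xi>. Applying \<phi> once more gives c\<phi>\<xi> = 0, and either
  alternative yields \<phi>\<xi> = 0.\<close>

lemma phi_xi: "phi p (xi p) = 0"
proof -
  let ?c = "eta p (phi p (xi p))"
  have z: "phi p (phi p (xi p)) = 0"
    using phi_phi[OF p xi_tangent] eta_xi[OF p] by simp
  have "phi p (phi p (phi p (xi p))) = - phi p (xi p) + tscale ?c (xi p)"
    by (rule phi_phi[OF p phi_tangent[OF xi_tangent]])
  then have c: "phi p (xi p) = tscale ?c (xi p)" unfolding z phi_0 by (simp add: eq_neg_iff_add_eq_0)
  have "phi p (phi p (xi p)) = tscale ?c (phi p (xi p))"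
    by (subst (1) c) (rule phi_tscale[OF xi_tangent])
  then have "tscale ?c (phi p (xi p)) = 0" unfolding z by simp
  then have "?c = 0 \<or> phi p (xi p) = 0" by (auto simp: fun_eq_iff)
  then show ?thesis using c by fastforce
qed

text \<open>This is metric compatibility with \<xi> as second argument, where the left-hand side
  vanishes.\<close>

lemma eta_eq: "u \<in> tangent M p \<Longrightarrow> eta p u = gM p u (xi p)"
  using phi_metric[OF p _ xi_tangent, of u] eta_xi[OF p] M.metric_0_right[OF p phi_tangent]
  by (simp add: phi_xi)

text \<open>The cube of \<phi> is computed in two ways, by the structure equation at \<phi>u and by
  \<phi> applied to the structure equation at u; the difference is a multiple of \<xi>.\<close>

lemma eta_phi:
  assumes u: "u \<in> tangent M p"
  shows "eta p (phi p u) = 0"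
proof -
  have "phi p (phi p (phi p u)) = - phi p u + tscale (eta p (phi p u)) (xi p)"
    by (rule phi_phi[OF p phi_tangent[OF u]])
  moreover have "phi p (phi p (phi p u)) = - phi p u"
    unfolding phi_phi[OF p u] using u xi_tangent
    by (simp add: phi_diff tangent_tscale phi_tscale phi_xi)
  ultimately have "tscale (eta p (phi p u)) (xi p) = 0" by simp
  then have "gM p (tscale (eta p (phi p u)) (xi p)) (xi p) = 0" using M.metric_0[OF p xi_tangent] by simp
  then have "eta p (phi p u) * gM p (xi p) (xi p) = 0" using M.metric_tscale[OF p xi_tangent xi_tangent] by simp
  then show ?thesis using eta_eq[OF xi_tangent] eta_xi[OF p] by simp
qed

lemma phi_skew:
  assumes u: "u \<in> tangent M p" and w: "w \<in> tangent M p"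
  shows "gM p (phi p u) w = - gM p u (phi p w)"
proof -
  have "gM p (phi p u) w = gM p (phi p (phi p u)) (phi p w)"
    using phi_metric[OF p phi_tangent[OF u] w] eta_phi[OF u] by simp
  also have "\<dots> = - gM p u (phi p w) + eta p u * gM p (xi p) (phi p w)"
    unfolding phi_phi[OF p u] using u w xi_tangent
    by (simp add: M.metric_diff[OF p] M.metric_tscale[OF p] tangent_tscale phi_tangent)
  also have "gM p (xi p) (phi p w) = 0"
    using eta_phi[OF w] eta_eq[OF phi_tangent[OF w]] M.metric_sym[OF p xi_tangent phi_tangent[OF w]] by simp
  finally show ?thesis by simp
qed

lemma phi_Ver: "u \<in> Ver p \<Longrightarrow> phi p u \<in> Ver p"
  using J_dpi[OF p, of u] J_0[OF proj_in[OF p]] by (simp add: Ver_iff phi_tangent)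

text \<open>\<open>J\<close> maps the image of \<xi> to the image of \<phi>\<xi> = 0, and the square
  of \<open>J\<close> is minus the identity.\<close>

lemma xi_Ver: "xi p \<in> Ver p"
proof -
  let ?w = "dpi (xi p)"
  have w: "?w \<in> tangent N (\<pi> p)" by (rule dpi_tangent[OF p xi_tangent])
  have "J (\<pi> p) ?w = 0" unfolding J_dpi[OF p xi_tangent] phi_xi dpi_0 ..
  then have "- ?w = 0" using J_J[OF proj_in[OF p] w] J_0[OF proj_in[OF p]] by simp
  then show ?thesis using xi_tangent by (simp add: Ver_iff)
qed

lemma phi_Hor:
  assumes u: "u \<in> Hor p"
  shows "phi p u \<in> Hor p"
  unfolding horizontal_space_def
proof (intro CollectI conjI ballI)
  show "phi p u \<in> tangent M p" by (rule phi_tangent[OF Hor_tangent[OF u]])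
  show "gM p (phi p u) w = 0" if "w \<in> Ver p" for w
    using phi_skew[OF Hor_tangent[OF u] Ver_tangent[OF that]] Hor_Ver[OF u phi_Ver[OF that]] by simp
qed

lemma phi_metric_Hor: "u \<in> Hor p \<Longrightarrow> w \<in> Hor p \<Longrightarrow> gM p (phi p u) (phi p w) = gM p u w"
  using phi_metric[OF p] eta_eq Hor_Ver[OF _ xi_Ver] by (simp add: Hor_tangent)

end

lemma app_phi_lift:
  assumes X: "X \<in> vfields N"
  shows "app M phi (lift X) = lift (app N J X)"
proof
  fix p
  show "app M phi (lift X) p = lift (app N J X) p"
  proof (cases "p \<in> points M")
    case p: True
    have "lift (app N J X) p = phi p (lift X p)"
      by (rule lift_eqI[OF p phi_Hor[OF p lift_Hor[OF p X]]])
         (simp add: app_def proj_in[OF p] dpi_lift[OF p X] flip: J_dpi[OF p Hor_tangent[OF lift_Hor[OF p X]]])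
    then show ?thesis using p by (simp add: app_def)
  qed (simp add: app_def lift_outside)
qed

theorem K1_base:
  assumes K: "K1_phi M" and A: "oneill_A_vanishes M N \<pi>"
  shows "K1 N"
  unfolding K1_def
proof (intro ballI)
  fix X Y Z W r
  assume V: "X \<in> vfields N" "Y \<in> vfields N" "Z \<in> vfields N" "W \<in> vfields N" and r: "r \<in> points N"
  from r have "r \<in> \<pi> ` points M" unfolding proj_points .
  then obtain p where p: "\<pi> p = r" "p \<in> points M" by (elim imageE) simp
  note l = vfields_lift[OF V(1)] vfields_lift[OF V(2)] vfields_lift[OF V(3)] vfields_lift[OF V(4)]
  have "riemann M (lift X) (lift Y) (lift Z) (lift W) p =
    riemann M (lift X) (lift Y) (app M phi (lift Z)) (app M phi (lift W)) p"
    using K l p(2) unfolding K1_phi_def by simp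
  then show "riemann N X Y Z W r = riemann N X Y (app N J Z) (app N J W) r"
    unfolding app_phi_lift[OF V(3)] app_phi_lift[OF V(4)]
      riemann_lift[OF A p(2) V] riemann_lift[OF A p(2) V(1,2) vfields_J[OF V(3)] vfields_J[OF V(4)]] p(1) .
qed

end

section \<open>Vertical vectors are tangent to the fibres\<close>

text \<open>In a chart around \<open>p\<close> let \<open>G\<^sub>y\<close> be the coordinate functions of the base, pulled back, and choose
  vectors \<open>w\<^sub>y\<close> dual to their differentials \<open>L\<^sub>y\<close>. The map \<open>z + \<Sum> (G\<^sub>y z - L\<^sub>y (z - a)) w\<^sub>y\<close> has the identity
  as derivative at \<open>a\<close> and straightens the fibres, so its local inverse turns the line through \<open>a\<close> in a
  vertical direction into a curve inside the fibre.\<close>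

lemma vertical_vanish:
  fixes M :: "('m::{t2_space, second_countable_topology}, 'y) riem_space_scheme"
    and N :: "('n::{t2_space, second_countable_topology}, 'z) riem_space_scheme"
    and E :: "'a::euclidean_space set" and E' :: "'b::euclidean_space set"
  assumes sub: "riemannian_submersion E E' M N \<pi>" and p: "p \<in> points M"
    and u: "u \<in> vertical_space M N \<pi> p" and h: "h \<in> smooth_funs M" and W: "open W" "p \<in> W"
    and h0: "\<forall>x\<in>W \<inter> points M. \<pi> x = \<pi> p \<longrightarrow> h x = 0"
  shows "u h = 0"
proof -
  interpret submersion M N \<pi> by (rule riemannian_submersion_submersion[OF sub])
  have smM: "smooth_manifold E M" and smN: "smooth_manifold E' N"
    using sub by (simp_all add: riemannian_submersion_def riemannian_manifold_def)
  obtain B :: "'a set" and U \<psi> D \<kappa> where "manifold_chart M B U \<psi> D \<kappa>" and pU: "p \<in> U"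
    by (rule smooth_manifold_chart[OF smM p])
  then interpret C: ring_chart M B U \<psi> D \<kappa>
    by (intro ring_chart.intro smooth_manifold_smooth_ring[OF smM])
  obtain Y e V where Y: "finite Y" "Y \<subseteq> smooth_funs N" and e: "\<forall>y\<in>Y. e y \<in> vfields N"
    and V: "open V" "\<pi> p \<in> V"
    and "\<forall>q\<in>V \<inter> points N. \<forall>u\<in>tangent N q. u = (\<Sum>x\<in>Y. tscale (u x) (e x q))"
    and delta: "\<forall>q\<in>V \<inter> points N. \<forall>x\<in>Y. \<forall>y\<in>Y. e x q y = (if x = y then 1 else 0)"
    and inj: "\<forall>q\<in>V \<inter> points N. \<forall>q'\<in>V \<inter> points N. (\<forall>x\<in>Y. x q = x q') \<longrightarrow> q = q'"
    by (rule smooth_manifold_frame[OF smN proj_in[OF p]])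
  obtain W' where W': "open W'" "p \<in> W'" "\<forall>x\<in>W' \<inter> points M. \<pi> x \<in> V"
    by (rule preimage_nhd[OF V(1) p V(2)])
  define a where "a = \<psi> p"
  have aD: "a \<in> D" and ka: "\<kappa> a = p" unfolding a_def using pU C.\<psi>_in C.\<kappa>_\<psi> by auto
  define O1 where "O1 = D \<inter> \<kappa> -` (W \<inter> W')"
  have O1: "open O1" unfolding O1_def
    by (rule continuous_open_preimage[OF C.cont_\<kappa> C.D_open open_Int[OF W(1) W'(1)]])
  have aO: "a \<in> O1" unfolding O1_def using aD ka W(2) W'(2) by simp
  define G where "G = (\<lambda>(y :: 'n \<Rightarrow> real) z. (y \<circ> \<pi>) (\<kappa> z))"
  define L where "L = (\<lambda>y. frechet_derivative (G y) (at a))"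
  have yp: "y \<circ> \<pi> \<in> smooth_funs M" if "y \<in> Y" for y using Y(2) that by (intro pullback) blast
  have G: "Cinf D (G y)" if "y \<in> Y" for y
    unfolding G_def by (rule C.smooth_\<kappa>[OF yp[OF that]])
  have dG: "(G y has_derivative L y) (at a)" if "y \<in> Y" for y
    unfolding L_def by (rule Cinf_has_derivative[OF G[OF that] aD])
  have Llin: "linear (L y)" if "y \<in> Y" for y using dG[OF that] has_derivative_linear by blast
  have Lvec: "C.chart_vec p v (y \<circ> \<pi>) = L y v" if "y \<in> Y" for y v
    using yp[OF that] by (simp add: C.chart_vec_def L_def G_def a_def)
  \<comment> \<open>Surjectivity of the differential of \<pi> enters here: a preimage of the frame
    vector \<open>e x\<close>, written in the chart, is dual to the differentials.\<close>
  have "\<exists>w. \<forall>y\<in>Y. L y w = (if x = y then 1 else 0)" if x: "x \<in> Y" for x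
  proof -
    have "e x (\<pi> p) \<in> tangent N (\<pi> p)" using vfields_tangent[OF _ proj_in[OF p]] e x by blast
    then obtain ux where ux: "ux \<in> tangent M p" "dpi ux = e x (\<pi> p)" using dmap_image[OF p] by (metis imageE)
    obtain w where "w \<in> span B" and w: "ux = C.chart_vec p w" by (rule C.tangent_in_chart[OF pU ux(1)])
    have "L y w = (if x = y then 1 else 0)" if y: "y \<in> Y" for y
    proof -
      have "L y w = dpi ux y" using Lvec[OF y, of w] w dpi_apply[of y ux] Y(2) y by auto
      then show ?thesis using ux(2) delta V(2) proj_in[OF p] x y by simp
    qed
    then show ?thesis by blast
  qed
  then obtain w where w: "\<And>x y. x \<in> Y \<Longrightarrow> y \<in> Y \<Longrightarrow> L y (w x) = (if x = y then 1 else 0)" by metis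
  obtain v where "v \<in> span B" and v: "u = C.chart_vec p v"
    by (rule C.tangent_in_chart[OF pU Ver_tangent[OF u]])
  have Lv: "L y v = 0" if y: "y \<in> Y" for y
  proof -
    have "L y v = dpi u y" using Lvec[OF y, of v] v dpi_apply[of y u] Y(2) y by auto
    then show ?thesis using u by (simp add: Ver_iff)
  qed
  define \<Phi> where "\<Phi> = (\<lambda>z. z + (\<Sum>y\<in>Y. (G y z - G y a - L y (z - a)) *\<^sub>R w y))"
  \<comment> \<open>By duality of the \<open>w y\<close>, the linear functional \<open>L y\<close>
    in the new coordinates is the base coordinate \<open>G y\<close>; the fibres become affine
    subspaces.\<close>
  have L\<Phi>: "L y (\<Phi> z - a) = G y z - G y a" if y: "y \<in> Y" for y z
  proof -
    note l = Llin[OF y]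
    have "\<Phi> z - a = (z - a) + (\<Sum>x\<in>Y. (G x z - G x a - L x (z - a)) *\<^sub>R w x)" by (simp add: \<Phi>_def)
    then have "L y (\<Phi> z - a) = L y (z - a) + (\<Sum>x\<in>Y. (G x z - G x a - L x (z - a)) * L y (w x))"
      by (simp only: linear_add[OF l] linear_sum[OF l] linear_cmul[OF l] real_scaleR_def)
    also have "(\<Sum>x\<in>Y. (G x z - G x a - L x (z - a)) * L y (w x)) =
        (\<Sum>x\<in>Y. if x = y then G x z - G x a - L x (z - a) else 0)"
      using w y by (intro sum.cong) auto
    finally show ?thesis using Y(1) y by simp
  qed
  have C\<Phi>: "Cinf O1 \<Phi>"
  proof -
    have "Cinf O1 (L y)" if "y \<in> Y" for y by (rule Cinf_linear[OF O1 Llin[OF that]])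
    then have "Cinf O1 (\<lambda>z. L y z - L y a)" if "y \<in> Y" for y
      using that by (intro Cinf_diff O1) auto
    then have LL: "Cinf O1 (\<lambda>z. L y (z - a))" if "y \<in> Y" for y
      using that by (simp add: linear_diff[OF Llin])
    have GO: "Cinf O1 (G y)" if "y \<in> Y" for y by (rule Cinf_mono[OF G[OF that]]) (auto simp: O1_def)
    show ?thesis unfolding \<Phi>_def
      by (rule Cinf_add[OF O1 Cinf_ident[OF O1]], rule Cinf_sum[OF O1], rule Cinf_scaleR[OF O1 _ Cinf_const],
          rule Cinf_diff[OF O1 Cinf_diff[OF O1 GO Cinf_const] LL])
  qed
  have d\<Phi>: "(\<Phi> has_derivative (\<lambda>v. v)) (at a)"
  proof -
    \<comment> \<open>\<open>L y\<close> is the derivative of \<open>G y\<close> at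
      \<open>a\<close>, so the correction has derivative 0 there.\<close>
    have "((\<lambda>z. (G y z - G y a - L y (z - a)) *\<^sub>R w y) has_derivative (\<lambda>v. 0)) (at a)" if y: "y \<in> Y" for y
    proof -
      have b: "bounded_linear (L y)" using dG[OF y] has_derivative_bounded_linear by blast
      have "((\<lambda>z. z - a) has_derivative (\<lambda>v. v)) (at a)" by (auto intro!: derivative_eq_intros)
      from bounded_linear.has_derivative[OF b this]
      have "((\<lambda>z. (G y z - G y a - L y (z - a)) *\<^sub>R w y) has_derivative (\<lambda>v. (L y v - 0 - L y v) *\<^sub>R w y)) (at a)"
        by (intro has_derivative_scaleR_left has_derivative_diff dG[OF y] has_derivative_const)
      then show ?thesis by simp
    qed
    then have "((\<lambda>z. \<Sum>y\<in>Y. (G y z - G y a - L y (z - a)) *\<^sub>R w y) has_derivative (\<lambda>v. \<Sum>y\<in>Y. 0)) (at a)"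
      by (rule has_derivative_sum)
    from has_derivative_add[OF has_derivative_ident this] show ?thesis unfolding \<Phi>_def by simp
  qed
  obtain \<Phi>' where \<Phi>': "\<And>x. x \<in> O1 \<Longrightarrow> blinfun_apply (\<Phi>' x) = frechet_derivative \<Phi> (at x)"
    and c\<Phi>': "continuous_on O1 \<Phi>'" using Cinf_blinfun[OF C\<Phi>] by blast
  have der: "(\<Phi> has_derivative blinfun_apply (\<Phi>' x)) (at x)" if "x \<in> O1" for x
    using Cinf_has_derivative[OF C\<Phi> that] \<Phi>'[OF that] by simp
  have \<Phi>'a: "\<Phi>' a = id_blinfun"
  proof (rule blinfun_eqI)
    show "blinfun_apply (\<Phi>' a) i = blinfun_apply id_blinfun i" for i
      using has_derivative_unique[OF der[OF aO] d\<Phi>] by simp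
  qed
  have "id_blinfun o\<^sub>L \<Phi>' a = id_blinfun" unfolding \<Phi>'a by (rule blinfun_eqI) simp
  then obtain U' V' g g' where "open U'" and U': "U' \<subseteq> O1" "a \<in> U'" and V': "open V'" "\<Phi> a \<in> V'"
    and hom: "homeomorphism U' V' \<Phi> g"
    and dg: "\<And>y. y \<in> V' \<Longrightarrow> (g has_derivative (g' y)) (at y)"
    and g': "\<And>y. y \<in> V' \<Longrightarrow> g' y = inv (blinfun_apply (\<Phi>' (g y)))"
    using inverse_function_theorem[OF O1 der c\<Phi>' aO] by metis
  have \<Phi>a: "\<Phi> a = a" unfolding \<Phi>_def using Llin by (simp add: linear_0)
  have ga: "g a = a" using hom U'(2) \<Phi>a unfolding homeomorphism_def by force
  have aV': "a \<in> V'" using V'(2) \<Phi>a by simp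
  have "inv (blinfun_apply (id_blinfun :: 'a \<Rightarrow>\<^sub>L 'a)) = (\<lambda>v. v)"
    by (rule inv_equality) auto
  then have dga: "(g has_derivative (\<lambda>v. v)) (at a)"
    using dg[OF aV'] g'[OF aV'] ga \<Phi>'a by simp
  \<comment> \<open>The straight line in the new coordinates. Since \<open>L y v = 0\<close> for all
    \<open>y\<close>, the base coordinates are constant along it and equal to those of \<pi> p. They
    separate points near \<pi> p, so the curve stays in the fibre, where \<open>h\<close> is
    0.\<close>
  let ?c = "\<lambda>t::real. g (a + t *\<^sub>R v)"
  let ?S = "(\<lambda>t::real. a + t *\<^sub>R v) -` V'"
  have S: "open ?S" by (intro open_vimage V'(1) continuous_intros)
  have c0: "h (\<kappa> (?c t)) = 0" if t: "t \<in> ?S" for t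
  proof -
    have cU: "?c t \<in> U'" and \<Phi>c: "\<Phi> (?c t) = a + t *\<^sub>R v"
      using hom t unfolding homeomorphism_def by auto
    have cO: "?c t \<in> O1" using cU U'(1) by blast
    then have k: "\<kappa> (?c t) \<in> W \<inter> points M" "\<kappa> (?c t) \<in> W' \<inter> points M"
      using C.\<kappa>_in C.U_sub by (auto simp: O1_def)
    have "y (\<pi> (\<kappa> (?c t))) = y (\<pi> p)" if y: "y \<in> Y" for y
    proof -
      have "G y (?c t) - G y a = L y (t *\<^sub>R v)" using L\<Phi>[OF y, of "?c t"] \<Phi>c by simp
      also have "\<dots> = 0" using Lv[OF y] linear_cmul[OF Llin[OF y]] by simp
      finally show ?thesis using ka by (simp add: G_def)
    qed
    then have "\<pi> (\<kappa> (?c t)) = \<pi> p"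
      using inj W'(3) k(2) proj_in V(2) p by blast
    then show ?thesis using h0 k(1) by blast
  qed
  have "((\<lambda>t::real. a + t *\<^sub>R v) has_derivative (\<lambda>t. t *\<^sub>R v)) (at 0)"
    by (auto intro!: derivative_eq_intros)
  moreover have "(g has_derivative (\<lambda>v. v)) (at (a + (0::real) *\<^sub>R v))" using dga by simp
  ultimately have "(?c has_derivative (\<lambda>t. t *\<^sub>R v)) (at 0)"
    using diff_chain_at by (fastforce simp: comp_def)
  moreover have "((\<lambda>z. h (\<kappa> z)) has_derivative frechet_derivative (\<lambda>z. h (\<kappa> z)) (at a)) (at (?c 0))"
    using C.chart_has_derivative[OF h pU] ga by (simp add: a_def)
  ultimately have 1: "((\<lambda>t. h (\<kappa> (?c t))) has_derivative
      (\<lambda>t. frechet_derivative (\<lambda>z. h (\<kappa> z)) (at a) (t *\<^sub>R v))) (at 0)"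
    using diff_chain_at by (fastforce simp: comp_def)
  have "0 \<in> ?S" using aV' by simp
  then have "((\<lambda>t. h (\<kappa> (?c t))) has_derivative (\<lambda>t. 0)) (at 0)"
    by (subst has_derivative_cong_open[OF S _ c0]) simp_all
  \<comment> \<open>The velocity of the curve at 0 is \<open>v\<close>, so one derivative is that of
    \<open>h\<close> in direction \<open>v\<close>, which is \<open>u h\<close>; the other is
    0.\<close>
  from has_derivative_unique[OF 1 this] have "frechet_derivative (\<lambda>z. h (\<kappa> z)) (at a) (1 *\<^sub>R v) = 0"
    by (rule fun_cong)
  then show ?thesis using v h by (simp add: C.chart_vec_def a_def)
qed

section \<open>The fibres\<close>

text \<open>\<open>vertical_kills\<close> is the one analytic input about fibres. Taking it as an
  assumption frees the following development from charts.\<close>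

locale contact_fibre = contact_submersion M N \<pi>
  for M :: "('m::topological_space, 'y) contact_space_scheme"
    and N :: "('n::topological_space, 'z) hermitian_space_scheme" and \<pi> :: "'m \<Rightarrow> 'n" +
  fixes r :: 'n
  assumes vertical_kills: "p \<in> points M \<Longrightarrow> u \<in> vertical_space M N \<pi> p \<Longrightarrow> h \<in> smooth_funs M \<Longrightarrow>
    open W \<Longrightarrow> p \<in> W \<Longrightarrow> \<forall>x\<in>W \<inter> points M. \<pi> x = \<pi> p \<longrightarrow> h x = 0 \<Longrightarrow> u h = 0"
begin

abbreviation "S \<equiv> {p \<in> points M. \<pi> p = r}"
abbreviation "F \<equiv> fibre M \<pi> r"
abbreviation "inc \<equiv> dmap M id"

lemma points_fibre: "points F = S"
  by (simp add: fibre_def induced_contact_def Let_def)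

lemma smooth_funs_fibre: "smooth_funs F =
    {f. \<forall>p\<in>S. \<exists>U h. open U \<and> p \<in> U \<and> h \<in> smooth_funs M \<and> (\<forall>x\<in>U \<inter> S. f x = h x)}"
  by (simp add: fibre_def induced_contact_def Let_def sub_space_def)

lemma metric_fibre: "metric_tensor F p u w = gM p (inc u) (inc w)"
  by (simp add: fibre_def induced_contact_def Let_def)

lemma tangent_fibre: "tangent (sub_space M S) = tangent F"
  by (rule ext) (simp add: tangent_def smooth_funs_fibre sub_space_def)

lemma phi_fibre: "phi_tensor F p u = (THE w. w \<in> tangent F p \<and> inc w = phi p (inc u))"
  unfolding tangent_fibre[symmetric] by (simp add: fibre_def induced_contact_def Let_def)

lemma S_points: "p \<in> S \<Longrightarrow> p \<in> points M"
  by simp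

lemma fibre_extension:
  assumes "f \<in> smooth_funs F" "p \<in> S"
  obtains U h where "open U" "p \<in> U" "h \<in> smooth_funs M" "\<forall>x\<in>U \<inter> S. f x = h x"
  using assms unfolding smooth_funs_fibre by blast

lemma fibre_funI:
  assumes "\<And>p. p \<in> S \<Longrightarrow> \<exists>U h. open U \<and> p \<in> U \<and> h \<in> smooth_funs M \<and> (\<forall>x\<in>U \<inter> S. f x = h x)"
  shows "f \<in> smooth_funs F"
  using assms unfolding smooth_funs_fibre by blast

lemma restrict_in: "h \<in> smooth_funs M \<Longrightarrow> h \<in> smooth_funs F"
  by (rule fibre_funI) (auto intro!: exI[of _ UNIV])

lemma smooth_ring_fibre: "smooth_ring F"
proof
  show "(\<lambda>_. c) \<in> smooth_funs F" for c
    by (rule restrict_in[OF M.const_in])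
  fix f k assume f: "f \<in> smooth_funs F" and k: "k \<in> smooth_funs F"
  have *: "\<exists>U h l. open U \<and> p \<in> U \<and> h \<in> smooth_funs M \<and> l \<in> smooth_funs M \<and> (\<forall>x\<in>U \<inter> S. f x = h x \<and> k x = l x)"
    if p: "p \<in> S" for p
  proof -
    obtain U h where U: "open U" "p \<in> U" "h \<in> smooth_funs M" "\<forall>x\<in>U \<inter> S. f x = h x"
      by (rule fibre_extension[OF f p])
    obtain V l where V: "open V" "p \<in> V" "l \<in> smooth_funs M" "\<forall>x\<in>V \<inter> S. k x = l x"
      by (rule fibre_extension[OF k p])
    show ?thesis
      using U V by (intro exI[of _ "U \<inter> V"] exI[of _ h] exI[of _ l]) auto
  qed
  show "(\<lambda>x. f x + k x) \<in> smooth_funs F"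
  proof (rule fibre_funI)
    fix p assume "p \<in> S"
    from *[OF this] obtain U h l where "open U" "p \<in> U" "h \<in> smooth_funs M" "l \<in> smooth_funs M"
      "\<forall>x\<in>U \<inter> S. f x = h x \<and> k x = l x" by (elim exE conjE) (rule that)
    then show "\<exists>U h. open U \<and> p \<in> U \<and> h \<in> smooth_funs M \<and> (\<forall>x\<in>U \<inter> S. f x + k x = h x)"
      by (intro exI[of _ U] exI[of _ "\<lambda>x. h x + l x"]) (simp add: M.add_in)
  qed
  show "(\<lambda>x. f x * k x) \<in> smooth_funs F"
  proof (rule fibre_funI)
    fix p assume "p \<in> S"
    from *[OF this] obtain U h l where "open U" "p \<in> U" "h \<in> smooth_funs M" "l \<in> smooth_funs M"
      "\<forall>x\<in>U \<inter> S. f x = h x \<and> k x = l x" by (elim exE conjE) (rule that)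
    then show "\<exists>U h. open U \<and> p \<in> U \<and> h \<in> smooth_funs M \<and> (\<forall>x\<in>U \<inter> S. f x * k x = h x)"
      by (intro exI[of _ U] exI[of _ "\<lambda>x. h x * l x"]) (simp add: M.mult_in)
  qed
next
  fix f assume *: "\<And>p. p \<in> points F \<Longrightarrow>
    \<exists>U h. open U \<and> p \<in> U \<and> h \<in> smooth_funs F \<and> (\<forall>x\<in>U \<inter> points F. f x = h x)"
  show "f \<in> smooth_funs F"
  proof (rule fibre_funI)
    fix p assume p: "p \<in> S"
    then have "p \<in> points F" by (simp add: points_fibre)
    from *[OF this] obtain U h where U: "open U" "p \<in> U" "h \<in> smooth_funs F" "\<forall>x\<in>U \<inter> S. f x = h x"
      unfolding points_fibre by (elim exE conjE) (rule that)
    obtain V l where V: "open V" "p \<in> V" "l \<in> smooth_funs M" "\<forall>x\<in>V \<inter> S. h x = l x"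
      by (rule fibre_extension[OF U(3) p])
    show "\<exists>U h. open U \<and> p \<in> U \<and> h \<in> smooth_funs M \<and> (\<forall>x\<in>U \<inter> S. f x = h x)"
      using U V by (intro exI[of _ "U \<inter> V"] exI[of _ l]) auto
  qed
next
  fix U p assume U: "open U" "p \<in> U" and "p \<in> points F"
  then have p: "p \<in> points M" by (simp add: points_fibre)
  from M.bump[OF U p] obtain b V where b: "b \<in> smooth_funs M" and V: "open V \<and> p \<in> V \<and>
        (\<forall>x\<in>V \<inter> points M. b x = 1) \<and> (\<forall>x\<in>points M - U. b x = 0)" by (elim bexE exE)
  then show "\<exists>b\<in>smooth_funs F. \<exists>V. open V \<and> p \<in> V \<and> (\<forall>x\<in>V \<inter> points F. b x = 1) \<and> (\<forall>x\<in>points F - U. b x = 0)"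
    using restrict_in[OF b] by (intro bexI[of _ b] exI[of _ V]) (simp_all add: points_fibre)
qed

end

sublocale contact_fibre \<subseteq> F: smooth_ring F
  by (rule smooth_ring_fibre)

context contact_fibre
begin

subsection \<open>Tangent vectors of the fibres\<close>

lemma inc_apply: "f \<in> smooth_funs M \<Longrightarrow> inc u f = u f"
  by (simp add: dmap_def)

lemma inc_outside: "f \<notin> smooth_funs M \<Longrightarrow> inc u f = 0"
  by (simp add: dmap_def)

lemma inc_add: "inc (u + w) = inc u + inc w"
  by (auto simp: dmap_def fun_eq_iff)

lemma inc_tscale: "inc (tscale c u) = tscale c (inc u)"
  by (auto simp: dmap_def fun_eq_iff)

lemma inc_diff: "inc (u - w) = inc u - inc w"
  by (auto simp: dmap_def fun_eq_iff)

lemma inc_0: "inc 0 = 0"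
  by (auto simp: dmap_def fun_eq_iff)

lemma inc_sum: "inc (\<Sum>i\<in>I. u i) = (\<Sum>i\<in>I. inc (u i))"
  by (induction I rule: infinite_finite_induct) (simp_all only: sum.infinite sum.empty sum.insert inc_0 inc_add not_False_eq_True)

text \<open>A pullback from the base is constant along the fibre, so derivations of the fibre kill
  it.\<close>

lemma inc_Ver:
  assumes p: "p \<in> S" and u: "u \<in> tangent F p"
  shows "inc u \<in> Ver p"
proof -
  have "inc u \<in> tangent M p"
  proof (rule tangentI)
    fix f h assume f: "f \<in> smooth_funs M" and h: "h \<in> smooth_funs M"
    show "inc u (\<lambda>x. f x + h x) = inc u f + inc u h"
      using tangent_add_fun[OF u restrict_in[OF f] restrict_in[OF h]] f h M.add_in by (simp add: inc_apply)
    show "inc u (\<lambda>x. f x * h x) = f p * inc u h + h p * inc u f"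
      using tangent_mult_fun[OF u restrict_in[OF f] restrict_in[OF h]] f h M.mult_in by (simp add: inc_apply)
  next
    fix f c assume f: "f \<in> smooth_funs M"
    show "inc u (\<lambda>x. c * f x) = c * inc u f"
      using tangent_cmult_fun[OF u restrict_in[OF f]] f M.cmult_in by (simp add: inc_apply)
  qed (rule inc_outside)
  moreover have "dpi (inc u) f = 0" for f
  proof (cases "f \<in> smooth_funs N")
    case f: True
    have "u (f \<circ> \<pi>) = u (\<lambda>_. f r)"
      by (rule F.tangent_cong[OF u _ F.const_in]) (use p in \<open>simp_all add: points_fibre\<close>)
    then show ?thesis using f pullback[OF f] F.tangent_const[OF u] by (simp add: dpi_apply inc_apply)
  qed (simp add: dmap_def)
  then have "dpi (inc u) = 0" by (simp add: fun_eq_iff)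
  ultimately show ?thesis by (simp add: Ver_iff)
qed

lemma tangent_fibre_extension:
  assumes p: "p \<in> S" and u: "u \<in> tangent F p" and U: "open U" "p \<in> U"
    and h: "h \<in> smooth_funs M" "\<forall>x\<in>U \<inter> S. f x = h x" and f: "f \<in> smooth_funs F"
  shows "u f = inc u h"
  using F.tangent_cong_local[OF u _ U f restrict_in[OF h(1)]] h p by (simp add: points_fibre inc_apply)

lemma inc_inject:
  assumes p: "p \<in> S" and u: "u \<in> tangent F p" and w: "w \<in> tangent F p" and eq: "inc u = inc w"
  shows "u = w"
proof
  fix f
  show "u f = w f"
  proof (cases "f \<in> smooth_funs F")
    case f: True
    obtain U h where U: "open U" "p \<in> U" "h \<in> smooth_funs M" "\<forall>x\<in>U \<inter> S. f x = h x"
      by (rule fibre_extension[OF f p])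
    show ?thesis
      using tangent_fibre_extension[OF p u U f] tangent_fibre_extension[OF p w U f] eq by simp
  qed (simp add: tangent_outside[OF u] tangent_outside[OF w])
qed

text \<open>The inverse of \<open>inc\<close> on vertical vectors: \<open>w\<close> is applied to an
  arbitrary local extension of \<open>f\<close>. The choice does not matter, because
  \<open>vertical_kills\<close> annihilates the difference of two extensions.\<close>

definition res :: "'m \<Rightarrow> 'm tvec \<Rightarrow> 'm tvec" where
  "res p w f = (if f \<in> smooth_funs F
     then w (SOME h. h \<in> smooth_funs M \<and> (\<exists>U. open U \<and> p \<in> U \<and> (\<forall>x\<in>U \<inter> S. f x = h x))) else 0)"

lemma Ver_cong:
  assumes p: "p \<in> S" and w: "w \<in> Ver p" and h: "h \<in> smooth_funs M" "k \<in> smooth_funs M"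
    and U: "open U" "p \<in> U" "\<forall>x\<in>U \<inter> S. h x = k x"
  shows "w h = w k"
proof -
  have "w (\<lambda>x. h x - k x) = 0"
    by (rule vertical_kills[OF S_points[OF p] w M.diff_in[OF h] U(1,2)]) (use U(3) p in auto)
  then show ?thesis using M.tangent_diff_fun[OF Ver_tangent[OF w] h] by simp
qed

lemma res_eq:
  assumes p: "p \<in> S" and w: "w \<in> Ver p" and f: "f \<in> smooth_funs F"
    and U: "open U" "p \<in> U" "h \<in> smooth_funs M" "\<forall>x\<in>U \<inter> S. f x = h x"
  shows "res p w f = w h"
proof -
  let ?P = "\<lambda>h. h \<in> smooth_funs M \<and> (\<exists>U. open U \<and> p \<in> U \<and> (\<forall>x\<in>U \<inter> S. f x = h x))"
  have "?P h" using U by blast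
  then have "?P (Eps ?P)" by (rule someI[of ?P])
  then obtain V where k: "Eps ?P \<in> smooth_funs M" and V: "open V" "p \<in> V" "\<forall>x\<in>V \<inter> S. f x = Eps ?P x"
    by (elim conjE exE) (rule that)
  have "w (Eps ?P) = w h"
  proof (rule Ver_cong[OF p w k U(3) open_Int[OF U(1) V(1)] IntI[OF U(2) V(2)]], rule ballI)
    fix x assume "x \<in> U \<inter> V \<inter> S"
    then have x: "x \<in> U \<inter> S" "x \<in> V \<inter> S" by blast+
    show "Eps ?P x = h x" by (rule trans[OF V(3)[rule_format, OF x(2), symmetric] U(4)[rule_format, OF x(1)]])
  qed
  then show ?thesis using f by (simp add: res_def)
qed

lemma res_tangent:
  assumes p: "p \<in> S" and w: "w \<in> Ver p"
  shows "res p w \<in> tangent F p"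
proof (rule tangentI)
  note wt = Ver_tangent[OF w]
  fix f k assume f: "f \<in> smooth_funs F" and k: "k \<in> smooth_funs F"
  obtain U h where U: "open U" "p \<in> U" "h \<in> smooth_funs M" "\<forall>x\<in>U \<inter> S. f x = h x"
    by (rule fibre_extension[OF f p])
  obtain V l where V: "open V" "p \<in> V" "l \<in> smooth_funs M" "\<forall>x\<in>V \<inter> S. k x = l x"
    by (rule fibre_extension[OF k p])
  have UV: "open (U \<inter> V)" "p \<in> U \<inter> V" using U V by auto
  have fp: "f p = h p" "k p = l p" using U V p by auto
  have r: "res p w f = w h" "res p w k = w l" using res_eq[OF p w f U] res_eq[OF p w k V] by auto
  have "res p w (\<lambda>x. f x + k x) = w (\<lambda>x. h x + l x)"
    by (rule res_eq[OF p w F.add_in[OF f k] UV M.add_in[OF U(3) V(3)]]) (use U V in auto)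
  then show "res p w (\<lambda>x. f x + k x) = res p w f + res p w k"
    using tangent_add_fun[OF wt U(3) V(3)] r by simp
  have "res p w (\<lambda>x. f x * k x) = w (\<lambda>x. h x * l x)"
    by (rule res_eq[OF p w F.mult_in[OF f k] UV M.mult_in[OF U(3) V(3)]]) (use U V in auto)
  then show "res p w (\<lambda>x. f x * k x) = f p * res p w k + k p * res p w f"
    using tangent_mult_fun[OF wt U(3) V(3)] r fp by simp
next
  fix f c assume f: "f \<in> smooth_funs F"
  obtain U h where U: "open U" "p \<in> U" "h \<in> smooth_funs M" "\<forall>x\<in>U \<inter> S. f x = h x"
    by (rule fibre_extension[OF f p])
  have "res p w (\<lambda>x. c * f x) = w (\<lambda>x. c * h x)"
    by (rule res_eq[OF p w F.cmult_in[OF f] U(1,2) M.cmult_in[OF U(3)]]) (use U in auto)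
  then show "res p w (\<lambda>x. c * f x) = c * res p w f"
    using tangent_cmult_fun[OF Ver_tangent[OF w] U(3)] res_eq[OF p w f U] by simp
qed (simp add: res_def)

lemma inc_res:
  assumes p: "p \<in> S" and w: "w \<in> Ver p"
  shows "inc (res p w) = w"
proof
  fix h
  show "inc (res p w) h = w h"
  proof (cases "h \<in> smooth_funs M")
    case h: True
    show ?thesis using res_eq[OF p w restrict_in[OF h] open_UNIV UNIV_I h] by (simp add: inc_apply h)
  qed (simp add: inc_outside tangent_outside[OF Ver_tangent[OF w]])
qed

subsection \<open>Vector fields on the fibres\<close>

abbreviation "VF \<equiv> vertical_fields M N \<pi>"

lemma VF_vfields: "X \<in> VF \<Longrightarrow> X \<in> vfields M"
  by (simp add: vertical_fields_def)

lemma VF_Ver: "X \<in> VF \<Longrightarrow> p \<in> points M \<Longrightarrow> X p \<in> Ver p"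
  by (simp add: vertical_fields_def)

lemma VF_vproj: "X \<in> vfields M \<Longrightarrow> app M vp X \<in> VF"
  unfolding vertical_fields_def
  by (auto simp: vfields_vproj app_apply intro: vproj_Ver vfields_tangent)

lemma VF_diff: "X \<in> VF \<Longrightarrow> Y \<in> VF \<Longrightarrow> X - Y \<in> VF"
  by (simp add: vertical_fields_def M.vfields_diff Ver_diff)

lemma VF_phi: "X \<in> VF \<Longrightarrow> app M phi X \<in> VF"
  by (simp add: vertical_fields_def vfields_phi app_apply phi_Ver)

text \<open>A vertical field annihilates every pullback identically, also outside \<open>M\<close>
  where fields are 0. Hence the inner derivative in the bracket is the zero function, and the outer
  one kills it.\<close>

lemma VF_bracket:
  assumes X: "X \<in> VF" and Y: "Y \<in> VF"
  shows "bracket M X Y \<in> VF"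
proof -
  have b: "bracket M X Y \<in> vfields M" by (rule M.vfields_bracket[OF VF_vfields[OF X] VF_vfields[OF Y]])
  have z: "Z q (f \<circ> \<pi>) = 0" if Z: "Z \<in> VF" and f: "f \<in> smooth_funs N" for Z q f
  proof (cases "q \<in> points M")
    case True
    have "dpi (Z q) f = 0" using VF_Ver[OF Z True] by (simp add: Ver_iff)
    then show ?thesis using dpi_apply[OF f] by simp
  qed (simp add: vfields_outside[OF VF_vfields[OF Z]])
  have "bracket M X Y p \<in> Ver p" if p: "p \<in> points M" for p
  proof -
    have "dpi (bracket M X Y p) f = 0" for f
    proof (cases "f \<in> smooth_funs N")
      case f: True
      show ?thesis
        using f pullback[OF f] M.tangent_const[OF vfields_tangent[OF VF_vfields[OF X] p]]
          M.tangent_const[OF vfields_tangent[OF VF_vfields[OF Y] p]]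
        by (simp add: dpi_apply bracket_def z[OF X f] z[OF Y f])
    qed (simp add: dmap_def)
    then have "dpi (bracket M X Y p) = 0" by (simp add: fun_eq_iff)
    then show ?thesis using vfields_tangent[OF b p] by (simp add: Ver_iff)
  qed
  then show ?thesis using b by (simp add: vertical_fields_def)
qed

definition restr :: "'m vfield \<Rightarrow> 'm vfield" where
  "restr W p = (if p \<in> S then res p (W p) else 0)"

lemma vfields_restr:
  assumes W: "W \<in> VF"
  shows "restr W \<in> vfields F"
proof (rule vfieldsI)
  show "restr W p \<in> tangent F p" if "p \<in> points F" for p
    using that res_tangent VF_Ver[OF W] by (simp add: restr_def points_fibre)
  show "restr W p = 0" if "p \<notin> points F" for p
    using that unfolding restr_def points_fibre by (simp only: if_False)
  fix f assume f: "f \<in> smooth_funs F"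
  show "(\<lambda>p. restr W p f) \<in> smooth_funs F"
  proof (rule fibre_funI)
    fix p assume p: "p \<in> S"
    obtain U h where U: "open U" "p \<in> U" "h \<in> smooth_funs M" "\<forall>x\<in>U \<inter> S. f x = h x"
      by (rule fibre_extension[OF f p])
    have "restr W x f = W x h" if x: "x \<in> U \<inter> S" for x
    proof -
      have xS: "x \<in> S" and xU: "x \<in> U" using x by blast+
      show ?thesis
        using res_eq[OF xS VF_Ver[OF W S_points[OF xS]] f U(1) xU U(3,4)] xS by (simp add: restr_def)
    qed
    then show "\<exists>U h. open U \<and> p \<in> U \<and> h \<in> smooth_funs M \<and> (\<forall>x\<in>U \<inter> S. restr W x f = h x)"
      using U vfields_smooth[OF VF_vfields[OF W] U(3)] by (intro exI[of _ U] exI[of _ "\<lambda>x. W x h"]) simp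
  qed
qed

lemma inc_restr: "W \<in> VF \<Longrightarrow> p \<in> S \<Longrightarrow> inc (restr W p) = W p"
  using inc_res[OF _ VF_Ver] by (simp add: restr_def)

text \<open>Agreement is asked on an open \<open>U\<close> only, which avoids partitions of unity.
  Both \<open>X\<close> and \<open>X'\<close> are nevertheless global fields, so brackets and
  connections apply to them directly. \<open>X'\<close> is vertical on all of \<open>M\<close> and
  not merely along the fibre.\<close>

definition extends_on :: "'m set \<Rightarrow> 'm vfield \<Rightarrow> 'm vfield \<Rightarrow> bool" where
  "extends_on U X X' \<longleftrightarrow> X \<in> vfields F \<and> X' \<in> VF \<and> (\<forall>q\<in>U \<inter> S. inc (X q) = X' q)"

lemma extends_on_mono: "extends_on U X X' \<Longrightarrow> V \<subseteq> U \<Longrightarrow> extends_on V X X'"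
  unfolding extends_on_def by blast

lemma extends_on_inc: "extends_on U X X' \<Longrightarrow> q \<in> U \<Longrightarrow> q \<in> S \<Longrightarrow> inc (X q) = X' q"
  unfolding extends_on_def by blast

lemma vproj_tscale:
  assumes p: "p \<in> points M" and u: "u \<in> tangent M p"
  shows "vp p (tscale c u) = tscale c (vp p u)"
proof (rule vproj_eqI[OF p Ver_tscale[OF vproj_Ver[OF p u]]])
  have "tscale c u - tscale c (vp p u) = tscale c (hp p u)"
    by (auto simp: hproj_def fun_eq_iff algebra_simps)
  then show "tscale c u - tscale c (vp p u) \<in> Hor p" using Hor_tscale[OF p hproj_Hor[OF p u]] by simp
qed

lemma vproj_sum:
  assumes p: "p \<in> points M" and u: "\<And>i. i \<in> I \<Longrightarrow> u i \<in> tangent M p" and I: "finite I"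
  shows "vp p (\<Sum>i\<in>I. u i) = (\<Sum>i\<in>I. vp p (u i))"
  using I u
proof (induction I)
  case empty
  show ?case unfolding sum.empty by (rule vproj_of_Ver[OF p Ver_0])
next
  case (insert i I)
  have "vp p (u i + sum u I) = vp p (u i) + vp p (sum u I)"
    using insert.prems by (intro vproj_add[OF p] tangent_sum) auto
  moreover have "vp p (sum u I) = (\<Sum>i\<in>I. vp p (u i))"
    using insert.IH insert.prems by blast
  ultimately show ?case unfolding sum.insert[OF insert.hyps] by (simp only:)
qed

text \<open>The coefficients of \<open>X\<close> in a frame of \<open>M\<close> are smooth on the
  fibre and extend near \<open>p\<close>. The resulting combination agrees with \<open>X\<close>
  along the fibre; projecting it to its vertical part changes nothing there and makes it vertical
  everywhere.\<close>

lemma extends_on_exists: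
  assumes X: "X \<in> vfields F" and p: "p \<in> S"
  shows "\<exists>U X'. open U \<and> p \<in> U \<and> extends_on U X X'"
proof -
  from M.frame[OF S_points[OF p]] obtain Y e U where Y: "finite Y" "Y \<subseteq> smooth_funs M"
    and e: "\<forall>x\<in>Y. e x \<in> vfields M" and U: "open U" "p \<in> U"
    and frame: "\<forall>q\<in>U \<inter> points M. \<forall>u\<in>tangent M q. u = (\<Sum>x\<in>Y. tscale (u x) (e x q))"
    by (elim exE conjE) (rule that)
  have "\<forall>y\<in>Y. \<exists>V h. open V \<and> p \<in> V \<and> h \<in> smooth_funs M \<and> (\<forall>x\<in>V \<inter> S. X x y = h x)"
  proof
    fix y assume "y \<in> Y"
    then have "(\<lambda>x. X x y) \<in> smooth_funs F" using vfields_smooth[OF X restrict_in] Y by blast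
    then show "\<exists>V h. open V \<and> p \<in> V \<and> h \<in> smooth_funs M \<and> (\<forall>x\<in>V \<inter> S. X x y = h x)"
      using p unfolding smooth_funs_fibre by blast
  qed
  then obtain V a where a: "\<forall>y\<in>Y. open (V y) \<and> p \<in> V y \<and> a y \<in> smooth_funs M \<and> (\<forall>x\<in>V y \<inter> S. X x y = a y x)"
    unfolding bchoice_iff by (elim exE) (rule that)
  let ?W = "\<Sum>y\<in>Y. fscale (a y) (e y)"
  have W: "?W \<in> vfields M" using a e by (intro M.vfields_sum M.vfields_fscale) auto
  let ?U = "U \<inter> (\<Inter>y\<in>Y. V y)"
  have "open ?U" "p \<in> ?U" using U a Y(1) by (auto intro!: open_INT)
  moreover have "inc (X q) = app M vp ?W q" if q: "q \<in> ?U \<inter> S" for q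
  proof -
    have qS: "q \<in> S" and qU: "q \<in> U \<inter> points M" and qV: "\<And>y. y \<in> Y \<Longrightarrow> q \<in> V y \<inter> S" using q by auto
    have qp: "q \<in> points M" using qU by blast
    have Xq: "X q \<in> tangent F q" using vfields_tangent[OF X] qS by (simp add: points_fibre)
    note iV = inc_Ver[OF qS Xq]
    have "?W q = (\<Sum>y\<in>Y. tscale (a y q) (e y q))" by (simp only: sum_fun_apply fscale_def)
    also have "\<dots> = (\<Sum>y\<in>Y. tscale (inc (X q) y) (e y q))"
    proof (rule sum.cong[OF refl])
      fix y assume y: "y \<in> Y"
      then have "inc (X q) y = a y q" using a qV[OF y] Y(2) by (auto simp: inc_apply)
      then show "tscale (a y q) (e y q) = tscale (inc (X q) y) (e y q)" by (simp only:)
    qed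
    also have "\<dots> = inc (X q)" by (rule frame[rule_format, OF qU Ver_tangent[OF iV], symmetric])
    finally have eq: "?W q = inc (X q)" .
    show ?thesis unfolding app_apply[OF qp] eq using vproj_of_Ver[OF qp iV] by simp
  qed
  ultimately have "open ?U \<and> p \<in> ?U \<and> extends_on ?U X (app M vp ?W)"
    unfolding extends_on_def using X VF_vproj[OF W] by blast
  then show ?thesis by (intro exI)
qed

text \<open>The expansion of the vertical vector \<open>inc u\<close> in the frame of
  \<open>M\<close> is projected vertically, keeping the same coefficient functions; injectivity of
  \<open>inc\<close> brings it back to the fibre.\<close>

lemma fibre_dual_basis:
  assumes frame: "\<forall>q\<in>U \<inter> points M. \<forall>u\<in>tangent M q. u = (\<Sum>x\<in>Y. tscale (u x) (e x q))"
    and Y: "finite Y" "Y \<subseteq> smooth_funs M" and e: "\<forall>x\<in>Y. e x \<in> vfields M"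
  shows "\<forall>q\<in>U \<inter> points F. \<forall>u\<in>tangent F q. u = (\<Sum>x\<in>Y. tscale (u x) (restr (app M vp (e x)) q))"
proof (intro ballI)
  fix q u assume q: "q \<in> U \<inter> points F" and u: "u \<in> tangent F q"
  have qS: "q \<in> S" and qU: "q \<in> U \<inter> points M" and qp: "q \<in> points M" using q by (auto simp: points_fibre)
  have et: "e x q \<in> tangent M q" if "x \<in> Y" for x using vfields_tangent[OF _ qp] e that by blast
  note iV = inc_Ver[OF qS u]
  show "u = (\<Sum>x\<in>Y. tscale (u x) (restr (app M vp (e x)) q))"
  proof (rule inc_inject[OF qS u])
    show "(\<Sum>x\<in>Y. tscale (u x) (restr (app M vp (e x)) q)) \<in> tangent F q"
      using vfields_tangent[OF vfields_restr[OF VF_vproj]] e q by (intro tangent_sum tangent_tscale) auto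
    have "inc (\<Sum>x\<in>Y. tscale (u x) (restr (app M vp (e x)) q)) = (\<Sum>x\<in>Y. tscale (u x) (inc (restr (app M vp (e x)) q)))"
      unfolding inc_sum inc_tscale ..
    also have "\<dots> = (\<Sum>x\<in>Y. vp q (tscale (inc u x) (e x q)))"
    proof (rule sum.cong[OF refl])
      fix x assume x: "x \<in> Y"
      have "inc (restr (app M vp (e x)) q) = vp q (e x q)"
        using inc_restr[OF VF_vproj[OF e[rule_format, OF x]] qS] unfolding app_apply[OF qp] .
      moreover have "inc u x = u x" using x Y by (auto simp: inc_apply)
      ultimately show "tscale (u x) (inc (restr (app M vp (e x)) q)) = vp q (tscale (inc u x) (e x q))"
        using vproj_tscale[OF qp et[OF x]] by simp
    qed
    also have "\<dots> = vp q (\<Sum>x\<in>Y. tscale (inc u x) (e x q))"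
      by (rule vproj_sum[OF qp tangent_tscale[OF et] Y(1), symmetric])
    also have "(\<Sum>x\<in>Y. tscale (inc u x) (e x q)) = inc u"
      by (rule frame[rule_format, OF qU Ver_tangent[OF iV], symmetric])
    also have "vp q (inc u) = inc u" by (rule vproj_of_Ver[OF qp iV])
    finally show "inc u = inc (\<Sum>x\<in>Y. tscale (u x) (restr (app M vp (e x)) q))" by (rule sym)
  qed
qed

lemma metric_fun_space_fibre: "metric_fun_space F"
proof
  fix p assume "p \<in> points F"
  then have "p \<in> points M" by (simp add: points_fibre)
  from M.frame[OF this] obtain Y e U where Y: "finite Y" "Y \<subseteq> smooth_funs M"
    and e: "\<forall>x\<in>Y. e x \<in> vfields M" and U: "open U" "p \<in> U"
    and frame: "\<forall>q\<in>U \<inter> points M. \<forall>u\<in>tangent M q. u = (\<Sum>x\<in>Y. tscale (u x) (e x q))"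
    by (elim exE conjE) (rule that)
  have 1: "Y \<subseteq> smooth_funs F" using Y(2) restrict_in by blast
  have 2: "\<forall>x\<in>Y. restr (app M vp (e x)) \<in> vfields F"
    using e by (auto intro: vfields_restr VF_vproj)
  show "\<exists>X e U. finite X \<and> X \<subseteq> smooth_funs F \<and> (\<forall>x\<in>X. e x \<in> vfields F) \<and> open U \<and> p \<in> U \<and>
        (\<forall>q\<in>U \<inter> points F. \<forall>u\<in>tangent F q. u = (\<Sum>x\<in>X. tscale (u x) (e x q)))"
    by (rule exI[of _ Y], rule exI[of _ "\<lambda>x. restr (app M vp (e x))"], rule exI[of _ U])
       (intro conjI Y(1) 1 2 U fibre_dual_basis[OF frame Y e])
next
  fix p u assume "p \<in> points F" and u: "u \<in> tangent F p" "u \<noteq> 0"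
  then have p: "p \<in> S" by (simp add: points_fibre)
  have "inc u \<noteq> 0" using inc_inject[OF p u(1) tangent_0] u(2) inc_0 by auto
  then show "0 < metric_tensor F p u u"
    unfolding metric_fibre by (rule M.metric_pos[OF S_points[OF p] Ver_tangent[OF inc_Ver[OF p u(1)]]])
next
  fix p u w assume "p \<in> points F" and u: "u \<in> tangent F p" and w: "w \<in> tangent F p"
  then have p: "p \<in> S" by (simp add: points_fibre)
  note t = Ver_tangent[OF inc_Ver[OF p u]] Ver_tangent[OF inc_Ver[OF p w]]
  show "metric_tensor F p u w = metric_tensor F p w u"
    unfolding metric_fibre by (rule M.metric_sym[OF S_points[OF p] t])
  show "metric_tensor F p (tscale c u) w = c * metric_tensor F p u w" for c
    unfolding metric_fibre inc_tscale by (rule M.metric_tscale[OF S_points[OF p] t])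
  show "metric_tensor F p (u + w) z = metric_tensor F p u z + metric_tensor F p w z" if z: "z \<in> tangent F p" for z
    unfolding metric_fibre inc_add by (rule M.metric_add[OF S_points[OF p] t Ver_tangent[OF inc_Ver[OF p z]]])
next
  fix X Y assume X: "X \<in> vfields F" and Y: "Y \<in> vfields F"
  show "(\<lambda>p. metric_tensor F p (X p) (Y p)) \<in> smooth_funs F"
  proof (rule fibre_funI)
    fix p assume p: "p \<in> S"
    obtain U X' where U: "open U" "p \<in> U" "extends_on U X X'" using extends_on_exists[OF X p] by (elim exE conjE) (rule that)
    obtain V Y' where V: "open V" "p \<in> V" "extends_on V Y Y'" using extends_on_exists[OF Y p] by (elim exE conjE) (rule that)
    have "M.ip X' Y' \<in> smooth_funs M"
      using U(3) V(3) by (intro M.metric_smooth) (auto simp: extends_on_def VF_vfields)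
    moreover have "metric_tensor F x (X x) (Y x) = M.ip X' Y' x" if "x \<in> (U \<inter> V) \<inter> S" for x
      using that extends_on_inc[OF U(3), of x] extends_on_inc[OF V(3), of x] by (simp add: metric_fibre)
    ultimately show "\<exists>U h. open U \<and> p \<in> U \<and> h \<in> smooth_funs M \<and> (\<forall>x\<in>U \<inter> S. metric_tensor F x (X x) (Y x) = h x)"
      using U V by (intro exI[of _ "U \<inter> V"] exI[of _ "M.ip X' Y'"]) auto
  qed
qed

end

sublocale contact_fibre \<subseteq> F: metric_fun_space F
  by (rule metric_fun_space_fibre)

context contact_fibre
begin

lemma riemannian_fun_space_fibre: "riemannian_fun_space F"
proof
  fix L p assume L: "module_functional F L" and "p \<in> points F"
  then have p: "p \<in> S" by (simp add: points_fibre)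
  from M.frame[OF S_points[OF p]] obtain Y e U where Y: "finite Y" "Y \<subseteq> smooth_funs M"
    and e: "\<forall>x\<in>Y. e x \<in> vfields M" and U: "open U" "p \<in> U"
    and frame: "\<forall>q\<in>U \<inter> points M. \<forall>u\<in>tangent M q. u = (\<Sum>x\<in>Y. tscale (u x) (e x q))"
    by (elim exE conjE) (rule that)
  let ?f = "\<lambda>x. restr (app M vp (e x))"
  have f: "\<forall>x\<in>Y. ?f x \<in> vfields F" using e by (auto intro: vfields_restr VF_vproj)
  have "\<forall>y\<in>Y. \<exists>V h. open V \<and> p \<in> V \<and> h \<in> smooth_funs M \<and> (\<forall>x\<in>V \<inter> S. L (?f y) x = h x)"
  proof
    fix y assume "y \<in> Y"
    then have "L (?f y) \<in> smooth_funs F" using L f unfolding module_functional_def by blast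
    then show "\<exists>V h. open V \<and> p \<in> V \<and> h \<in> smooth_funs M \<and> (\<forall>x\<in>V \<inter> S. L (?f y) x = h x)"
      using p unfolding smooth_funs_fibre by blast
  qed
  then obtain V a where a: "\<forall>y\<in>Y. open (V y) \<and> p \<in> V y \<and> a y \<in> smooth_funs M \<and> (\<forall>x\<in>V y \<inter> S. L (?f y) x = a y x)"
    unfolding bchoice_iff by (elim exE) (rule that)
  \<comment> \<open>A functional on \<open>M\<close> that restricts to \<open>L\<close> near
    \<open>p\<close>: the dual basis formula for \<open>L\<close>, with its coefficients extended
    off the fibre. The vertical part of its Riesz representative on \<open>M\<close> represents
    \<open>L\<close> on the fibre.\<close>
  let ?L = "\<lambda>Z q. \<Sum>y\<in>Y. a y q * Z q y"
  have "module_functional M ?L"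
    unfolding module_functional_def
  proof (intro ballI conjI)
    fix Z assume Z: "Z \<in> vfields M"
    show "?L Z \<in> smooth_funs M"
    proof (rule M.sum_in, rule M.mult_in)
      fix y assume y: "y \<in> Y"
      show "a y \<in> smooth_funs M" using a y by blast
      show "(\<lambda>q. Z q y) \<in> smooth_funs M" using vfields_smooth[OF Z] Y y by blast
    qed
  qed (simp_all add: fscale_def sum.distrib distrib_left sum_distrib_left mult.left_commute)
  from M.riesz[OF this] obtain W where W: "W \<in> vfields M"
    and Weq: "\<forall>q\<in>points M. \<forall>Z\<in>vfields M. gM q (W q) (Z q) = ?L Z q" by (elim exE conjE) (rule that)
  let ?U = "U \<inter> (\<Inter>y\<in>Y. V y)"
  have oU: "open ?U" "p \<in> ?U" using U a Y(1) by (auto intro!: open_INT)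
  have "metric_tensor F q (restr (app M vp W) q) (Z q) = L Z q" if q: "q \<in> ?U \<inter> points F" and Z: "Z \<in> vfields F" for q Z
  proof -
    have qS: "q \<in> S" and qp: "q \<in> points M" and qU: "q \<in> U" and qF: "q \<in> points F"
      and qV: "\<And>y. y \<in> Y \<Longrightarrow> q \<in> V y \<inter> S" using q by (auto simp: points_fibre)
    note iV = inc_Ver[OF qS vfields_tangent[OF Z qF]]
    obtain Z' where Z': "Z' \<in> vfields M" "Z' q = inc (Z q)" by (rule M.extend_tangent[OF qp Ver_tangent[OF iV]])
    have "metric_tensor F q (restr (app M vp W) q) (Z q) = gM q (vp q (W q)) (inc (Z q))"
      unfolding metric_fibre inc_restr[OF VF_vproj[OF W] qS] app_apply[OF qp] ..
    also have "\<dots> = gM q (W q) (inc (Z q))" by (rule metric_vproj[OF qp vfields_tangent[OF W qp] iV])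
    also have "\<dots> = ?L Z' q"
      unfolding Z'(2)[symmetric] by (rule Weq[rule_format, OF qp Z'(1)])
    also have "\<dots> = (\<Sum>y\<in>Y. Z q y * L (?f y) q)"
    proof (rule sum.cong[OF refl])
      fix y assume y: "y \<in> Y"
      have "Z' q y = Z q y" using Z'(2) y Y(2) by (auto simp: inc_apply)
      then show "a y q * Z' q y = Z q y * L (?f y) q" using a y qV[OF y] by simp
    qed
    also have "\<dots> = L Z q"
      by (rule F.module_functional_expand[OF L Y(1) _ f U(1) fibre_dual_basis[OF frame Y e] qU qF Z, symmetric])
         (use Y(2) restrict_in in blast)
    finally show ?thesis .
  qed
  then show "\<exists>W\<in>vfields F. \<exists>U. open U \<and> p \<in> U \<and>
        (\<forall>q\<in>U \<inter> points F. \<forall>Z\<in>vfields F. metric_tensor F q (W q) (Z q) = L Z q)"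
    using oU by (intro bexI[OF _ vfields_restr[OF VF_vproj[OF W]]] exI[of _ ?U]) blast
qed

end

sublocale contact_fibre \<subseteq> F: riemannian_fun_space F
  by (rule riemannian_fun_space_fibre)

subsection \<open>The Gauss equation\<close>

context contact_fibre
begin

lemma extends_on_apply:
  assumes r: "extends_on U X X'" and q: "q \<in> U" "q \<in> S" and V: "open V" "q \<in> V"
    and f: "f \<in> smooth_funs F" "h \<in> smooth_funs M" "\<forall>x\<in>V \<inter> S. f x = h x"
  shows "X q f = X' q h"
proof -
  have X: "X q \<in> tangent F q" using r q(2) vfields_tangent[of X F q] by (simp add: extends_on_def points_fibre)
  show ?thesis using tangent_fibre_extension[OF q(2) X V f(2,3,1)] extends_on_inc[OF r q] by simp
qed

lemma extends_on_vfields: "extends_on U X X' \<Longrightarrow> X \<in> vfields F" "extends_on U X X' \<Longrightarrow> X' \<in> VF" "extends_on U X X' \<Longrightarrow> X' \<in> vfields M"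
  by (auto simp: extends_on_def VF_vfields)

lemma extends_on_bracket:
  assumes X: "extends_on U X X'" and Y: "extends_on U Y Y'" and U: "open U"
  shows "extends_on U (bracket F X Y) (bracket M X' Y')"
  unfolding extends_on_def
proof (intro conjI ballI)
  show "bracket F X Y \<in> vfields F" by (rule F.vfields_bracket[OF extends_on_vfields(1)[OF X] extends_on_vfields(1)[OF Y]])
  show "bracket M X' Y' \<in> VF" by (rule VF_bracket[OF extends_on_vfields(2)[OF X] extends_on_vfields(2)[OF Y]])
  fix q assume "q \<in> U \<inter> S"
  then have q: "q \<in> U" "q \<in> S" by blast+
  show "inc (bracket F X Y q) = bracket M X' Y' q"
  proof
    fix f
    show "inc (bracket F X Y q) f = bracket M X' Y' q f"
    proof (cases "f \<in> smooth_funs M")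
      case f: True
      note fF = restrict_in[OF f]
      have e: "\<forall>x\<in>U \<inter> S. Z x f = Z' x f" if Z: "extends_on U Z Z'" for Z Z'
      proof
        fix x assume "x \<in> U \<inter> S"
        then have "inc (Z x) = Z' x" using extends_on_inc[OF Z] by blast
        then show "Z x f = Z' x f" using inc_apply[OF f, of "Z x"] by simp
      qed
      have "X q (\<lambda>x. Y x f) = X' q (\<lambda>x. Y' x f)"
        by (rule extends_on_apply[OF X q U q(1) vfields_smooth[OF extends_on_vfields(1)[OF Y] fF]
              vfields_smooth[OF extends_on_vfields(3)[OF Y] f] e[OF Y]])
      moreover have "Y q (\<lambda>x. X x f) = Y' q (\<lambda>x. X' x f)"
        by (rule extends_on_apply[OF Y q U q(1) vfields_smooth[OF extends_on_vfields(1)[OF X] fF]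
              vfields_smooth[OF extends_on_vfields(3)[OF X] f] e[OF X]])
      ultimately show ?thesis using f fF by (simp add: inc_apply bracket_def)
    qed (simp add: inc_outside bracket_def)
  qed
qed

lemma metric_extends_on:
  assumes "extends_on U X X'" "extends_on U Y Y'" "q \<in> U" "q \<in> S"
  shows "F.ip X Y q = M.ip X' Y' q"
  using extends_on_inc[OF assms(1,3,4)] extends_on_inc[OF assms(2-4)] by (simp add: metric_fibre)

text \<open>Metric products, their derivatives and brackets of extended fields all restrict to the
  fibre on the same \<open>U\<close>.\<close>

lemma koszul_extends_on:
  assumes X: "extends_on U X X'" and Y: "extends_on U Y Y'" and Z: "extends_on U Z Z'" and U: "open U" and q: "q \<in> U" "q \<in> S"
  shows "F.koszul X Y Z q = M.koszul X' Y' Z' q"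
proof -
  have ap: "A q (F.ip B C) = A' q (M.ip B' C')"
    if A: "extends_on U A A'" and B: "extends_on U B B'" and C: "extends_on U C C'" for A A' B B' C C'
    by (rule extends_on_apply[OF A q U q(1) F.metric_smooth[OF extends_on_vfields(1)[OF B] extends_on_vfields(1)[OF C]]
          M.metric_smooth[OF extends_on_vfields(3)[OF B] extends_on_vfields(3)[OF C]]])
       (intro ballI, rule metric_extends_on[OF B C], auto)
  show ?thesis
    unfolding F.koszul_def M.koszul_def
      ap[OF X Y Z] ap[OF Y X Z] ap[OF Z X Y]
      metric_extends_on[OF extends_on_bracket[OF X Y U] Z q] metric_extends_on[OF extends_on_bracket[OF X Z U] Y q]
      metric_extends_on[OF extends_on_bracket[OF Y Z U] X q] ..
qed

abbreviation nab :: "'m vfield \<Rightarrow> 'm vfield \<Rightarrow> 'm vfield" where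
  "nab X Y \<equiv> app M vp (levi_civita M X Y)"

lemma VF_nab: "X \<in> VF \<Longrightarrow> Y \<in> VF \<Longrightarrow> nab X Y \<in> VF"
  by (intro VF_vproj M.levi_civita_vfields VF_vfields)

lemma extends_on_levi_civita:
  assumes X: "extends_on U X X'" and Y: "extends_on U Y Y'" and U: "open U"
  shows "extends_on U (levi_civita F X Y) (nab X' Y')"
  unfolding extends_on_def
proof (intro conjI ballI)
  have D: "levi_civita F X Y \<in> vfields F"
    by (rule F.levi_civita_vfields[OF extends_on_vfields(1)[OF X] extends_on_vfields(1)[OF Y]])
  have D': "levi_civita M X' Y' \<in> vfields M"
    by (rule M.levi_civita_vfields[OF extends_on_vfields(3)[OF X] extends_on_vfields(3)[OF Y]])
  show "levi_civita F X Y \<in> vfields F" by (rule D)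
  show "nab X' Y' \<in> VF" by (rule VF_vproj[OF D'])
  fix q assume "q \<in> U \<inter> S"
  then have q: "q \<in> U" "q \<in> S" and qp: "q \<in> points M" and qF: "q \<in> points F" by (auto simp: points_fibre)
  let ?a = "inc (levi_civita F X Y q)" and ?b = "nab X' Y' q"
  have a: "?a \<in> Ver q" by (rule inc_Ver[OF q(2) vfields_tangent[OF D qF]])
  have b: "?b \<in> Ver q" by (rule VF_Ver[OF VF_vproj[OF D'] qp])
  have eq: "gM q ?a z = gM q ?b z" if z: "z \<in> Ver q" for z
  proof -
    \<comment> \<open>The test vector is extended twice: to a field on the fibre, and from there to
      a vertical field on \<open>M\<close>, which makes the two Koszul expressions
      comparable.\<close>
    obtain Z where Z: "Z \<in> vfields F" "Z q = res q z" by (rule F.extend_tangent[OF qF res_tangent[OF q(2) z]])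
    have iz: "inc (Z q) = z" unfolding Z(2) by (rule inc_res[OF q(2) z])
    obtain V Z' where V: "open V" "q \<in> V" "extends_on V Z Z'" using extends_on_exists[OF Z(1) q(2)] by (elim exE conjE) (rule that)
    have Zz: "Z' q = z" using extends_on_inc[OF V(3,2) q(2)] iz by simp
    have UV: "open (U \<inter> V)" "q \<in> U \<inter> V" using U V q by auto
    have "gM q ?a z = F.ip (levi_civita F X Y) Z q" unfolding metric_fibre iz ..
    also have "\<dots> = F.koszul X Y Z q"
      by (rule F.levi_civita_koszul[OF extends_on_vfields(1)[OF X] extends_on_vfields(1)[OF Y] Z(1) qF])
    also have "\<dots> = M.koszul X' Y' Z' q"
      by (rule koszul_extends_on[OF extends_on_mono[OF X] extends_on_mono[OF Y] extends_on_mono[OF V(3)] UV q(2)]) auto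
    also have "\<dots> = M.ip (levi_civita M X' Y') Z' q"
      by (rule M.levi_civita_koszul[OF extends_on_vfields(3)[OF X] extends_on_vfields(3)[OF Y] extends_on_vfields(3)[OF V(3)] qp, symmetric])
    also have "\<dots> = gM q ?b z"
      unfolding Zz app_apply[OF qp] by (rule metric_vproj[OF qp vfields_tangent[OF D' qp] z, symmetric])
    finally show ?thesis .
  qed
  \<comment> \<open>Only vertical test vectors are available, but the difference is itself vertical
    and may be tested against itself.\<close>
  show "?a = ?b"
  proof (rule ccontr)
    assume "?a \<noteq> ?b"
    then have "?a - ?b \<noteq> 0" by (simp only: right_minus_eq not_False_eq_True)
    then have "gM q (?a - ?b) (?a - ?b) > 0"
      by (rule M.metric_pos[OF qp tangent_diff[OF Ver_tangent[OF a] Ver_tangent[OF b]]])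
    moreover have "gM q (?a - ?b) (?a - ?b) = 0"
      using M.metric_diff[OF qp Ver_tangent[OF a] Ver_tangent[OF b] Ver_tangent[OF Ver_diff[OF a b]]]
        eq[OF Ver_diff[OF a b]] by linarith
    ultimately show False by linarith
  qed
qed

lemma extends_on_diff: "extends_on U X X' \<Longrightarrow> extends_on U Y Y' \<Longrightarrow> extends_on U (X - Y) (X' - Y')"
  unfolding extends_on_def by (auto intro: F.vfields_diff VF_diff simp: inc_diff)

definition nab_curv :: "'m vfield \<Rightarrow> 'm vfield \<Rightarrow> 'm vfield \<Rightarrow> 'm vfield" where
  "nab_curv X Y Z = nab X (nab Y Z) - nab Y (nab X Z) - nab (bracket M X Y) Z"

text \<open>The covariant derivative of extended fields is again extended on the same
  \<open>U\<close>, so iterated derivatives require no shrinking of neighbourhoods and no separate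
  locality argument for the connection.\<close>

lemma riemann_fibre:
  assumes X: "extends_on U X X'" and Y: "extends_on U Y Y'" and Z: "extends_on U Z Z'" and W: "extends_on U W W'"
    and U: "open U" and q: "q \<in> U" "q \<in> S"
  shows "riemann F X Y Z W q = gM q (nab_curv X' Y' Z' q) (W' q)"
proof -
  note D = extends_on_levi_civita[OF _ _ U]
  have "extends_on U (curvature_op F X Y Z) (nab_curv X' Y' Z')"
    unfolding curvature_op_def nab_curv_def Let_def
    by (rule extends_on_diff[OF extends_on_diff[OF D[OF X D[OF Y Z]] D[OF Y D[OF X Z]]] D[OF extends_on_bracket[OF X Y U] Z]])
  from metric_extends_on[OF this W q] show ?thesis unfolding riemann_def .
qed

lemma phi_fibre_eq:
  assumes p: "p \<in> S" and u: "u \<in> tangent F p"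
  shows "phi_tensor F p u = res p (phi p (inc u))"
proof -
  have v: "phi p (inc u) \<in> Ver p" by (rule phi_Ver[OF S_points[OF p] inc_Ver[OF p u]])
  show ?thesis
    unfolding phi_fibre
  proof (rule the_equality)
    show "res p (phi p (inc u)) \<in> tangent F p \<and> inc (res p (phi p (inc u))) = phi p (inc u)"
      using res_tangent[OF p v] inc_res[OF p v] by (rule conjI)
    show "w = res p (phi p (inc u))" if "w \<in> tangent F p \<and> inc w = phi p (inc u)" for w
      by (rule inc_inject[OF p conjunct1[OF that] res_tangent[OF p v]])
         (simp only: inc_res[OF p v] conjunct2[OF that])
  qed
qed

lemma vfields_phi_fibre:
  assumes X: "X \<in> vfields F"
  shows "app F (phi_tensor F) X \<in> vfields F"
proof (rule F.vfields_localI)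
  show "app F (phi_tensor F) X p = 0" if "p \<notin> points F" for p using that by (simp add: app_def)
  fix p assume "p \<in> points F"
  then have p: "p \<in> S" by (simp add: points_fibre)
  obtain U X' where U: "open U" "p \<in> U" "extends_on U X X'" using extends_on_exists[OF X p] by (elim exE conjE) (rule that)
  have "app F (phi_tensor F) X q = restr (app M phi X') q" if q: "q \<in> U \<inter> points F" for q
  proof -
    have qF: "q \<in> points F" and qS: "q \<in> S" and qU: "q \<in> U" and qp: "q \<in> points M"
      using q by (auto simp: points_fibre)
    have "app F (phi_tensor F) X q = phi_tensor F q (X q)" using qF by (simp add: app_def)
    also have "\<dots> = res q (phi q (X' q))"
      unfolding phi_fibre_eq[OF qS vfields_tangent[OF X qF]] extends_on_inc[OF U(3) qU qS] ..
    also have "\<dots> = restr (app M phi X') q" using qS by (simp add: restr_def app_def)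
    finally show ?thesis .
  qed
  then show "\<exists>U Y. open U \<and> p \<in> U \<and> Y \<in> vfields F \<and> (\<forall>q\<in>U \<inter> points F. app F (phi_tensor F) X q = Y q)"
    using U vfields_restr[OF VF_phi[OF extends_on_vfields(2)[OF U(3)]]]
    by (intro exI[of _ U] exI[of _ "restr (app M phi X')"]) simp
qed

lemma extends_on_phi:
  assumes X: "extends_on U X X'"
  shows "extends_on U (app F (phi_tensor F) X) (app M phi X')"
  unfolding extends_on_def
proof (intro conjI ballI)
  show "app F (phi_tensor F) X \<in> vfields F" by (rule vfields_phi_fibre[OF extends_on_vfields(1)[OF X]])
  show "app M phi X' \<in> VF" by (rule VF_phi[OF extends_on_vfields(2)[OF X]])
  fix q assume "q \<in> U \<inter> S"
  then have q: "q \<in> U" "q \<in> S" and qp: "q \<in> points M" and qF: "q \<in> points F" by (auto simp: points_fibre)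
  note Xq = vfields_tangent[OF extends_on_vfields(1)[OF X] qF]
  have "app F (phi_tensor F) X q = res q (phi q (inc (X q)))"
    using qF phi_fibre_eq[OF q(2) Xq] by (simp add: app_def)
  then have "inc (app F (phi_tensor F) X q) = phi q (inc (X q))"
    using inc_res[OF q(2) phi_Ver[OF qp inc_Ver[OF q(2) Xq]]] by simp
  then show "inc (app F (phi_tensor F) X q) = app M phi X' q"
    unfolding extends_on_inc[OF X q] app_apply[OF qp] .
qed

section \<open>The second fundamental form and the curvature comparison\<close>

abbreviation sff :: "'m vfield \<Rightarrow> 'm vfield \<Rightarrow> 'm vfield" where
  "sff X Y \<equiv> app M hp (levi_civita M X Y)"

lemma oneill_T_VF:
  assumes X: "X \<in> VF" and Y: "Y \<in> VF"
  shows "oneill_T M N \<pi> X Y = sff X Y"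
proof -
  have v: "app M vp Z = Z" and h: "app M hp Z = 0" if Z: "Z \<in> VF" for Z
    using vproj_of_Ver VF_Ver[OF Z] vfields_outside[OF VF_vfields[OF Z]]
    by (auto simp: app_def hproj_def fun_eq_iff)
  have "app M vp 0 = 0" using vproj_of_Ver[OF _ Ver_0] by (auto simp: app_def fun_eq_iff)
  then show ?thesis
    unfolding oneill_T_def Let_def v[OF X] v[OF Y] h[OF Y] levi_civita_zero_right[OF VF_vfields[OF X]]
    by (simp only: add_0_right)
qed

text \<open>The product of the horizontal field \<open>sff Y Z\<close> with the vertical field
  \<open>W\<close> is 0 on all of \<open>M\<close>. Differentiating it along \<open>X\<close> moves
  the derivative onto \<open>W\<close>, where only the horizontal part \<open>sff X W\<close> is
  paired with \<open>sff Y Z\<close>.\<close>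

lemma metric_levi_civita_nab:
  assumes X: "X \<in> VF" and Y: "Y \<in> VF" and Z: "Z \<in> VF" and W: "W \<in> VF" and p: "p \<in> points M"
  shows "gM p (levi_civita M X (levi_civita M Y Z) p) (W p) =
    gM p (nab X (nab Y Z) p) (W p) - gM p (sff Y Z p) (sff X W p)"
proof -
  note v = VF_vfields
  have D: "levi_civita M Y Z \<in> vfields M" by (rule M.levi_civita_vfields[OF v[OF Y] v[OF Z]])
  have n: "nab Y Z \<in> VF" by (rule VF_vproj[OF D])
  have s: "sff Y Z \<in> vfields M" by (rule vfields_hproj[OF D])
  have sH: "sff Y Z q \<in> Hor q" if "q \<in> points M" for q
    unfolding app_apply[OF that] by (rule hproj_Hor[OF that vfields_tangent[OF D that]])
  have dec: "levi_civita M Y Z = nab Y Z + sff Y Z"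
    using vfields_outside[OF D] by (auto simp: app_def hproj_def fun_eq_iff)
  have DXW: "levi_civita M X W \<in> vfields M" by (rule M.levi_civita_vfields[OF v[OF X] v[OF W]])
  have "levi_civita M X (levi_civita M Y Z) = levi_civita M X (nab Y Z) + levi_civita M X (sff Y Z)"
    by (subst dec) (rule M.levi_civita_add[OF v[OF X] v[OF n] s])
  then have 1: "gM p (levi_civita M X (levi_civita M Y Z) p) (W p) =
      gM p (levi_civita M X (nab Y Z) p) (W p) + gM p (levi_civita M X (sff Y Z) p) (W p)"
    using M.metric_add[OF p vfields_tangent[OF M.levi_civita_vfields[OF v[OF X] v[OF n]] p]
        vfields_tangent[OF M.levi_civita_vfields[OF v[OF X] s] p] vfields_tangent[OF v[OF W] p]] by simp
  have 2: "gM p (levi_civita M X (nab Y Z) p) (W p) = gM p (nab X (nab Y Z) p) (W p)"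
    unfolding app_apply[OF p]
    by (rule metric_vproj[OF p vfields_tangent[OF M.levi_civita_vfields[OF v[OF X] VF_vfields] p] VF_Ver[OF W p], symmetric])
       (use n in \<open>simp add: app_apply[OF p]\<close>)
  have "X p (M.ip (sff Y Z) W) = X p (\<lambda>_. 0)"
    by (rule M.tangent_cong[OF vfields_tangent[OF v[OF X] p] p M.const_in])
       (rule Hor_Ver[OF sH VF_Ver[OF W]])
  also have "\<dots> = 0" by (rule M.tangent_const[OF vfields_tangent[OF v[OF X] p]])
  finally have "gM p (levi_civita M X (sff Y Z) p) (W p) = - gM p (sff Y Z p) (levi_civita M X W p)"
    using M.levi_civita_metric[OF v[OF X] s v[OF W] p] by linarith
  also have "gM p (sff Y Z p) (levi_civita M X W p) = gM p (sff Y Z p) (sff X W p)"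
  proof -
    note t = vfields_tangent[OF DXW p]
    have e: "levi_civita M X W p = vp p (levi_civita M X W p) + hp p (levi_civita M X W p)"
      by (rule vproj_hproj[OF p])
    have "gM p (sff Y Z p) (vp p (levi_civita M X W p) + hp p (levi_civita M X W p)) =
       gM p (sff Y Z p) (vp p (levi_civita M X W p)) + gM p (sff Y Z p) (hp p (levi_civita M X W p))"
      by (rule M.metric_add_right[OF p Ver_tangent[OF vproj_Ver[OF p t]] Hor_tangent[OF hproj_Hor[OF p t]]
            vfields_tangent[OF s p]])
    then show ?thesis
      unfolding e[symmetric] app_apply[OF p, of hp "levi_civita M X W"]
        Hor_Ver[OF sH[OF p] vproj_Ver[OF p t]] by simp
  qed
  finally show ?thesis using 1 2 by linarith
qed

text \<open>The previous identity is used for \<open>X\<close>, \<open>Y\<close> and for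
  \<open>Y\<close>, \<open>X\<close>. The bracket term gives no correction, because only its
  vertical part pairs with \<open>W\<close>.\<close>

lemma Gauss:
  assumes X: "X \<in> VF" and Y: "Y \<in> VF" and Z: "Z \<in> VF" and W: "W \<in> VF" and p: "p \<in> points M"
  shows "riemann M X Y Z W p = gM p (nab_curv X Y Z p) (W p)
    - gM p (sff Y Z p) (sff X W p) + gM p (sff X Z p) (sff Y W p)"
proof -
  note v = VF_vfields and b = VF_bracket[OF X Y]
  note Wt = vfields_tangent[OF v[OF W] p]
  have t: "levi_civita M A (levi_civita M B Z) p \<in> tangent M p" "nab A (nab B Z) p \<in> tangent M p"
    if "A \<in> VF" "B \<in> VF" for A B
    using that Z vfields_tangent[OF M.levi_civita_vfields[OF v M.levi_civita_vfields[OF v v]] p]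
      vfields_tangent[OF v[OF VF_nab[OF _ VF_nab]] p] by blast+
  have tb: "levi_civita M (bracket M X Y) Z p \<in> tangent M p" "nab (bracket M X Y) Z p \<in> tangent M p"
    using vfields_tangent[OF M.levi_civita_vfields[OF v[OF b] v[OF Z]] p] vfields_tangent[OF v[OF VF_nab[OF b Z]] p] by auto
  have 1: "gM p (levi_civita M (bracket M X Y) Z p) (W p) = gM p (nab (bracket M X Y) Z p) (W p)"
    unfolding app_apply[OF p] by (rule metric_vproj[OF p tb(1) VF_Ver[OF W p], symmetric])
  have "riemann M X Y Z W p = gM p (levi_civita M X (levi_civita M Y Z) p) (W p)
     - gM p (levi_civita M Y (levi_civita M X Z) p) (W p) - gM p (levi_civita M (bracket M X Y) Z p) (W p)"
    unfolding riemann_def curvature_op_def Let_def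
    using t[OF X Y] t[OF Y X] tb Wt by (simp add: M.metric_diff[OF p] tangent_diff)
  moreover have "gM p (nab_curv X Y Z p) (W p) = gM p (nab X (nab Y Z) p) (W p)
     - gM p (nab Y (nab X Z) p) (W p) - gM p (nab (bracket M X Y) Z p) (W p)"
    unfolding nab_curv_def
    using t[OF X Y] t[OF Y X] tb Wt by (simp add: M.metric_diff[OF p] tangent_diff)
  ultimately show ?thesis
    using 1 metric_levi_civita_nab[OF X Y Z W p] metric_levi_civita_nab[OF Y X Z W p] by linarith
qed

theorem K1_phi_fibre:
  assumes K: "K1_phi M" and T: "T_phi_bilinear M N \<pi>"
  shows "K1_phi F"
  unfolding K1_phi_def
proof (intro ballI)
  fix X Y Z W p
  assume X: "X \<in> vfields F" and Y: "Y \<in> vfields F" and Z: "Z \<in> vfields F" and W: "W \<in> vfields F"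
    and "p \<in> points F"
  then have p: "p \<in> S" and pM: "p \<in> points M" by (auto simp: points_fibre)
  obtain U1 X' where 1: "open U1" "p \<in> U1" "extends_on U1 X X'" using extends_on_exists[OF X p] by (elim exE conjE) (rule that)
  obtain U2 Y' where 2: "open U2" "p \<in> U2" "extends_on U2 Y Y'" using extends_on_exists[OF Y p] by (elim exE conjE) (rule that)
  obtain U3 Z' where 3: "open U3" "p \<in> U3" "extends_on U3 Z Z'" using extends_on_exists[OF Z p] by (elim exE conjE) (rule that)
  obtain U4 W' where 4: "open U4" "p \<in> U4" "extends_on U4 W W'" using extends_on_exists[OF W p] by (elim exE conjE) (rule that)
  define U where "U = U1 \<inter> U2 \<inter> U3 \<inter> U4"
  have U: "open U" "p \<in> U" using 1 2 3 4 by (auto simp: U_def)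
  have sub: "U \<subseteq> U1" "U \<subseteq> U2" "U \<subseteq> U3" "U \<subseteq> U4" by (auto simp: U_def)
  note R = extends_on_mono[OF 1(3) sub(1)] extends_on_mono[OF 2(3) sub(2)] extends_on_mono[OF 3(3) sub(3)] extends_on_mono[OF 4(3) sub(4)]
  note V = extends_on_vfields(2)[OF R(1)] extends_on_vfields(2)[OF R(2)] extends_on_vfields(2)[OF R(3)] extends_on_vfields(2)[OF R(4)]
  let ?Z = "app M phi Z'" and ?W = "app M phi W'"
  have sphi: "sff A (app M phi B) p = phi p (sff A B p)" if A: "A \<in> VF" and B: "B \<in> VF" for A B
  proof -
    have "oneill_T M N \<pi> A (app M phi B) = app M phi (oneill_T M N \<pi> A B)"
      using T A B by (simp add: T_phi_bilinear_def)
    then have "sff A (app M phi B) = app M phi (sff A B)"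
      unfolding oneill_T_VF[OF A B] oneill_T_VF[OF A VF_phi[OF B]] .
    from fun_cong[OF this, of p] show ?thesis unfolding app_apply[OF pM, of phi] .
  qed
  have sH: "sff A B p \<in> Hor p" if A: "A \<in> VF" and B: "B \<in> VF" for A B
    unfolding app_apply[OF pM]
    by (rule hproj_Hor[OF pM vfields_tangent[OF M.levi_civita_vfields[OF VF_vfields[OF A] VF_vfields[OF B]] pM]])
  have sm: "gM p (sff A ?Z p) (sff B ?W p) = gM p (sff A Z' p) (sff B W' p)" if A: "A \<in> VF" and B: "B \<in> VF" for A B
    unfolding sphi[OF A V(3)] sphi[OF B V(4)] by (rule phi_metric_Hor[OF pM sH[OF A V(3)] sH[OF B V(4)]])
  have "riemann M X' Y' Z' W' p = riemann M X' Y' ?Z ?W p"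
    using K V pM unfolding K1_phi_def by (simp add: VF_vfields)
  then have "gM p (nab_curv X' Y' Z' p) (W' p) = gM p (nab_curv X' Y' ?Z p) (?W p)"
    using Gauss[OF V pM] Gauss[OF V(1,2) VF_phi[OF V(3)] VF_phi[OF V(4)] pM] sm[OF V(2,1)] sm[OF V(1,2)] by linarith
  then show "riemann F X Y Z W p = riemann F X Y (app F (phi_tensor F) Z) (app F (phi_tensor F) W) p"
    unfolding riemann_fibre[OF R U p] riemann_fibre[OF R(1,2) extends_on_phi[OF R(3)] extends_on_phi[OF R(4)] U p] .
qed

end

lemma contact_complex_submersion_contact_submersion:
  assumes "contact_complex_submersion E E' M N \<pi>"
  shows "contact_submersion M N \<pi>"
proof -
  interpret submersion M N \<pi>
    using assms by (intro riemannian_submersion_submersion[of E E']) (simp add: contact_complex_submersion_def)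
  show ?thesis
    using assms by unfold_locales
      (simp_all add: contact_complex_submersion_def almost_contact_metric_manifold_def almost_hermitian_manifold_def)
qed

lemma contact_complex_submersion_contact_fibre:
  assumes "contact_complex_submersion E E' M N \<pi>"
  shows "contact_fibre M N \<pi>"
proof -
  interpret contact_submersion M N \<pi>
    by (rule contact_complex_submersion_contact_submersion[OF assms])
  have s: "riemannian_submersion E E' M N \<pi>"
    using assms by (simp add: contact_complex_submersion_def)
  show ?thesis
    by unfold_locales (rule vertical_vanish[OF s])
qed

theorem proposition3p5:
  fixes E :: "'a::euclidean_space set" and E' :: "'b::euclidean_space set"
    and M :: "'m::{t2_space, second_countable_topology} contact_space"
    and N :: "'n::{t2_space, second_countable_topology} hermitian_space"
    and \<pi> :: "'m \<Rightarrow> 'n"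
  assumes "contact_complex_submersion E E' M N \<pi>"
    and "K1_phi M"
  shows "(T_phi_bilinear M N \<pi> \<longrightarrow> (\<forall>q\<in>points N. K1_phi (fibre M \<pi> q))) \<and>
    (oneill_A_vanishes M N \<pi> \<longrightarrow> K1 N)"
proof (intro conjI impI ballI)
  show "K1_phi (fibre M \<pi> q)" if "T_phi_bilinear M N \<pi>" for q
    by (rule contact_fibre.K1_phi_fibre[OF contact_complex_submersion_contact_fibre[OF assms(1)] assms(2) that])
  show "K1 N" if "oneill_A_vanishes M N \<pi>"
    by (rule contact_submersion.K1_base[OF contact_complex_submersion_contact_submersion[OF assms(1)] assms(2) that])
qed

end
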